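(* Let $\mathcal{D}$ be a non-ascending deformation space of $G$-trees. Any two reduced simplicial trees $T,T'\in\mathcal{D}$ may be connected by a finite sequence of slide moves.
   Context: $G$ is a finitely generated group. A $G$-tree is a simplicial tree $T$ with an action of $G$ by simplicial automorphisms without inversions, always assumed minimal (no proper $G$-invariant subtree); simplicial $G$-trees are considered up to equivariant isomorphism. $G_v,G_e$ denote vertex and edge stabilizers. A subgroup of $G$ is elliptic in $T$ if it fixes a point. The deformation space $\mathcal{D}$ of a $G$-tree is the set of $G$-trees having the same elliptic subgroups (edge lengths are ignored here). A $G$-tree is irreducible if there are two hyperbolic (non-elliptic) elements with disjoint translation axes; $\mathcal{D}$ is irreducible if its trees are. $T$ is reduced if whenever an edge $e=vw$ satisfies $G_e=G_v$, the vertices $v$ and $w$ are in the same $G$-orbit. View $\Gamma=T/G$ as a graph of groups. A strict ascending loop is an edge of $\Gamma$ with equal endpoints such that exactly one of the two inclusions of its edge group into the vertex group is onto. $\mathcal{D}$ is non-ascending if it is irreducible and no quotient graph of groups $\Gamma=T/G$ with $T\in\mathcal{D}$ contains a strict ascending loop. Slide move: let $e=vw$ and $f=vx$ be edges of $T$ with common vertex $v$, with $G_f\subset G_e$, and with $e,f$ not in the same $G$-orbit as non-oriented edges. The tree $T'$ obtained from $T$ by sliding $f$ across $e$ has the same vertex set as $T$, with $f$ replaced by an edge $f'=wx$, and this replacement extended $G$-equivariantly to the orbit of $f$. *)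

theory Defs
  imports "HOL-Algebra.Algebra"
begin

section \<open>Simplicial trees\<close>

definition adjacent :: "'v set set \<Rightarrow> 'v rel" where
  "adjacent E = {(u, w). {u, w} \<in> E}"

text \<open>
  A cycle is listed without repeating its first vertex; the condition that its length is at least 3
  is needed because a single edge \<open>{u, w}\<close> would otherwise give the closed walk \<open>u, w\<close>.
\<close>
definition graph_cycle :: "'v set set \<Rightarrow> 'v list \<Rightarrow> bool" where
  "graph_cycle E p \<longleftrightarrow> 3 \<le> length p \<and> distinct p \<and>
     (\<forall>i < length p. {p ! i, p ! (Suc i mod length p)} \<in> E)"

definition simplicial_tree :: "'v set \<Rightarrow> 'v set set \<Rightarrow> bool" where
  "simplicial_tree V E \<longleftrightarrow>
     V \<noteq> {} \<and>
     (\<forall>e \<in> E. \<exists>u \<in> V. \<exists>w \<in> V. u \<noteq> w \<and> e = {u, w}) \<and>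
     (\<forall>u \<in> V. \<forall>w \<in> V. (u, w) \<in> (adjacent E)\<^sup>*) \<and>
     \<not> (\<exists>p. graph_cycle E p)"


section \<open>Trees with a group action\<close>

record ('g, 'v) action_tree =
  verts :: "'v set"
  edges :: "'v set set"
  act :: "'g \<Rightarrow> 'v \<Rightarrow> 'v"

text \<open>The actions on non-oriented and on oriented edges induced by the action on vertices.\<close>

definition edge_act :: "('g, 'v) action_tree \<Rightarrow> 'g \<Rightarrow> 'v set \<Rightarrow> 'v set" where
  "edge_act T g = (`) (act T g)"

definition oriented_edges :: "('g, 'v) action_tree \<Rightarrow> ('v \<times> 'v) set" where
  "oriented_edges T = {(u, w). {u, w} \<in> edges T}"

definition oriented_edge_act :: "('g, 'v) action_tree \<Rightarrow> 'g \<Rightarrow> 'v \<times> 'v \<Rightarrow> 'v \<times> 'v" where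
  "oriented_edge_act T g = map_prod (act T g) (act T g)"

abbreviation vertex_stabilizer ::
    "('g, 'm) monoid_scheme \<Rightarrow> ('g, 'v) action_tree \<Rightarrow> 'v \<Rightarrow> 'g set" where
  "vertex_stabilizer G T \<equiv> stabilizer G (act T)"

abbreviation edge_stabilizer ::
    "('g, 'm) monoid_scheme \<Rightarrow> ('g, 'v) action_tree \<Rightarrow> 'v set \<Rightarrow> 'g set" where
  "edge_stabilizer G T \<equiv> stabilizer G (edge_act T)"

definition without_inversions :: "('g, 'm) monoid_scheme \<Rightarrow> ('g, 'v) action_tree \<Rightarrow> bool" where
  "without_inversions G T \<longleftrightarrow>
     (\<forall>g \<in> carrier G. \<forall>u w. {u, w} \<in> edges T \<longrightarrow> \<not> (act T g u = w \<and> act T g w = u))"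

definition minimal_action :: "('g, 'm) monoid_scheme \<Rightarrow> ('g, 'v) action_tree \<Rightarrow> bool" where
  "minimal_action G T \<longleftrightarrow>
     (\<forall>V E. simplicial_tree V E \<longrightarrow> V \<subseteq> verts T \<longrightarrow> E \<subseteq> edges T \<longrightarrow>
        (\<forall>g \<in> carrier G. act T g ` V \<subseteq> V \<and> edge_act T g ` E \<subseteq> E) \<longrightarrow>
        V = verts T \<and> E = edges T)"

definition G_tree :: "('g, 'm) monoid_scheme \<Rightarrow> ('g, 'v) action_tree \<Rightarrow> bool" where
  "G_tree G T \<longleftrightarrow>
     simplicial_tree (verts T) (edges T) \<and>
     group_action G (verts T) (act T) \<and>
     (\<forall>g \<in> carrier G. edge_act T g ` edges T \<subseteq> edges T) \<and>
     without_inversions G T \<and>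
     minimal_action G T"

definition equivariantly_isomorphic ::
    "('g, 'm) monoid_scheme \<Rightarrow> ('g, 'v) action_tree \<Rightarrow> ('g, 'w) action_tree \<Rightarrow> bool" where
  "equivariantly_isomorphic G T T' \<longleftrightarrow>
     (\<exists>f. bij_betw f (verts T) (verts T') \<and>
          (`) f ` edges T = edges T' \<and>
          (\<forall>g \<in> carrier G. \<forall>v \<in> verts T. f (act T g v) = act T' g (f v)))"


section \<open>Deformation spaces\<close>

text \<open>
  As the action is without inversions, a subgroup fixing a point in the interior of an edge also
  fixes both endpoints, so only vertices have to be considered here and for \<open>hyperbolic\<close>.
\<close>
definition elliptic :: "('g, 'v) action_tree \<Rightarrow> 'g set \<Rightarrow> bool" where
  "elliptic T H \<longleftrightarrow> (\<exists>v \<in> verts T. \<forall>h \<in> H. act T h v = v)"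

text \<open>
  All trees have their vertices in the type \<open>'v\<close>. If \<open>G\<close> is finitely generated, it is countable, and
  so is every minimal \<open>G\<close>-tree (the convex hull of a single orbit). Hence, if \<open>'v\<close> is infinite, the
  set below contains a representative of every isomorphism class of \<open>G\<close>-trees with the same
  elliptic subgroups as \<open>T\<close>.
\<close>
definition deformation_space ::
    "('g, 'm) monoid_scheme \<Rightarrow> ('g, 'v) action_tree \<Rightarrow> ('g, 'v) action_tree set" where
  "deformation_space G T =
     {T'. G_tree G T' \<and> (\<forall>H. subgroup H G \<longrightarrow> (elliptic T' H \<longleftrightarrow> elliptic T H))}"

definition is_deformation_space ::
    "('g, 'm) monoid_scheme \<Rightarrow> ('g, 'v) action_tree set \<Rightarrow> bool" where
  "is_deformation_space G D \<longleftrightarrow> (\<exists>T. G_tree G T \<and> D = deformation_space G T)"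

definition hyperbolic :: "('g, 'm) monoid_scheme \<Rightarrow> ('g, 'v) action_tree \<Rightarrow> 'g \<Rightarrow> bool" where
  "hyperbolic G T g \<longleftrightarrow> g \<in> carrier G \<and> \<not> (\<exists>v \<in> verts T. act T g v = v)"

text \<open>
  An axis of \<open>g\<close> is a line on which \<open>g\<close> acts as a nontrivial translation, given by its set of
  vertices. Two lines of a tree are disjoint iff their vertex sets are.
\<close>
definition translation_axis :: "('g, 'v) action_tree \<Rightarrow> 'g \<Rightarrow> 'v set \<Rightarrow> bool" where
  "translation_axis T g A \<longleftrightarrow>
     (\<exists>(p :: int \<Rightarrow> 'v) l. inj p \<and> (\<forall>n. {p n, p (n + 1)} \<in> edges T) \<and>
        l > 0 \<and> (\<forall>n. act T g (p n) = p (n + l)) \<and> A = range p)"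

definition irreducible_tree :: "('g, 'm) monoid_scheme \<Rightarrow> ('g, 'v) action_tree \<Rightarrow> bool" where
  "irreducible_tree G T \<longleftrightarrow>
     (\<exists>g h A B. hyperbolic G T g \<and> hyperbolic G T h \<and>
        translation_axis T g A \<and> translation_axis T h B \<and> A \<inter> B = {})"

definition reduced :: "('g, 'm) monoid_scheme \<Rightarrow> ('g, 'v) action_tree \<Rightarrow> bool" where
  "reduced G T \<longleftrightarrow>
     (\<forall>v w. {v, w} \<in> edges T \<longrightarrow> edge_stabilizer G T {v, w} = vertex_stabilizer G T v \<longrightarrow>
        w \<in> orbit G (act T) v)"


section \<open>Quotient graphs of groups\<close>

text \<open>
  Graphs are graphs in the sense of Serre: each non-oriented edge consists of two mutually inverse
  oriented edges. All vertex and edge groups are subgroups of one ambient group.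
\<close>
record ('g, 'x, 'y) graph_of_groups =
  gog_verts :: "'x set"
  gog_edges :: "'y set"
  gog_rev :: "'y \<Rightarrow> 'y"
  gog_origin :: "'y \<Rightarrow> 'x"
  gog_vertex_group :: "'x \<Rightarrow> 'g set"
  gog_edge_group :: "'y \<Rightarrow> 'g set"
  gog_inclusion :: "'y \<Rightarrow> 'g \<Rightarrow> 'g"  \<comment> \<open>from the group of an edge to that of its origin\<close>

definition strict_ascending_loop :: "('g, 'x, 'y) graph_of_groups \<Rightarrow> 'y \<Rightarrow> bool" where
  "strict_ascending_loop \<Gamma> y \<longleftrightarrow>
     y \<in> gog_edges \<Gamma> \<and>
     gog_origin \<Gamma> y = gog_origin \<Gamma> (gog_rev \<Gamma> y) \<and>
     (let onto = (\<lambda>z. gog_inclusion \<Gamma> z ` gog_edge_group \<Gamma> z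
                        = gog_vertex_group \<Gamma> (gog_origin \<Gamma> z))
      in onto y \<noteq> onto (gog_rev \<Gamma> y))"

text \<open>
  In \<open>T/G\<close>, the vertices are the orbits of vertices and the oriented edges are the orbits of oriented
  edges. Choose a representative of each vertex orbit and of each non-oriented edge orbit.  The image
  of an orbit \<open>y\<close> of oriented edges under \<open>\<lambda>(u, w). {u, w}\<close> is the underlying non-oriented orbit; it
  is the same set for \<open>y\<close> and its reverse, so both get the same representative \<open>edge_rep y\<close>.
  The origin of \<open>edge_rep y\<close>, oriented as in \<open>y\<close>, is \<open>origin_rep y\<close>; it is unique in the absence of
  inversions. The inclusion of the edge group is conjugation by an element moving \<open>origin_rep y\<close>
  to the representative of its orbit.
\<close>

definition vertex_rep :: "'v set \<Rightarrow> 'v" where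
  "vertex_rep x = (SOME v. v \<in> x)"

definition edge_rep :: "('v \<times> 'v) set \<Rightarrow> 'v set" where
  "edge_rep y = (SOME e. e \<in> (\<lambda>(u, w). {u, w}) ` y)"

definition origin_rep :: "('v \<times> 'v) set \<Rightarrow> 'v" where
  "origin_rep y = (SOME u. \<exists>w. (u, w) \<in> y \<and> {u, w} = edge_rep y)"

definition transport ::
    "('g, 'm) monoid_scheme \<Rightarrow> ('g, 'v) action_tree \<Rightarrow> ('v \<times> 'v) set \<Rightarrow> 'g" where
  "transport G T y = (SOME t. t \<in> carrier G \<and> act T t (origin_rep y) = vertex_rep (fst ` y))"

definition quotient_graph_of_groups ::
    "('g, 'm) monoid_scheme \<Rightarrow> ('g, 'v) action_tree
      \<Rightarrow> ('g, 'v set, ('v \<times> 'v) set) graph_of_groups" where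
  "quotient_graph_of_groups G T =
     \<lparr> gog_verts = orbits G (verts T) (act T),
       gog_edges = orbits G (oriented_edges T) (oriented_edge_act T),
       gog_rev = (`) prod.swap,
       gog_origin = (`) fst,
       gog_vertex_group = (\<lambda>x. vertex_stabilizer G T (vertex_rep x)),
       gog_edge_group = (\<lambda>y. edge_stabilizer G T (edge_rep y)),
       gog_inclusion =
         (\<lambda>y h. transport G T y \<otimes>\<^bsub>G\<^esub> h \<otimes>\<^bsub>G\<^esub> inv\<^bsub>G\<^esub> (transport G T y)) \<rparr>"

definition non_ascending ::
    "('g, 'm) monoid_scheme \<Rightarrow> ('g, 'v) action_tree set \<Rightarrow> bool" where
  "non_ascending G D \<longleftrightarrow>
     (\<forall>T \<in> D. irreducible_tree G T) \<and>
     (\<forall>T \<in> D. \<not> (\<exists>y. strict_ascending_loop (quotient_graph_of_groups G T) y))"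


section \<open>Slide moves\<close>

text \<open>With \<open>e = {v, w}\<close> and \<open>f = {v, x}\<close>, the orbit of \<open>f\<close> is replaced by that of \<open>f' = {w, x}\<close>.\<close>

definition slide_move ::
    "('g, 'm) monoid_scheme \<Rightarrow> ('g, 'v) action_tree \<Rightarrow> ('g, 'v) action_tree \<Rightarrow> bool" where
  "slide_move G T T' \<longleftrightarrow>
     (\<exists>v w x. {v, w} \<in> edges T \<and> {v, x} \<in> edges T \<and>
        edge_stabilizer G T {v, x} \<subseteq> edge_stabilizer G T {v, w} \<and>
        {v, x} \<notin> orbit G (edge_act T) {v, w} \<and>
        T' = T\<lparr>edges := (edges T - orbit G (edge_act T) {v, x}) \<union> orbit G (edge_act T) {w, x}\<rparr>)"

text \<open>
  Trees are considered up to equivariant isomorphism. As slide moves can be transported along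
  isomorphisms, it is enough to allow one at the end of the sequence.
\<close>
definition connected_by_slides ::
    "('g, 'm) monoid_scheme \<Rightarrow> ('g, 'v) action_tree \<Rightarrow> ('g, 'v) action_tree \<Rightarrow> bool" where
  "connected_by_slides G T T' \<longleftrightarrow>
     (\<exists>T''. (slide_move G)\<^sup>*\<^sup>* T T'' \<and> equivariantly_isomorphic G T'' T')"

end

theory Submission
  imports Defs
begin

text \<open>
  As there are no strict ascending loops, in a reduced tree an inclusion between vertex stabilizers
  is an equality and relates vertices of the same orbit. Vertex stabilizers are then determined by
  the elliptic subgroups, so the vertices of \<open>T\<close> and \<open>T'\<close> form isomorphic \<open>G\<close>-sets, and one may
  regard the two trees as sets of edges \<open>E\<close> and \<open>F\<close> on the same \<open>G\<close>-set \<open>V\<close>.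

  Replacing each edge of \<open>E\<close> by the geodesic of \<open>F\<close> between its endpoints gives an equivariant map
  onto \<open>F\<close>, which is factored into folds. An intermediate tree consists of a \<open>G\<close>-tree on \<open>V\<close>
  and, attached to each \<open>v \<in> V\<close>, a subtree of \<open>F\<close> containing \<open>v\<close>; collapsing the attached
  subtrees turns a fold into a sequence of slides. The stabilizer inclusions that the slides need
  could only fail at an ascending edge, and blowing up such an edge would produce a tree of the
  deformation space with a strict ascending loop. The folding stops because each step lowers the
  number of orbits of attached vertices or, keeping it, the length of a shortest path between two
  vertices that are still to be identified.
\<close>

section \<open>Trees and their path metric\<close>

text \<open>The obstacle is equivariance. Moving the branch that starts at \<open>q\<close> from the
  copy at \<open>w\<close> to the copy at \<open>v\<close>, across an edge \<open>vw\<close>, is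
  consistent only if the elements fixing \<open>w\<close> and \<open>q\<close> also fix
  \<open>v\<close>. If they do not, the elements fixing \<open>v\<close> and \<open>q\<close> fix
  \<open>w\<close>, since in a tree one of the two inclusions always holds, and edges at
  \<open>v\<close> can be slid to \<open>w\<close> instead. What remains is the case
  \<open>w = g v\<close>: a translate of the branch then leaves \<open>v\<close> at the same time,
  and it may contain the place that should receive the branch. In this case conjugation by
  \<open>g\<close> maps the group \<open>M\<close> fixing \<open>v\<close> and \<open>q\<close> into
  the edge group \<open>K\<close> of \<open>vw\<close>, and \<open>K \<subseteq> M\<close>; so
  \<open>M = K\<close> unless \<open>K\<close> is conjugated properly into itself. To exclude the
  latter, \<open>vw\<close> is subdivided and the half edge from \<open>w\<close> towards
  \<open>g w\<close> slides over the half edge from \<open>w\<close> to the midpoint: the midpoint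
  has stabilizer \<open>K\<close> and becomes adjacent to its translate, whose stabilizer is
  properly smaller. Maximality of the vertex stabilizers makes this tree minimal, and irreducibility
  makes the vertex set infinite, so that the tree fits into the same vertex type.\<close>

text \<open>Acyclicity is only used in the form that every edge is a bridge.\<close>

definition separates :: "'v set set \<Rightarrow> 'v set \<Rightarrow> 'v \<Rightarrow> 'v \<Rightarrow> bool" where
  "separates E S u w \<longleftrightarrow> u \<notin> S \<and> w \<in> S \<and> (\<forall>a b. {a, b} \<in> E \<longrightarrow> a \<in> S \<longrightarrow> b \<notin> S \<longrightarrow> a = w \<and> b = u)"

locale cut_tree =
  fixes V :: "'v set" and E :: "'v set set"
  assumes edge_ends: "e \<in> E \<Longrightarrow> \<exists>u\<in>V. \<exists>w\<in>V. u \<noteq> w \<and> e = {u, w}"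
    and connected: "u \<in> V \<Longrightarrow> w \<in> V \<Longrightarrow> (u, w) \<in> (adjacent E)\<^sup>*"
    and cut: "{u, w} \<in> E \<Longrightarrow> \<exists>S. separates E S u w"

lemma adjacent_sym: "(u, w) \<in> adjacent E \<Longrightarrow> (w, u) \<in> adjacent E"
  by (simp add: adjacent_def insert_commute)

lemma relpow_adjacent_sym: "(u, w) \<in> adjacent E ^^ n \<Longrightarrow> (w, u) \<in> adjacent E ^^ n"
proof (induction n arbitrary: w)
  case (Suc n)
  then obtain y where "(u, y) \<in> adjacent E ^^ n" "(y, w) \<in> adjacent E" by (auto elim: relpow_Suc_E)
  then show ?case using Suc.IH adjacent_sym relpow_Suc_I2 by metis
qed simp

text \<open>At its first step into \<open>S\<close> the walk can only run over the bridge, from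
  \<open>u\<close> to \<open>w\<close>; the walk is cut there.\<close>

lemma crossing_walk:
  assumes "separates E S u w" "(x, z) \<in> adjacent E ^^ n" "x \<notin> S" "z \<in> S"
  shows "\<exists>i m. n = i + 1 + m \<and> (x, u) \<in> adjacent E ^^ i \<and> (w, z) \<in> adjacent E ^^ m"
  using assms(2,3)
proof (induction n arbitrary: x)
  case 0
  then show ?case using assms(4) by simp
next
  case (Suc n)
  obtain y where y: "(x, y) \<in> adjacent E" "(y, z) \<in> adjacent E ^^ n"
    using Suc.prems(1) by (meson relpow_Suc_D2)
  show ?case
  proof (cases "y \<in> S")
    case True
    have "{y, x} \<in> E" using y(1) by (simp add: adjacent_def insert_commute)
    then have "y = w" "x = u" using True Suc.prems(2) assms(1) by (auto simp: separates_def)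
    then show ?thesis using y(2) by (intro exI[of _ 0] exI[of _ n]) auto
  next
    case False
    then obtain i m where "n = i + 1 + m" "(y, u) \<in> adjacent E ^^ i" "(w, z) \<in> adjacent E ^^ m"
      using Suc.IH y(2) by blast
    then show ?thesis using y(1) relpow_Suc_I2[OF y(1)] by (intro exI[of _ "Suc i"] exI[of _ m]) auto
  qed
qed

section \<open>Distances and geodesics\<close>

definition gdist :: "'v set set \<Rightarrow> 'v \<Rightarrow> 'v \<Rightarrow> nat" where
  "gdist E u w = (LEAST n. (u, w) \<in> adjacent E ^^ n)"

definition between :: "'v set set \<Rightarrow> 'v \<Rightarrow> 'v \<Rightarrow> 'v \<Rightarrow> bool" where
  "between E a z b \<longleftrightarrow> gdist E a z + gdist E z b = gdist E a b"

lemma gdist_le: "(u, w) \<in> adjacent E ^^ n \<Longrightarrow> gdist E u w \<le> n"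
  unfolding gdist_def by (rule Least_le)

lemma gdist_self[simp]: "gdist E u u = 0"
  using gdist_le[of u u 0 E] by simp

lemma gdist_sym: "gdist E u w = gdist E w u"
  unfolding gdist_def using relpow_adjacent_sym by metis

lemma between_sym: "between E a z b \<longleftrightarrow> between E b z a"
  unfolding between_def using gdist_sym by (metis add.commute)

lemma between_left[simp]: "between E a a b" and between_right[simp]: "between E a b b"
  by (auto simp: between_def)

context cut_tree
begin

abbreviation "d \<equiv> gdist E"
abbreviation "btw \<equiv> between E"

lemma edge_in_V: assumes "{u, w} \<in> E" shows "u \<in> V" "w \<in> V" "u \<noteq> w"
  using edge_ends[OF assms] by (auto simp: doubleton_eq_iff)

lemma gdist_walk: assumes "u \<in> V" "w \<in> V" shows "(u, w) \<in> adjacent E ^^ d u w"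
  unfolding gdist_def using rtrancl_imp_relpow[OF connected[OF assms]] by (metis LeastI)

lemma gdist_eq_0: assumes "u \<in> V" "w \<in> V" shows "d u w = 0 \<longleftrightarrow> u = w"
  using gdist_walk[OF assms] by auto

lemma triangle: assumes "u \<in> V" "w \<in> V" "z \<in> V" shows "d u z \<le> d u w + d w z"
  using gdist_le relpow_trans gdist_walk assms by metis

lemma gdist_edge: assumes "{u, w} \<in> E" shows "d u w = 1"
proof -
  have "d u w \<le> 1" using assms by (intro gdist_le) (simp add: adjacent_def)
  moreover have "d u w \<noteq> 0" using edge_in_V[OF assms] gdist_eq_0 by blast
  ultimately show ?thesis by simp
qed

lemma gdist_cross:
  assumes "separates E S u w" "x \<in> V" "z \<in> V" "x \<notin> S" "z \<in> S"
  shows "d x u + 1 + d w z \<le> d x z"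
proof -
  obtain i m where "d x z = i + 1 + m" "(x, u) \<in> adjacent E ^^ i" "(w, z) \<in> adjacent E ^^ m"
    using crossing_walk[OF assms(1) gdist_walk[OF assms(2,3)] assms(4,5)] by blast
  then show ?thesis using gdist_le[of x u i E] gdist_le[of w z m E] by simp
qed

text \<open>A geodesic from one side to the other runs over the bridge. So on \<open>V\<close> the
  cut is determined by the edge, as the set of vertices nearer to \<open>w\<close>; this is the
  source of \<open>half_tree\<close>.\<close>

lemma side:
  assumes "separates E S u w" "{u, w} \<in> E" "z \<in> V"
  shows "z \<in> S \<longleftrightarrow> d u z = Suc (d w z)" "z \<notin> S \<longleftrightarrow> d w z = Suc (d u z)"
proof -
  have S: "u \<notin> S" "w \<in> S" using assms(1) by (auto simp: separates_def)
  note uw = edge_in_V[OF assms(2)]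
  have 1: "d u z \<le> Suc (d w z)" "d w z \<le> Suc (d u z)"
    using triangle[of u w z] triangle[of w u z] uw assms gdist_edge[OF assms(2)] gdist_sym[of E u w] by auto
  have 2: "d u z \<ge> Suc (d w z)" if "z \<in> S" using gdist_cross[OF assms(1) uw(1) assms(3) S(1) that] by simp
  have 3: "d w z \<ge> Suc (d u z)" if "z \<notin> S"
    using gdist_cross[OF assms(1) assms(3) uw(2) that S(2)] gdist_sym[of E z] by simp
  show "z \<in> S \<longleftrightarrow> d u z = Suc (d w z)" "z \<notin> S \<longleftrightarrow> d w z = Suc (d u z)" using 1 2 3 by (cases "z \<in> S"; fastforce)+
qed

text \<open>Trees are bipartite: the end of the edge that lies across the bridge from
  \<open>z\<close> is further away by exactly one step.\<close>

lemma gdist_adj: assumes "{u, w} \<in> E" "z \<in> V" shows "d u z = Suc (d w z) \<or> d w z = Suc (d u z)"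
  using cut[OF assms(1)] side[OF _ assms] by metis

text \<open>If \<open>z\<close> lies beyond the bridge from \<open>u\<close> to \<open>a\<close>,
  another neighbour \<open>b\<close> of \<open>u\<close> stays on the side of \<open>u\<close> and
  is one step further from \<open>z\<close> than \<open>u\<close> itself.\<close>

lemma closer_unique:
  assumes "{u, a} \<in> E" "{u, b} \<in> E" "z \<in> V" "d u z = Suc (d a z)" "d u z = Suc (d b z)"
  shows "a = b"
proof (rule ccontr)
  assume ab: "a \<noteq> b"
  obtain S where S: "separates E S u a" using cut[OF assms(1)] by blast
  have z: "z \<in> S" using side[OF S assms(1,3)] assms(4) by simp
  have b: "b \<notin> S" using S assms(2) ab unfolding separates_def by (metis insert_commute)
  have "d b u + 1 + d a z \<le> d b z" using gdist_cross[OF S _ assms(3) b z] edge_in_V[OF assms(2)] by blast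
  then show False using assms(4,5) by simp
qed

lemma closer_ex: assumes "u \<in> V" "z \<in> V" "u \<noteq> z" shows "\<exists>a. {u, a} \<in> E \<and> d u z = Suc (d a z)"
proof -
  obtain n where n: "d u z = Suc n" using gdist_eq_0 assms by (metis not0_implies_Suc)
  then obtain a where a: "(u, a) \<in> adjacent E" "(a, z) \<in> adjacent E ^^ n"
    using gdist_walk[OF assms(1,2)] by (metis relpow_Suc_D2)
  have e: "{u, a} \<in> E" using a by (simp add: adjacent_def)
  have "d a z \<le> n" using a by (simp add: gdist_le)
  then show ?thesis using gdist_adj[OF e assms(2)] n e by (intro exI[of _ a]) auto
qed

lemma between_trans:
  assumes "btw a z b" "btw a y z" "a \<in> V" "b \<in> V" "y \<in> V" "z \<in> V"
  shows "btw a y b" "btw y z b"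
  using assms triangle[of a y b] triangle[of y z b] by (auto simp: between_def)

lemma between_adjI: assumes "{w, v} \<in> E" "d v q = Suc (d w q)" shows "btw v w q"
  using gdist_edge[OF assms(1)] assms(2) gdist_sym[of E v w] by (simp add: between_def)

lemma between_adj_cases: assumes "{v, w} \<in> E" "q \<in> V" shows "btw v w q \<or> btw w v q"
  using gdist_adj[OF assms] between_adjI assms(1) by (metis insert_commute)

text \<open>Uniqueness of geodesics, by induction on the distance from \<open>a\<close>: the
  predecessors of the two points coincide, and from this common vertex only one step leads towards
  \<open>b\<close>.\<close>

lemma between_unique:
  assumes "btw a z b" "btw a y b" "d a z = d a y" "a \<in> V" "b \<in> V" "y \<in> V" "z \<in> V"
  shows "z = y"
  using assms
proof (induction "d a z" arbitrary: z y)
  case 0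
  then show ?case using gdist_eq_0 by metis
next
  case (Suc n)
  have "z \<noteq> a" "y \<noteq> a" using Suc.hyps(2) Suc.prems(3) by auto
  then obtain z' y' where z': "{z, z'} \<in> E" "d z a = Suc (d z' a)" and y': "{y, y'} \<in> E" "d y a = Suc (d y' a)"
    using closer_ex Suc.prems by metis
  note V = edge_in_V[OF z'(1)] edge_in_V[OF y'(1)]
  have bz: "btw a z' z" "btw a y' y"
    using z' y' gdist_edge[OF z'(1)] gdist_edge[OF y'(1)] gdist_sym[of E] unfolding between_def by (metis Suc_eq_plus1)+
  have b: "btw a z' b" "btw a y' b" "btw z' z b" "btw y' y b"
    using between_trans[OF Suc.prems(1) bz(1)] between_trans[OF Suc.prems(2) bz(2)] Suc.prems V by auto
  have eq: "z' = y'"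
  proof (rule Suc.hyps(1))
    show "n = d a z'" using Suc.hyps(2) z'(2) gdist_sym[of E] by (metis Suc_inject)
    show "d a z' = d a y'" using Suc.prems(3) z'(2) y'(2) gdist_sym[of E] by (metis Suc_inject)
  qed (use b V Suc.prems in auto)
  have "d z' b = Suc (d z b)" "d y' b = Suc (d y b)"
    using b(3,4) gdist_edge[OF z'(1)] gdist_edge[OF y'(1)] gdist_sym[of E z z'] gdist_sym[of E y y'] by (auto simp: between_def)
  moreover have "{z', z} \<in> E" "{z', y} \<in> E" using z' y' eq by (auto simp: insert_commute)
  ultimately show ?case using closer_unique[of z' z y b] Suc.prems eq by simp
qed

text \<open>If both alternatives fail, the step from \<open>z\<close> towards \<open>c\<close> is
  also the step towards \<open>a\<close> and the step towards \<open>b\<close>. One neighbour of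
  \<open>z\<close> is then nearer to both \<open>a\<close> and \<open>b\<close>, although
  \<open>z\<close> lies on the geodesic between them.\<close>

lemma tripod:
  assumes "btw a z b" "a \<in> V" "b \<in> V" "z \<in> V" "c \<in> V"
  shows "btw a z c \<or> btw c z b"
proof (rule ccontr)
  assume neg: "\<not> ?thesis"
  have ne: "z \<noteq> c" "z \<noteq> a" "z \<noteq> b" using neg by auto
  have *: "\<exists>x. {z, x} \<in> E \<and> d z y = Suc (d x y) \<and> d z c = Suc (d x c)" if y: "y \<in> V" "z \<noteq> y" "\<not> btw y z c" for y
  proof -
    obtain x where x: "{z, x} \<in> E" "d z y = Suc (d x y)" using closer_ex[of z y] assms y by blast
    obtain S where S: "separates E S z x" using cut[OF x(1)] by blast
    have yS: "y \<in> S" using side[OF S x(1) y(1)] x(2) by simp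
    have "c \<in> S"
    proof (rule ccontr)
      assume "c \<notin> S"
      then have "d c z + 1 + d x y \<le> d c y" using gdist_cross[OF S assms(5) y(1) _ yS] by simp
      then have "d y z + d z c \<le> d y c" using x(2) gdist_sym[of E] by (metis add.commute add_Suc_right plus_1_eq_Suc add.assoc)
      then have "btw y z c" using triangle[of y z c] assms y by (simp add: between_def)
      then show False using y(3) by simp
    qed
    then show ?thesis using x side[OF S x(1) assms(5)] by auto
  qed
  obtain x where x: "{z, x} \<in> E" "d z a = Suc (d x a)" "d z c = Suc (d x c)" using *[of a] neg assms ne by blast
  obtain y where y: "{z, y} \<in> E" "d z b = Suc (d y b)" "d z c = Suc (d y c)"
    using *[of b] neg assms ne between_sym[of E b z c] by blast
  have "x = y" using closer_unique x y assms by metis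
  then have "d a b \<le> d x a + d x b" using triangle[of a x b] assms edge_in_V[OF x(1)] gdist_sym[of E a x] by simp
  then have "d a b + 2 \<le> d z a + d z b" using x y \<open>x = y\<close> by simp
  then show False using assms(1) gdist_sym[of E a z] by (simp add: between_def)
qed

lemma gdist_two:
  assumes "{v, w} \<in> E" "{v, x} \<in> E" "w \<noteq> x"
  shows "d w x = 2" "btw w v x" "{w, x} \<notin> E"
proof -
  note V = edge_in_V[OF assms(1)] edge_in_V[OF assms(2)]
  have 1: "d v x = 1" "d w v = 1" using assms gdist_edge gdist_sym[of E] by metis+
  have "d w x \<noteq> 0" using assms(3) V gdist_eq_0 by auto
  moreover have "d w x = Suc (d v x) \<or> d v x = Suc (d w x)" using gdist_adj assms(1) V by metis
  ultimately show 2: "d w x = 2" using 1 by simp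
  show "btw w v x" using 1 2 by (simp add: between_def)
  show "{w, x} \<notin> E" using 2 gdist_edge by fastforce
qed

lemma between_adj_other:
  assumes "{v, w} \<in> E" "{v, x} \<in> E" "w \<noteq> x" "btw v w q" "q \<in> V"
  shows "btw x v q"
proof (rule ccontr)
  assume "\<not> ?thesis"
  then have "btw v x q" using between_adj_cases assms by blast
  then have "d v q = Suc (d x q)" using gdist_edge[OF assms(2)] by (simp add: between_def)
  moreover have "d v q = Suc (d w q)" using assms(4) gdist_edge[OF assms(1)] by (simp add: between_def)
  ultimately show False using closer_unique[OF assms(1,2,5)] assms(3) by blast
qed

text \<open>At a vertex of the closed walk farthest from \<open>s 0\<close>, both neighbours along
  the walk are closer to \<open>s 0\<close>, and a vertex has only one closer neighbour.\<close>

lemma backtrack: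
  fixes s :: "nat \<Rightarrow> 'v"
  assumes "s 0 = s n" "\<And>i. i < n \<Longrightarrow> {s i, s (Suc i)} \<in> E" "n > 0"
  shows "\<exists>i. 0 < i \<and> i < n \<and> s (i - 1) = s (i + 1)"
proof -
  have sV: "s i \<in> V" if "i \<le> n" for i
    using that assms edge_in_V by (metis le_less less_Suc_eq_0_disj gr0_implies_Suc lessI)
  define f where "f i = d (s i) (s 0)" for i
  have fin: "finite (f ` {0..n})" "f ` {0..n} \<noteq> {}" by auto
  obtain i where i: "i \<le> n" "f i = Max (f ` {0..n})" using Max_in[OF fin] by force
  have max: "f j \<le> f i" if "j \<le> n" for j using that i Max_ge[OF fin(1)] by simp
  have "f 1 = 1" unfolding f_def using gdist_edge assms(2)[of 0] assms(3) gdist_sym by (metis One_nat_def)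
  then have "f i \<ge> 1" using max[of 1] assms(3) by simp
  moreover have "f 0 = 0" "f n = 0" using assms(1) by (auto simp: f_def)
  ultimately have i': "0 < i" "i < n" using i(1) by (metis not_gr0 not_one_le_zero, metis le_neq_implies_less not_one_le_zero)
  have e: "{s i, s (i - 1)} \<in> E" "{s i, s (i + 1)} \<in> E"
    using assms(2)[of "i - 1"] assms(2)[of i] i' by (auto simp: insert_commute)
  have "d (s i) (s 0) = Suc (d (s (i - 1)) (s 0))" "d (s i) (s 0) = Suc (d (s (i + 1)) (s 0))"
    using gdist_adj[OF e(1), of "s 0"] gdist_adj[OF e(2), of "s 0"] sV[of 0] max[of "i-1"] max[of "i+1"] i' unfolding f_def by linarith+
  then show ?thesis using closer_unique[OF e, of "s 0"] sV[of 0] i' by auto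
qed

text \<open>Every edge of \<open>E\<close> is a bridge, so omitting one would disconnect its
  ends.\<close>

lemma subtree_eq:
  assumes "cut_tree V E'" "E' \<subseteq> E"
  shows "E' = E"
proof (rule ccontr)
  assume "E' \<noteq> E"
  then obtain e where e: "e \<in> E" "e \<notin> E'" using assms by blast
  then obtain u w where uw: "u \<in> V" "w \<in> V" "e = {u, w}" using edge_ends by metis
  obtain S where S: "separates E S u w" using cut e uw by metis
  have n: "{a, b} \<in> E' \<Longrightarrow> a \<in> S \<Longrightarrow> b \<in> S" for a b
    using S e uw assms(2) unfolding separates_def by (metis insert_commute subsetD)
  have "(w, u) \<in> (adjacent E')\<^sup>*" using cut_tree.connected[OF assms(1)] uw by blast
  moreover have "w \<in> S" using S by (simp add: separates_def)
  ultimately have "u \<in> S" by (induction) (auto simp: adjacent_def intro: n)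
  then show False using S by (simp add: separates_def)
qed

end

section \<open>Equivalence of the bridge condition with acyclicity\<close>

lemma simplicial_tree_imp_cut_tree:
  assumes "simplicial_tree V E"
  shows "cut_tree V E"
proof
  fix u w assume e: "{u, w} \<in> E"
  have uw: "u \<noteq> w" using assms e unfolding simplicial_tree_def by (metis doubleton_eq_iff)
  define E' where "E' = E - {{u, w}}"
  \<comment> \<open>The side of \<open>w\<close> after removal of the edge. A shortest walk from
    \<open>w\<close> to \<open>u\<close> avoiding the edge would close up with it to a
    cycle.\<close>
  define S where "S = {x. (w, x) \<in> (adjacent E')\<^sup>*}"
  have "u \<notin> S"
  proof
    assume "u \<in> S"
    then have ex: "\<exists>n. (w, u) \<in> adjacent E' ^^ n" by (simp add: S_def rtrancl_imp_relpow)
    define n where "n = gdist E' w u"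
    have n: "(w, u) \<in> adjacent E' ^^ n" unfolding n_def gdist_def using ex by (rule LeastI_ex)
    then obtain f where f: "f 0 = w" "f n = u" "\<And>i. i < n \<Longrightarrow> (f i, f (Suc i)) \<in> adjacent E'"
      unfolding relpow_fun_conv by blast
    have seg: "(f i, f j) \<in> adjacent E' ^^ (j - i)" if "i \<le> j" "j \<le> n" for i j
      unfolding relpow_fun_conv using that f(3) by (intro exI[of _ "\<lambda>k. f (i + k)"]) auto
    have dist: "f i \<noteq> f j" if "i < j" "j \<le> n" for i j
    proof
      assume eq: "f i = f j"
      have "(w, f i) \<in> adjacent E' ^^ i" "(f j, u) \<in> adjacent E' ^^ (n - j)"
        using seg[of 0 i] seg[of j n] that f by auto
      then have "(w, u) \<in> adjacent E' ^^ (i + (n - j))" using eq relpow_trans by metis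
      then have "n \<le> i + (n - j)" unfolding n_def by (rule gdist_le)
      then show False using that by simp
    qed
    have n2: "2 \<le> n"
    proof (rule ccontr)
      assume "\<not> 2 \<le> n"
      then have "n = 0 \<or> n = 1" by auto
      then show False using n uw by (auto simp: adjacent_def E'_def insert_commute)
    qed
    have "graph_cycle E (map f [0..<Suc n])"
      unfolding graph_cycle_def
    proof (intro conjI allI impI)
      show "3 \<le> length (map f [0..<Suc n])" using n2 by simp
      show "distinct (map f [0..<Suc n])"
        unfolding distinct_map inj_on_def using dist
        by simp (metis antisym_conv3 atLeastLessThan_iff less_Suc_eq_le order_le_less)
      fix i assume i: "i < length (map f [0..<Suc n])"
      show "{map f [0..<Suc n] ! i, map f [0..<Suc n] ! (Suc i mod length (map f [0..<Suc n]))} \<in> E"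
      proof (cases "i = n")
        case True
        then show ?thesis using f e n2 by (simp add: nth_append)
      next
        case False
        then have "i < n" using i by simp
        then show ?thesis using f(3)[of i] by (simp add: adjacent_def E'_def nth_append del: upt_Suc)
      qed
    qed
    then show False using assms by (auto simp: simplicial_tree_def)
  qed
  moreover have "a = w \<and> b = u" if "{a, b} \<in> E" "a \<in> S" "b \<notin> S" for a b
  proof -
    have "(a, b) \<notin> adjacent E'" using that unfolding S_def by (metis (mono_tags, lifting) mem_Collect_eq rtrancl.rtrancl_into_rtrancl)
    then have "{a, b} = {u, w}" using that by (simp add: adjacent_def E'_def)
    then show ?thesis using \<open>u \<notin> S\<close> that by (auto simp: doubleton_eq_iff)
  qed
  ultimately show "\<exists>S. separates E S u w" unfolding separates_def by (intro exI[of _ S]) (auto simp: S_def)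
qed (use assms in \<open>auto simp: simplicial_tree_def\<close>)

text \<open>A cycle that enters \<open>S\<close> over the bridge from \<open>p ! 0\<close> to
  \<open>p ! 1\<close> can leave it only by the same edge. Its closing edge returns to
  \<open>p ! 0\<close> from \<open>p ! (m - 1)\<close>, which differs from
  \<open>p ! 1\<close>.\<close>

lemma cut_tree_imp_simplicial_tree:
  assumes "cut_tree V E" "V \<noteq> {}"
  shows "simplicial_tree V E"
proof -
  interpret cut_tree V E by fact
  have False if "graph_cycle E p" for p
  proof -
    define m where "m = length p"
    have m: "p \<noteq> []" "3 \<le> m" "distinct p" "\<And>i. i < m \<Longrightarrow> {p ! i, p ! (Suc i mod m)} \<in> E"
      using that by (auto simp: graph_cycle_def m_def)
    note m = m(2-4) m(1)
    have "{p ! 0, p ! 1} \<in> E" using m(3)[of 0] m(1) by simp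
    then obtain S where S: "separates E S (p ! 0) (p ! 1)" using cut by blast
    have "p ! Suc i \<in> S" if "Suc i < m" for i using that
    proof (induction i)
      case 0
      then show ?case using S by (simp add: separates_def)
    next
      case (Suc i)
      have 1: "p ! Suc i \<in> S" using Suc by simp
      have 2: "{p ! Suc i, p ! Suc (Suc i)} \<in> E" using m(3)[of "Suc i"] Suc.prems by simp
      show ?case
      proof (rule ccontr)
        assume "p ! Suc (Suc i) \<notin> S"
        then have "p ! Suc (Suc i) = p ! 0" using S 1 2 by (auto simp: separates_def)
        then show False using m(1) Suc.prems nth_eq_iff_index_eq[OF m(2), of "Suc (Suc i)" 0] m(4) by (simp add: m_def)
      qed
    qed
    from this[of "m - 2"] have 1: "p ! (m - 1) \<in> S" using m(1) by (simp add: numeral_2_eq_2 Suc_diff_Suc)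
    have 2: "{p ! (m - 1), p ! 0} \<in> E" using m(3)[of "m - 1"] m(1) by simp
    have "p ! 0 \<notin> S" using S by (simp add: separates_def)
    then have "p ! (m - 1) = p ! 1" using S 1 2 unfolding separates_def by blast
    then show False using m(1) nth_eq_iff_index_eq[OF m(2), of "m - 1" 1] m(4) unfolding m_def by linarith
  qed
  then show ?thesis unfolding simplicial_tree_def using assms(2) edge_ends connected by blast
qed

section \<open>Group actions on trees\<close>

text \<open>\<open>S\<close> is not confined to \<open>V\<close>, so the complement in the whole
  type serves as the opposite side.\<close>

lemma separates_compl: "separates E S u w \<Longrightarrow> separates E (- S) w u"
  unfolding separates_def by (metis ComplD ComplI insert_commute)

text \<open>A canonical cut for each edge, so that the cuts at translates of an edge can be indexed
  by group elements and united.\<close>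

definition half_tree :: "'v set set \<Rightarrow> 'v set \<Rightarrow> 'v \<Rightarrow> 'v \<Rightarrow> 'v set" where
  "half_tree E V u w = {z \<in> V. gdist E u z = Suc (gdist E w z)}"

lemma (in cut_tree) separates_half_tree:
  assumes "{u, w} \<in> E" shows "separates E (half_tree E V u w) u w"
proof -
  obtain S where S: "separates E S u w" using cut[OF assms] by blast
  have eq: "z \<in> half_tree E V u w \<longleftrightarrow> z \<in> S" if "z \<in> V" for z
    using side[OF S assms that] that by (auto simp: half_tree_def)
  have "z \<in> V" if "{z, y} \<in> E" for z y using edge_in_V[OF that] by blast
  then show ?thesis using S eq edge_in_V[OF assms] unfolding separates_def by (metis insert_commute)
qed

text \<open>Weaker than \<open>group_action\<close>, whose values are extensional bijections: the
  maps are arbitrary outside \<open>V\<close>. This allows the induced actions on arcs and on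
  subdivided trees to be written as pairs and images.\<close>

locale gset = group G for G :: "('g, 'm) monoid_scheme" (structure) +
  fixes V :: "'v set" and a :: "'g \<Rightarrow> 'v \<Rightarrow> 'v"
  assumes act_closed: "g \<in> carrier G \<Longrightarrow> x \<in> V \<Longrightarrow> a g x \<in> V"
    and act_one: "x \<in> V \<Longrightarrow> a \<one> x = x"
    and act_mult: "g \<in> carrier G \<Longrightarrow> h \<in> carrier G \<Longrightarrow> x \<in> V \<Longrightarrow> a (g \<otimes> h) x = a g (a h x)"
begin

definition St :: "'v \<Rightarrow> 'g set" where "St x = {g \<in> carrier G. a g x = x}"

lemma act_inv: assumes "g \<in> carrier G" "x \<in> V" shows "a (inv g) (a g x) = x" "a g (a (inv g) x) = x"
  using act_mult[of "inv g" g x] act_mult[of g "inv g" x] assms act_one by auto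

lemma act_inj: assumes "g \<in> carrier G" "x \<in> V" "y \<in> V" shows "a g x = a g y \<longleftrightarrow> x = y"
  using act_inv assms by metis

lemma act_eq_iff:
  assumes "g \<in> carrier G" "h \<in> carrier G" "x \<in> V" "y \<in> V"
  shows "a g x = a h y \<longleftrightarrow> a (inv h \<otimes> g) x = y"
  using act_mult[of "inv h" g x] act_inv assms by (metis act_closed inv_closed)

lemma doubleton_act_eq:
  assumes "g \<in> carrier G" "h \<in> carrier G" "p \<in> V" "q \<in> V" "r \<in> V" "s \<in> V"
  shows "{a g p, a g q} = {a h r, a h s} \<longleftrightarrow> {p, q} = {a (inv g \<otimes> h) r, a (inv g \<otimes> h) s}"
proof -
  have "a g y = a h z \<longleftrightarrow> y = a (inv g \<otimes> h) z" if "y \<in> V" "z \<in> V" for y z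
    using act_eq_iff[of h g z y] assms that by metis
  then show ?thesis using assms unfolding doubleton_eq_iff by simp
qed

lemma St_carrier: "g \<in> St x \<Longrightarrow> g \<in> carrier G"
  by (auto simp: St_def)

lemma St_inv: assumes "g \<in> St x" "x \<in> V" shows "inv g \<in> St x"
  using assms act_inv[of g x] by (auto simp: St_def)

lemma St_conj: assumes "g \<in> carrier G" "x \<in> V" "h \<in> St x" shows "g \<otimes> h \<otimes> inv g \<in> St (a g x)"
  using assms act_mult act_inv by (auto simp: St_def act_closed)

lemma St_conj': assumes "g \<in> carrier G" "x \<in> V" "h \<in> St (a g x)" shows "inv g \<otimes> h \<otimes> g \<in> St x"
  using assms act_mult act_inv by (auto simp: St_def act_closed)

definition orbE :: "'v \<Rightarrow> 'v \<Rightarrow> 'v set set" where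
  "orbE u w = {{a g u, a g w} | g. g \<in> carrier G}"

lemma orbE_self: assumes "u \<in> V" "w \<in> V" shows "{u, w} \<in> orbE u w"
  unfolding orbE_def using act_one assms by (metis (mono_tags, lifting) mem_Collect_eq one_closed)

definition slide_edges :: "'v set set \<Rightarrow> 'v \<Rightarrow> 'v \<Rightarrow> 'v \<Rightarrow> 'v set set" where
  "slide_edges E v w x = (E - orbE v x) \<union> orbE w x"

text \<open>In the absence of inversions, \<open>St v \<inter> St x\<close> is the stabilizer of the
  edge \<open>vx\<close>; it lies in the stabilizer of \<open>vw\<close> once it fixes
  \<open>w\<close>.\<close>

definition slidable :: "'v set set \<Rightarrow> 'v \<Rightarrow> 'v \<Rightarrow> 'v \<Rightarrow> bool" where
  "slidable E v w x \<longleftrightarrow> {v, w} \<in> E \<and> {v, x} \<in> E \<and> St v \<inter> St x \<subseteq> St w \<and> {v, x} \<notin> orbE v w"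

definition slide :: "'v set set \<Rightarrow> 'v set set \<Rightarrow> bool" where
  "slide E E' \<longleftrightarrow> (\<exists>v w x. slidable E v w x \<and> E' = slide_edges E v w x)"

end

text \<open>Minimality is kept apart: slides and subdivisions only have to preserve this structure,
  and minimality is established where a member of the deformation space is built.\<close>

locale gtree = gset G V a + cut_tree V E
  for G :: "('g, 'm) monoid_scheme" (structure) and V :: "'v set" and a :: "'g \<Rightarrow> 'v \<Rightarrow> 'v" and E :: "'v set set" +
  assumes act_edge: "g \<in> carrier G \<Longrightarrow> {u, w} \<in> E \<Longrightarrow> {a g u, a g w} \<in> E"
    and no_inv: "g \<in> carrier G \<Longrightarrow> {u, w} \<in> E \<Longrightarrow> a g u = w \<Longrightarrow> a g w = u \<Longrightarrow> False"

section \<open>Isometries of a tree and the effect of a slide\<close>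

context gtree
begin

lemma no_inv2:
  assumes "{u, w} \<in> E" "g \<in> carrier G" "h \<in> carrier G" "a g u = a h w" "a g w = a h u"
  shows False
proof -
  note uw = edge_in_V[OF assms(1)]
  show False using no_inv[of "inv h \<otimes> g" u w] assms uw act_eq_iff by auto
qed

lemma act_gdist_le: assumes "g \<in> carrier G" "x \<in> V" "y \<in> V" shows "d (a g x) (a g y) \<le> d x y"
proof (rule gdist_le)
  obtain f where f: "f 0 = x" "f (d x y) = y" "\<And>i. i < d x y \<Longrightarrow> (f i, f (Suc i)) \<in> adjacent E"
    using gdist_walk[OF assms(2,3)] unfolding relpow_fun_conv by blast
  then show "(a g x, a g y) \<in> adjacent E ^^ d x y"
    unfolding relpow_fun_conv using act_edge[OF assms(1)]
    by (intro exI[of _ "\<lambda>i. a g (f i)"]) (auto simp: adjacent_def)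
qed

lemma act_gdist: assumes "g \<in> carrier G" "x \<in> V" "y \<in> V" shows "d (a g x) (a g y) = d x y"
  using act_gdist_le[OF assms] act_gdist_le[of "inv g" "a g x" "a g y"] assms act_inv act_closed by fastforce

lemma act_between: assumes "g \<in> carrier G" "x \<in> V" "y \<in> V" "z \<in> V"
  shows "btw (a g x) (a g y) (a g z) \<longleftrightarrow> btw x y z"
  using assms by (simp add: between_def act_gdist)

text \<open>The image of \<open>z\<close> lies on the same geodesic, at the same distance from
  \<open>x\<close>.\<close>

lemma fix_between:
  assumes "g \<in> St x" "g \<in> St y" "btw x z y" "x \<in> V" "y \<in> V" "z \<in> V"
  shows "g \<in> St z"
proof -
  have g: "g \<in> carrier G" "a g x = x" "a g y = y" using assms by (auto simp: St_def)
  have "btw x (a g z) y" "d x (a g z) = d x z"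
    using act_between[of g x z y] act_gdist[of g x z] assms g by auto
  then have "a g z = z" using between_unique[of x "a g z" y z] assms g act_closed by auto
  then show ?thesis using g by (simp add: St_def)
qed

text \<open>An element fixing \<open>q\<close> preserves distances to \<open>q\<close>, whereas
  adjacent vertices have distances to \<open>q\<close> of different parity.\<close>

lemma parity:
  assumes "g \<in> carrier G" "q \<in> V" "a g q = q" "{v, a g v} \<in> E"
  shows False
  using gdist_adj[OF assms(4,2)] act_gdist[of g v q] assms edge_in_V[OF assms(4)] by simp

text \<open>One end of the edge lies on the geodesic from the other end to \<open>q\<close>.\<close>

lemma stabilizer_side:
  assumes "{v, w} \<in> E" "q \<in> V"
  shows "St v \<inter> St q \<subseteq> St w \<or> St w \<inter> St q \<subseteq> St v"
  using between_adj_cases[OF assms] fix_between edge_in_V[OF assms(1)] assms(2) by blast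

text \<open>\<open>v\<close> is the midpoint of the geodesic from \<open>w\<close> to
  \<open>x\<close>, whose ends are exchanged.\<close>

lemma swap_fixes_middle:
  assumes "{v, w} \<in> E" "{v, x} \<in> E" "w \<noteq> x" "k \<in> carrier G" "a k w = x" "a k x = w"
  shows "a k v = v"
proof -
  note V = edge_in_V[OF assms(1)] edge_in_V[OF assms(2)]
  have b: "btw w v x" using gdist_two assms by blast
  then have "btw x (a k v) w" using act_between[of k w v x] V assms by simp
  then have b2: "btw w (a k v) x" by (simp add: between_sym)
  have "d w (a k v) = d x v" using act_gdist[of k x v] V assms by simp
  also have "\<dots> = 1" using gdist_edge[OF assms(2)] gdist_sym[of E] by metis
  also have "\<dots> = d w v" using gdist_edge[OF assms(1)] gdist_sym[of E] by metis
  finally show ?thesis using between_unique[OF b2 b] V assms act_closed by auto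
qed

lemma orbE_eqD:
  assumes "{u, w} \<in> E" "g \<in> carrier G" "h \<in> carrier G" "{a g u, a g w} = {a h u, a h w}"
  shows "a g u = a h u" "a g w = a h w"
  using assms no_inv2[of u w g h] by (auto simp: doubleton_eq_iff)

text \<open>A new edge \<open>(g w, g x)\<close> cuts the tree where \<open>(g v, g x)\<close> did,
  and edges outside the two orbits keep their cuts. Only the cut at an edge
  \<open>(g v, g w)\<close> changes: the branches slid across it now lie on the side of
  \<open>g w\<close>, so they are added to its half tree. The stabilizer inclusion ensures that each
  translate of \<open>vx\<close> slides across a single edge.\<close>

lemma slide_tree:
  assumes s: "slidable E v w x"
  shows "gtree G V a (slide_edges E v w x)"
proof -
  define E2 where "E2 = slide_edges E v w x"
  have vw: "{v, w} \<in> E" and vx: "{v, x} \<in> E" and st: "\<And>g. g \<in> St v \<Longrightarrow> g \<in> St x \<Longrightarrow> g \<in> St w"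
    and orb0: "{v, x} \<notin> orbE v w" using s by (auto simp: slidable_def)
  note V = edge_in_V[OF vw] edge_in_V[OF vx]
  have orb: False if "g \<in> carrier G" "h \<in> carrier G" "{a g v, a g w} = {a h v, a h x}" for g h
  proof -
    have "{v, x} = {a (inv h \<otimes> g) v, a (inv h \<otimes> g) w}"
      using that V doubleton_act_eq[of h g v x v w] by simp
    then show False using orb0 that unfolding orbE_def by blast
  qed
  have wx: "w \<noteq> x" using orb0 orbE_self V by metis
  have E2: "e \<in> E2 \<longleftrightarrow> (e \<in> E \<and> \<not> (\<exists>g\<in>carrier G. e = {a g v, a g x})) \<or> (\<exists>g\<in>carrier G. e = {a g w, a g x})" for e
    unfolding E2_def slide_edges_def orbE_def by blast
  have E2E: R if "e \<in> E2" "e \<in> E \<Longrightarrow> \<not> (\<exists>g\<in>carrier G. e = {a g v, a g x}) \<Longrightarrow> R" "\<And>g. g \<in> carrier G \<Longrightarrow> e = {a g w, a g x} \<Longrightarrow> R" for e R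
    using that E2[of e] by metis
  have new: "{a g w, a g x} \<in> E2" if "g \<in> carrier G" for g using that unfolding E2 by blast
  have keep: "{a g v, a g w} \<in> E2" if "g \<in> carrier G" for g using E2[of "{a g v, a g w}"] orb[OF that] act_edge[OF that vw] by blast
  have ends: "\<exists>u\<in>V. \<exists>t\<in>V. u \<noteq> t \<and> e = {u, t}" if eE: "e \<in> E2" for e
  proof -
    consider (1) "e \<in> E" | (2) g where "g \<in> carrier G" "e = {a g w, a g x}" using E2E[OF eE] by metis
    then show ?thesis
    proof cases
      case 1 then show ?thesis using edge_ends by blast
    next
      case 2
      then have "a g w \<noteq> a g x" using wx V act_inj by metis
      then show ?thesis using 2 V act_closed by blast
    qed
  qed
  have conn: "(u, t) \<in> (adjacent E2)\<^sup>*" if "u \<in> V" "t \<in> V" for u t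
  proof -
    have step: "(c, b) \<in> (adjacent E2)\<^sup>*" if "(c, b) \<in> adjacent E" for c b
    proof (cases "\<exists>g\<in>carrier G. {c, b} = {a g v, a g x}")
      case False
      then show ?thesis using that E2[of "{c, b}"] unfolding adjacent_def by blast
    next
      case True
      then obtain g where g: "g \<in> carrier G" "{c, b} = {a g v, a g x}" by blast
      have p: "(a g v, a g w) \<in> adjacent E2" "(a g w, a g x) \<in> adjacent E2"
        using keep new g by (auto simp: adjacent_def)
      then have "(a g v, a g x) \<in> (adjacent E2)\<^sup>*" "(a g x, a g v) \<in> (adjacent E2)\<^sup>*"
        using adjacent_sym by (meson r_into_rtrancl rtrancl_trans)+
      then show ?thesis using g(2) by (auto simp: doubleton_eq_iff)
    qed
    have "(u, t) \<in> (adjacent E)\<^sup>*" using connected that by blast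
    then show ?thesis by induction (auto intro: step rtrancl_trans)
  qed
  have inva: "{a g u, a g t} \<in> E2" if g: "g \<in> carrier G" and e: "{u, t} \<in> E2" for g u t
  proof -
    consider "{u, t} \<in> E" "\<not> (\<exists>g\<in>carrier G. {u, t} = {a g v, a g x})" | h where "h \<in> carrier G" "{u, t} = {a h w, a h x}"
      using E2E[OF e] by metis
    then show ?thesis
    proof cases
      case 1
      note ut = edge_in_V[OF 1(1)]
      have "\<not> (\<exists>h\<in>carrier G. {a g u, a g t} = {a h v, a h x})"
      proof
        assume "\<exists>h\<in>carrier G. {a g u, a g t} = {a h v, a h x}"
        then obtain h where h: "h \<in> carrier G" "{a g u, a g t} = {a h v, a h x}" by blast
        then have "{u, t} = {a (inv g \<otimes> h) v, a (inv g \<otimes> h) x}"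
          using ut V g doubleton_act_eq[of g h u t v x] by simp
        then show False using 1(2) g h by blast
      qed
      then show ?thesis using E2[of "{a g u, a g t}"] act_edge[OF g 1(1)] by blast
    next
      case 2
      then have "{a g u, a g t} = {a (g \<otimes> h) w, a (g \<otimes> h) x}" using act_mult g V by (auto simp: doubleton_eq_iff)
      then show ?thesis using new[of "g \<otimes> h"] g 2 by simp
    qed
  qed
  have noinv: False if g: "g \<in> carrier G" and e: "{u, t} \<in> E2" and i: "a g u = t" "a g t = u" for g u t
  proof -
    consider "{u, t} \<in> E" | h where "h \<in> carrier G" "{u, t} = {a h w, a h x}"
      using E2E[OF e] by metis
    then show False
    proof cases
      case 1 then show False using no_inv g i by blast
    next
      case 2
      then have "a g (a h w) = a h x" "a g (a h x) = a h w" using i by (auto simp: doubleton_eq_iff)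
      then have "a (g \<otimes> h) w = a h x" "a (g \<otimes> h) x = a h w" using act_mult g 2 V by auto
      then have k: "a (inv h \<otimes> (g \<otimes> h)) w = x" "a (inv h \<otimes> (g \<otimes> h)) x = w"
        using act_eq_iff g 2 V by auto
      \<comment> \<open>An inversion of a new edge yields an element exchanging \<open>w\<close> and
        \<open>x\<close>. It fixes the midpoint \<open>v\<close>, hence carries \<open>vw\<close> to
        \<open>vx\<close>, but these lie in different orbits.\<close>
      have "a (inv h \<otimes> (g \<otimes> h)) v = v" using swap_fixes_middle[OF vw vx wx _ k] g 2 by simp
      then show False using orb[of "inv h \<otimes> (g \<otimes> h)" \<one>] k g 2 act_one V by simp
    qed
  qed
  have cuts: "\<exists>S. separates E2 S u t" if e: "{u, t} \<in> E2" for u t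
  proof -
    have flip: "(\<exists>S. separates E2 S p r) \<Longrightarrow> {u, t} = {p, r} \<Longrightarrow> \<exists>S. separates E2 S u t" for p r
      using separates_compl by (metis doubleton_eq_iff)
    consider (new) g where "g \<in> carrier G" "{u, t} = {a g w, a g x}"
      | (base) g where "g \<in> carrier G" "{u, t} = {a g v, a g w}"
      | (old) "{u, t} \<in> E" "\<forall>g\<in>carrier G. {u, t} \<noteq> {a g v, a g x}" "\<forall>g\<in>carrier G. {u, t} \<noteq> {a g v, a g w}"
      using E2E[OF e] by metis
    then show ?thesis
    proof cases
      case new
      define S where "S = half_tree E V (a g v) (a g x)"
      have S: "separates E S (a g v) (a g x)" unfolding S_def using separates_half_tree act_edge new(1) vx by blast
      have sep: "c = a g x \<and> b = a g v" if "{c, b} \<in> E" "c \<in> S" "b \<notin> S" for c b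
        using S that by (auto simp: separates_def)
      have "a g w \<notin> S"
      proof
        assume "a g w \<in> S"
        moreover have "{a g w, a g v} \<in> E" using act_edge[OF new(1) vw] by (simp add: insert_commute)
        moreover have "a g v \<notin> S" using S by (simp add: separates_def)
        ultimately have "a g w = a g x" using sep by blast
        then show False using wx act_inj new V by blast
      qed
      moreover have "c = a g x \<and> b = a g w" if cb: "{c, b} \<in> E2" "c \<in> S" "b \<notin> S" for c b
      proof -
        consider "{c, b} \<in> E" "\<not> (\<exists>h\<in>carrier G. {c, b} = {a h v, a h x})"
          | h where "h \<in> carrier G" "c = a h w" "b = a h x" | h where "h \<in> carrier G" "c = a h x" "b = a h w"
          using E2E[OF cb(1)] unfolding doubleton_eq_iff by metis
        then show ?thesis
        proof cases
          case 1
          then have "c = a g x" "b = a g v" using sep cb by auto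
          then show ?thesis using 1 new(1) by (metis insert_commute)
        next
          case h: 2
          have e1: "{a h v, a h w} \<in> E" "{a h v, a h x} \<in> E" "{a h w, a h v} \<in> E" "{a h x, a h v} \<in> E"
            using act_edge[OF h(1) vw] act_edge[OF h(1) vx] by (simp_all add: insert_commute)
          have False
          proof (cases "a h v \<in> S")
            case True
            then have "a h v = a g x" "a h x = a g v" using sep[OF e1(2)] cb h by auto
            then show False using no_inv2[OF vx h(1) new(1)] by blast
          next
            case False
            then have "a h w = a g x" "a h v = a g v" using sep[OF e1(3)] cb h by auto
            then show False using orb[OF h(1) new(1)] by auto
          qed
          then show ?thesis ..
        next
          case h: 3
          have e1: "{a h v, a h w} \<in> E" "{a h v, a h x} \<in> E" "{a h w, a h v} \<in> E" "{a h x, a h v} \<in> E"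
            using act_edge[OF h(1) vw] act_edge[OF h(1) vx] by (simp_all add: insert_commute)
          show ?thesis
          proof (cases "a h v \<in> S")
            case True
            then have "a h v = a g x" "a h w = a g v" using sep[OF e1(1)] cb h by auto
            then have False using orb[OF h(1) new(1)] by auto
            then show ?thesis ..
          next
            case False
            then have eq: "a h x = a g x" "a h v = a g v" using sep[OF e1(4)] cb h by auto
            then have "a (inv g \<otimes> h) x = x" "a (inv g \<otimes> h) v = v" using act_eq_iff h new V by auto
            then have "inv g \<otimes> h \<in> St w" using st h new by (auto simp: St_def)
            then have "a h w = a g w" using act_eq_iff h new V by (auto simp: St_def)
            then show ?thesis using h eq by simp
          qed
        qed
      qed
      moreover have "a g x \<in> S" using S by (simp add: separates_def)
      ultimately have "separates E2 S (a g w) (a g x)" by (auto simp: separates_def)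
      then show ?thesis using flip new(2) by blast
    next
      case old
      define S where "S = half_tree E V u t"
      have S: "separates E S u t" unfolding S_def using separates_half_tree old by blast
      have cr: "{c, b} = {u, t}" if "{c, b} \<in> E" "c \<in> S \<longleftrightarrow> b \<notin> S" for c b
        using S that unfolding separates_def by (metis insert_commute)
      have "c = t \<and> b = u" if cb: "{c, b} \<in> E2" "c \<in> S" "b \<notin> S" for c b
      proof -
        have False if h: "h \<in> carrier G" "{c, b} = {a h w, a h x}" for h
        proof -
          have "{a h v, a h w} \<in> E" "{a h v, a h x} \<in> E" using act_edge h vw vx by auto
          moreover have "a h w \<in> S \<longleftrightarrow> a h x \<notin> S" using h(2) cb by (auto simp: doubleton_eq_iff)
          ultimately show False using cr old h by metis
        qed
        then have "{c, b} \<in> E" using E2[of "{c, b}"] cb by blast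
        then show ?thesis using S cb by (auto simp: separates_def)
      qed
      then have "separates E2 S u t" using S by (auto simp: separates_def)
      then show ?thesis by blast
    next
      case base
      have gE: "{a g v, a g w} \<in> E" using act_edge base vw by blast
      define S0 where "S0 = half_tree E V (a g v) (a g w)"
      have S0: "separates E S0 (a g v) (a g w)" unfolding S0_def using separates_half_tree gE by blast
      \<comment> \<open>The edges \<open>(h v, h x)\<close> with \<open>h \<in> K\<close> are those
        that slide across \<open>(g v, g w)\<close>.\<close>
      define K where "K = {h \<in> carrier G. a h v = a g v \<and> a h w = a g w}"
      define B where "B h = half_tree E V (a h v) (a h x)" for h
      have B: "separates E (B h) (a h v) (a h x)" if "h \<in> carrier G" for h
        unfolding B_def using separates_half_tree act_edge that vx by blast
      define S where "S = S0 \<union> (\<Union>h\<in>K. B h)"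
      have cr0: "{c, b} = {a g v, a g w}" if "{c, b} \<in> E" "c \<in> S0 \<longleftrightarrow> b \<notin> S0" for c b
        using S0 that unfolding separates_def by (metis insert_commute)
      have crB: "{c, b} = {a h v, a h x}" if "{c, b} \<in> E" "c \<in> B h \<longleftrightarrow> b \<notin> B h" "h \<in> carrier G" for c b h
        using B[OF that(3)] that unfolding separates_def by (metis insert_commute)
      have "a g v \<notin> S" using S0 B unfolding S_def K_def separates_def by (auto, metis)
      moreover have "a g w \<in> S" using S0 by (auto simp: S_def separates_def)
      moreover have "c = a g w \<and> b = a g v" if cb: "{c, b} \<in> E2" "c \<in> S" "b \<notin> S" for c b
      proof -
        consider "{c, b} \<in> E" "\<not> (\<exists>h\<in>carrier G. {c, b} = {a h v, a h x})"
          | k where "k \<in> carrier G" "{c, b} = {a k w, a k x}" using E2E[OF cb(1)] by metis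
        then show ?thesis
        proof cases
          case 1
          show ?thesis
          proof (cases "c \<in> S0")
            case True
            then show ?thesis using S0 1 cb by (auto simp: separates_def S_def)
          next
            case False
            then obtain h where h: "h \<in> K" "c \<in> B h" using cb by (auto simp: S_def)
            then have "b \<notin> B h" using cb by (auto simp: S_def)
            have hc: "h \<in> carrier G" using h(1) by (simp add: K_def)
            have "{c, b} = {a h v, a h x}" using crB[OF 1(1) _ hc] h(2) \<open>b \<notin> B h\<close> by blast
            then show ?thesis using 1(2) hc by blast
          qed
        next
          case k: 2
          have e1: "{a k v, a k w} \<in> E" "{a k v, a k x} \<in> E" using act_edge k vw vx by auto
          have False
          proof (cases "k \<in> K")
            case True
            then have "a k w \<in> S" using S0 by (auto simp: S_def separates_def K_def)
            moreover have "a k x \<in> S" using True B[of k] by (auto simp: S_def separates_def K_def)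
            ultimately show False using k cb by (auto simp: doubleton_eq_iff)
          next
            case False
            have 0: "a k w \<in> S0 \<longleftrightarrow> a k x \<in> S0"
            proof -
              have "a k v \<in> S0 \<longleftrightarrow> a k w \<in> S0"
              proof (rule ccontr)
                assume "\<not> ?thesis"
                then have "{a k v, a k w} = {a g v, a g w}" using cr0 e1(1) by blast
                then have "k \<in> K" using orbE_eqD[OF vw k(1) base(1)] k by (auto simp: K_def)
                then show False using False by blast
              qed
              moreover have "a k v \<in> S0 \<longleftrightarrow> a k x \<in> S0" using cr0 e1(2) orb[OF base(1) k(1)] by metis
              ultimately show ?thesis by blast
            qed
            have 1: "a k w \<in> B h \<longleftrightarrow> a k x \<in> B h" if h: "h \<in> K" for h
            proof -
              have hc: "h \<in> carrier G" using h by (simp add: K_def)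
              have "a k v \<in> B h \<longleftrightarrow> a k w \<in> B h" using crB[OF e1(1) _ hc] orb[OF k(1) hc] by blast
              moreover have "a k v \<in> B h \<longleftrightarrow> a k x \<in> B h"
              proof (rule ccontr)
                assume "\<not> ?thesis"
                then have "{a k v, a k x} = {a h v, a h x}" using crB[OF e1(2) _ hc] by blast
                then have eq: "a k v = a h v" "a k x = a h x" using orbE_eqD[OF vx k(1) hc] by auto
                then have "inv h \<otimes> k \<in> St w" using st[of "inv h \<otimes> k"] act_eq_iff[OF k(1) hc] V k hc by (auto simp: St_def)
                then have "a k w = a h w" using act_eq_iff[OF k(1) hc] V by (auto simp: St_def)
                then show False using False eq h k by (simp add: K_def)
              qed
              ultimately show ?thesis by blast
            qed
            have "a k w \<in> S \<longleftrightarrow> a k x \<in> S" using 0 1 by (auto simp: S_def)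
            then show False using k(2) cb by (auto simp: doubleton_eq_iff)
          qed
          then show ?thesis ..
        qed
      qed
      ultimately have "separates E2 S (a g v) (a g w)" by (auto simp: separates_def)
      then show ?thesis using flip base(2) by blast
    qed
  qed
  show ?thesis
    unfolding E2_def[symmetric]
    by (rule gtree.intro[OF gset_axioms cut_tree.intro[OF ends conn cuts] gtree_axioms.intro[OF inva noinv]])
qed

end

section \<open>Moving the origins of the edges of a tree\<close>

text \<open>
  \<open>A\<close> is the set of oriented edges and \<open>sw\<close> reverses them. This \<open>G\<close>-set stays the same while the
  origins \<open>r x\<close>, and hence the tree \<open>Eo r\<close>, change.
\<close>

locale arcs = gset G V a + A: gset G A b
  for G :: "('g, 'm) monoid_scheme" (structure) and V :: "'v set" and a :: "'g \<Rightarrow> 'v \<Rightarrow> 'v"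
    and A :: "'e set" and b :: "'g \<Rightarrow> 'e \<Rightarrow> 'e" +
  fixes sw :: "'e \<Rightarrow> 'e"
  assumes sw_closed: "x \<in> A \<Longrightarrow> sw x \<in> A" and sw_sw: "x \<in> A \<Longrightarrow> sw (sw x) = x"
    and sw_act: "g \<in> carrier G \<Longrightarrow> x \<in> A \<Longrightarrow> sw (b g x) = b g (sw x)"
    and sw_no_inv: "g \<in> carrier G \<Longrightarrow> x \<in> A \<Longrightarrow> b g x \<noteq> sw x"
begin

definition orb :: "'e \<Rightarrow> 'e set" where "orb x = {b g x | g. g \<in> carrier G}"

lemma orbI: "g \<in> carrier G \<Longrightarrow> b g x \<in> orb x" by (auto simp: orb_def)

lemma orb_self: "x \<in> A \<Longrightarrow> x \<in> orb x" using orbI[OF one_closed, of x] A.act_one by simp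

lemma orb_sub: "x \<in> A \<Longrightarrow> orb x \<subseteq> A" by (auto simp: orb_def A.act_closed)

lemma orb_act_iff: assumes "x \<in> A" "y \<in> A" "g \<in> carrier G" shows "b g y \<in> orb x \<longleftrightarrow> y \<in> orb x"
proof
  assume "b g y \<in> orb x"
  then obtain h where "h \<in> carrier G" "b g y = b h x" by (auto simp: orb_def)
  then have "y = b (inv g \<otimes> h) x" using assms A.act_eq_iff[of h g x y] by simp
  then show "y \<in> orb x" using \<open>h \<in> carrier G\<close> assms orbI by simp
next
  assume "y \<in> orb x"
  then obtain h where h: "h \<in> carrier G" "y = b h x" by (auto simp: orb_def)
  then have "b g y = b (g \<otimes> h) x" using A.act_mult assms by simp
  then show "b g y \<in> orb x" using h assms orbI by simp
qed

lemma sw_notin_orb: assumes "x \<in> A" "y \<in> orb x" shows "sw y \<notin> orb x"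
proof
  assume "sw y \<in> orb x"
  then obtain g h where g: "g \<in> carrier G" "y = b g x" and h: "h \<in> carrier G" "sw y = b h x"
    using assms(2) unfolding orb_def by blast
  then have "b h x = b g (sw x)" using sw_act assms by metis
  then have "b (inv g \<otimes> h) x = sw x" using A.act_eq_iff g h assms sw_closed by metis
  then show False using sw_no_inv[of "inv g \<otimes> h" x] g h assms by simp
qed

definition Eo :: "('e \<Rightarrow> 'v) \<Rightarrow> 'v set set" where "Eo r = {{r x, r (sw x)} | x. x \<in> A}"

text \<open>The last clause identifies arcs with oriented edges of \<open>Eo r\<close>, so that the
  stabilizer of an arc is the stabilizer of its edge.\<close>

definition sys :: "('e \<Rightarrow> 'v) \<Rightarrow> bool" where
  "sys r \<longleftrightarrow> (\<forall>x\<in>A. r x \<in> V) \<and> (\<forall>g\<in>carrier G. \<forall>x\<in>A. r (b g x) = a g (r x)) \<and> gtree G V a (Eo r)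
     \<and> (\<forall>x\<in>A. \<forall>y\<in>A. r x = r y \<longrightarrow> r (sw x) = r (sw y) \<longrightarrow> x = y)"

lemma EoI: "x \<in> A \<Longrightarrow> {r x, r (sw x)} \<in> Eo r" by (auto simp: Eo_def)

lemma sysD:
  assumes "sys r"
  shows "x \<in> A \<Longrightarrow> r x \<in> V" "g \<in> carrier G \<Longrightarrow> x \<in> A \<Longrightarrow> r (b g x) = a g (r x)" "gtree G V a (Eo r)"
    "x \<in> A \<Longrightarrow> y \<in> A \<Longrightarrow> r x = r y \<Longrightarrow> r (sw x) = r (sw y) \<Longrightarrow> x = y"
  using assms by (auto simp: sys_def)

lemma sys_edge_eq:
  assumes "sys r" "x \<in> A" "y \<in> A" "{r x, r (sw x)} = {r y, r (sw y)}"
  shows "x = y \<or> x = sw y"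
  using assms sysD(4)[OF assms(1)] sw_closed sw_sw unfolding doubleton_eq_iff by metis

text \<open>\<open>J\<close> prescribes the new origins on the orbit of \<open>\<eta>\<close>. Since
  it is well defined, the stabilizer of \<open>\<eta>\<close> fixes the far end of
  \<open>\<epsilon>\<close>; this is how the stabilizer inclusion of the slide is encoded.\<close>

lemma sys_slide:
  assumes r: "sys r" and A: "\<eta> \<in> A" "\<epsilon> \<in> A" and o: "r \<eta> = r \<epsilon>"
    and n1: "\<eta> \<notin> orb \<epsilon>" and n2: "\<eta> \<notin> orb (sw \<epsilon>)"
    and J: "\<And>g. g \<in> carrier G \<Longrightarrow> J (b g \<eta>) = a g (r (sw \<epsilon>))"
  defines "r1 \<equiv> (\<lambda>x. if x \<in> orb \<eta> then J x else r x)"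
  shows "sys r1" "slide (Eo r) (Eo r1)"
proof -
  define v w x where "v = r \<epsilon>" and "w = r (sw \<epsilon>)" and "x = r (sw \<eta>)"
  interpret T: gtree G V a "Eo r" using sysD(3)[OF r] .
  note ra = sysD(2)[OF r]
  note swA = sw_closed
  have vw: "{v, w} \<in> Eo r" unfolding v_def w_def using EoI A by blast
  have vx: "{v, x} \<in> Eo r" unfolding v_def x_def using EoI[of \<eta> r] A o by simp
  have V: "v \<in> V" "w \<in> V" "x \<in> V" using T.edge_in_V vw vx by auto
  have rg: "r (b g \<epsilon>) = a g v" "r (sw (b g \<epsilon>)) = a g w" "r (b g \<eta>) = a g v" "r (sw (b g \<eta>)) = a g x" if "g \<in> carrier G" for g
    using that A swA ra sw_act o by (auto simp: v_def w_def x_def)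
  have orbvw: "{v, x} \<noteq> {a g v, a g w}" if g: "g \<in> carrier G" for g
  proof
    assume "{v, x} = {a g v, a g w}"
    then have "{r \<eta>, r (sw \<eta>)} = {r (b g \<epsilon>), r (sw (b g \<epsilon>))}" using rg g o by (simp add: v_def x_def)
    then have "\<eta> = b g \<epsilon> \<or> \<eta> = sw (b g \<epsilon>)" using sys_edge_eq r A A.act_closed g by metis
    then show False using n1 n2 g A sw_act orbI by metis
  qed
  have wx: "w \<noteq> x" using orbvw[of \<one>] act_one V by auto
  have sl: "slidable (Eo r) v w x"
    unfolding slidable_def
  proof (intro conjI subsetI vw vx)
    fix g assume g: "g \<in> St v \<inter> St x"
    then have gc: "g \<in> carrier G" using St_carrier by blast
    have "b g \<eta> = \<eta>" using g gc sysD(4)[OF r, of "b g \<eta>" \<eta>] rg[OF gc] A A.act_closed[OF gc] o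
      by (auto simp: St_def v_def x_def)
    then have "a g w = w" using J[OF gc] J[OF one_closed] A A.act_one act_one V unfolding w_def by metis
    then show "g \<in> St w" using gc by (simp add: St_def)
  qed (use orbvw in \<open>auto simp: orbE_def\<close>)
  have r1g: "r1 (b g \<eta>) = a g w" "r1 (sw (b g \<eta>)) = a g x" if "g \<in> carrier G" for g
    using that orbI J sw_notin_orb[OF A(1) orbI[OF that]] rg by (auto simp: r1_def w_def)
  have other: "{r y, r (sw y)} \<in> orbE v x \<longleftrightarrow> y \<in> orb \<eta> \<or> sw y \<in> orb \<eta>" if y: "y \<in> A" for y
  proof
    assume "{r y, r (sw y)} \<in> orbE v x"
    then obtain g where g: "g \<in> carrier G" "{r y, r (sw y)} = {r (b g \<eta>), r (sw (b g \<eta>))}"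
      unfolding orbE_def using rg by fastforce
    then have "y = b g \<eta> \<or> y = sw (b g \<eta>)" using sys_edge_eq r A A.act_closed y by metis
    then show "y \<in> orb \<eta> \<or> sw y \<in> orb \<eta>" using g orbI sw_sw A A.act_closed by metis
  next
    have *: "{r y, r (sw y)} \<in> orbE v x" if "y \<in> orb \<eta>" for y
    proof -
      obtain g where "g \<in> carrier G" "y = b g \<eta>" using \<open>y \<in> orb \<eta>\<close> by (auto simp: orb_def)
      then show ?thesis unfolding orbE_def using rg by fastforce
    qed
    assume "y \<in> orb \<eta> \<or> sw y \<in> orb \<eta>"
    then show "{r y, r (sw y)} \<in> orbE v x" using *[of y] *[of "sw y"] sw_sw y by (auto simp: insert_commute)
  qed
  have Eo1: "Eo r1 = slide_edges (Eo r) v w x"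
  proof (rule equalityI; rule subsetI)
    fix e assume "e \<in> Eo r1"
    then obtain y where y: "y \<in> A" "e = {r1 y, r1 (sw y)}" by (auto simp: Eo_def)
    have *: "{r1 y, r1 (sw y)} \<in> orbE w x" if "y \<in> orb \<eta>" for y
      using that r1g unfolding orb_def orbE_def by fastforce
    show "e \<in> slide_edges (Eo r) v w x"
    proof (cases "y \<in> orb \<eta> \<or> sw y \<in> orb \<eta>")
      case True
      then show ?thesis using *[of y] *[of "sw y"] sw_sw y by (auto simp: slide_edges_def insert_commute)
    next
      case False
      then show ?thesis using other[OF y(1)] y EoI[OF y(1), of r] by (simp add: r1_def slide_edges_def)
    qed
  next
    fix e assume e: "e \<in> slide_edges (Eo r) v w x"
    show "e \<in> Eo r1"
    proof (cases "e \<in> orbE w x")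
      case True
      then obtain g where "g \<in> carrier G" "e = {r1 (b g \<eta>), r1 (sw (b g \<eta>))}" unfolding orbE_def using r1g by fastforce
      then show ?thesis using EoI A A.act_closed by metis
    next
      case False
      then obtain y where y: "y \<in> A" "e = {r y, r (sw y)}" "e \<notin> orbE v x" using e by (auto simp: slide_edges_def Eo_def)
      then have "y \<notin> orb \<eta>" "sw y \<notin> orb \<eta>" using other by auto
      then show ?thesis using EoI[OF y(1), of r1] y by (simp add: r1_def)
    qed
  qed
  show "slide (Eo r) (Eo r1)" unfolding slide_def Eo1 using sl by blast
  \<comment> \<open>\<open>w\<close> and \<open>x\<close> have distance 2 in the old tree, so no new
    edge coincides with an old one.\<close>
  have new: "{a g w, a g x} \<notin> Eo r" if g: "g \<in> carrier G" for g
  proof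
    assume "{a g w, a g x} \<in> Eo r"
    then have "{a (inv g) (a g w), a (inv g) (a g x)} \<in> Eo r" using T.act_edge g by blast
    then show False using T.gdist_two(3)[OF vw vx wx] act_inv g V by simp
  qed
  have H: "y = z" if yz: "y \<in> A" "z \<in> A" "y \<in> orb \<eta>" "r1 y = r1 z" "r1 (sw y) = r1 (sw z)" for y z
  proof -
    obtain g where g: "g \<in> carrier G" "y = b g \<eta>" using yz by (auto simp: orb_def)
    consider (1) "z \<in> orb \<eta>" | (2) "sw z \<in> orb \<eta>" | (3) "z \<notin> orb \<eta>" "sw z \<notin> orb \<eta>" by blast
    then show ?thesis
    proof cases
      case 1
      then obtain h where h: "h \<in> carrier G" "z = b h \<eta>" by (auto simp: orb_def)
      have "a g w = a h w" "a g x = a h x" using yz r1g g h by auto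
      then have k: "inv h \<otimes> g \<in> St w" "inv h \<otimes> g \<in> St x" using act_eq_iff g h V by (auto simp: St_def)
      have "inv h \<otimes> g \<in> St v" using T.fix_between[OF k] T.gdist_two(2)[OF vw vx wx] V by blast
      then have "b (inv h \<otimes> g) \<eta> = \<eta>"
        using k g h sysD(4)[OF r, of "b (inv h \<otimes> g) \<eta>" \<eta>] rg[of "inv h \<otimes> g"] A A.act_closed o
        by (auto simp: St_def v_def x_def)
      then show ?thesis using A.act_eq_iff g h A by metis
    next
      case 2
      then obtain h where h: "h \<in> carrier G" "sw z = b h \<eta>" by (auto simp: orb_def)
      then have z: "z = sw (b h \<eta>)" using sw_sw yz by metis
      have "a g w = a h x" "a g x = a h w" using yz r1g g h z by auto
      then have k: "a (inv h \<otimes> g) w = x" "a (inv h \<otimes> g) x = w" using act_eq_iff g h V by auto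
      have "a (inv h \<otimes> g) v = v" using T.swap_fixes_middle[OF vw vx wx _ k] g h by simp
      then have False using orbvw[of "inv h \<otimes> g"] k g h by simp
      then show ?thesis ..
    next
      case 3
      then have "r1 z = r z" "r1 (sw z) = r (sw z)" by (simp_all add: r1_def)
      then have "{a g w, a g x} = {r z, r (sw z)}" using yz(4,5) r1g[OF g(1)] g(2) by metis
      then have False using new[OF g(1)] EoI[OF yz(2)] by simp
      then show ?thesis ..
    qed
  qed
  have inj: "y = z" if yz: "y \<in> A" "z \<in> A" "r1 y = r1 z" "r1 (sw y) = r1 (sw z)" for y z
  proof -
    consider "y \<in> orb \<eta>" | "z \<in> orb \<eta>" | "sw y \<in> orb \<eta>" | "sw z \<in> orb \<eta>"
      | "y \<notin> orb \<eta>" "z \<notin> orb \<eta>" "sw y \<notin> orb \<eta>" "sw z \<notin> orb \<eta>" by blast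
    then show ?thesis
    proof cases
      case 3
      then have "sw y = sw z" using H[of "sw y" "sw z"] yz swA sw_sw by simp
      then show ?thesis using sw_sw yz by metis
    next
      case 4
      then have "sw z = sw y" using H[of "sw z" "sw y"] yz swA sw_sw by simp
      then show ?thesis using sw_sw yz by metis
    next
      case 5
      then show ?thesis using yz sysD(4)[OF r] by (simp add: r1_def)
    qed (use H yz in metis)+
  qed
  have eqv: "r1 (b g y) = a g (r1 y)" if g: "g \<in> carrier G" "y \<in> A" for g y
  proof (cases "y \<in> orb \<eta>")
    case True
    then obtain h where h: "h \<in> carrier G" "y = b h \<eta>" by (auto simp: orb_def)
    then have "b g y = b (g \<otimes> h) \<eta>" using A.act_mult g A by simp
    then show ?thesis using r1g g h act_mult V by simp
  next
    case False
    then show ?thesis using orb_act_iff[OF A(1) g(2,1)] ra g by (simp add: r1_def)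
  qed
  have "r1 y \<in> V" if y: "y \<in> A" for y
  proof (cases "y \<in> orb \<eta>")
    case True
    then obtain g where "g \<in> carrier G" "y = b g \<eta>" by (auto simp: orb_def)
    then show ?thesis using r1g act_closed V by simp
  next
    case False
    then show ?thesis using sysD(1)[OF r y] by (simp add: r1_def)
  qed
  then show "sys r1" unfolding sys_def using eqv inj T.slide_tree[OF sl] Eo1 by auto
qed

text \<open>The orbits slide one after the other across translates of \<open>\<epsilon>\<close>,
  whose own orbit never moves and so remains available. Elements of \<open>R\<close> may share an
  orbit; for a later one there is nothing left to do.\<close>

lemma multi_slide:
  assumes r: "sys r" and \<epsilon>: "\<epsilon> \<in> A" and fin: "finite R"
    and H: "\<And>x. x \<in> R \<Longrightarrow> x \<in> A \<and> x \<notin> orb \<epsilon> \<and> x \<notin> orb (sw \<epsilon>) \<and> (\<exists>g\<in>carrier G. r x = a g (r \<epsilon>) \<and> J x = a g (r (sw \<epsilon>)))"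
    and J: "\<And>g x. g \<in> carrier G \<Longrightarrow> x \<in> R \<Longrightarrow> J (b g x) = a g (J x)"
  shows "sys (\<lambda>x. if x \<in> \<Union>(orb ` R) then J x else r x) \<and>
    slide\<^sup>*\<^sup>* (Eo r) (Eo (\<lambda>x. if x \<in> \<Union>(orb ` R) then J x else r x))"
  using fin H J
proof (induction R rule: finite_induct)
  case empty
  then show ?case using r by simp
next
  case (insert \<eta> R)
  define rR where "rR = (\<lambda>x. if x \<in> \<Union>(orb ` R) then J x else r x)"
  define rI where "rI = (\<lambda>x. if x \<in> \<Union>(orb ` insert \<eta> R) then J x else r x)"
  have IH: "sys rR" "slide\<^sup>*\<^sup>* (Eo r) (Eo rR)" unfolding rR_def using insert.IH insert.prems by auto
  have \<eta>: "\<eta> \<in> A" "\<eta> \<notin> orb \<epsilon>" "\<eta> \<notin> orb (sw \<epsilon>)" using insert.prems by auto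
  obtain g where g: "g \<in> carrier G" "r \<eta> = a g (r \<epsilon>)" "J \<eta> = a g (r (sw \<epsilon>))" using insert.prems by blast
  show ?case
  proof (cases "\<eta> \<in> \<Union>(orb ` R)")
    case True
    then obtain \<zeta> where "\<zeta> \<in> R" "\<eta> \<in> orb \<zeta>" by blast
    moreover have "\<zeta> \<in> A" using \<open>\<zeta> \<in> R\<close> insert.prems by blast
    ultimately have "orb \<eta> \<subseteq> \<Union>(orb ` R)" using orb_act_iff[OF _ \<eta>(1)] by (force simp: orb_def[of \<eta>])
    then have "\<Union>(orb ` insert \<eta> R) = \<Union>(orb ` R)" by auto
    then have "rI = rR" unfolding rI_def rR_def by simp
    then show ?thesis using IH unfolding rI_def by simp
  next
    case False
    define \<epsilon>' where "\<epsilon>' = b g \<epsilon>"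
    have e: "\<epsilon>' \<in> A" "sw \<epsilon>' \<in> A" "sw \<epsilon>' = b g (sw \<epsilon>)" using \<epsilon> g A.act_closed sw_closed sw_act by (auto simp: \<epsilon>'_def)
    have out: "y \<notin> \<Union>(orb ` R)" if "y \<in> orb \<epsilon> \<or> y \<in> orb (sw \<epsilon>)" for y
    proof
      assume "y \<in> \<Union>(orb ` R)"
      then obtain \<zeta> h where z: "\<zeta> \<in> R" "h \<in> carrier G" "y = b h \<zeta>" by (auto simp: orb_def)
      have "\<zeta> \<in> A" "\<zeta> \<notin> orb \<epsilon>" "\<zeta> \<notin> orb (sw \<epsilon>)" using z insert.prems by auto
      then show False using that orb_act_iff[of \<epsilon> \<zeta> h] orb_act_iff[of "sw \<epsilon>" \<zeta> h] \<epsilon> sw_closed z by auto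
    qed
    have e1: "rR \<epsilon>' = r \<eta>" "rR (sw \<epsilon>') = J \<eta>"
      using out[of \<epsilon>'] out[of "sw \<epsilon>'"] orbI g e sysD(2)[OF r] \<epsilon> sw_closed by (auto simp: rR_def \<epsilon>'_def)
    have n: "\<eta> \<notin> orb \<epsilon>'" "\<eta> \<notin> orb (sw \<epsilon>')"
    proof -
      have "x \<in> orb y" if y: "y \<in> A" "x \<in> orb (b g y)" for x y
      proof -
        obtain h where h: "h \<in> carrier G" "x = b h (b g y)" using y(2) by (auto simp: orb_def)
        then show ?thesis using orbI[of "h \<otimes> g" y] A.act_mult[of h g y] g y by simp
      qed
      then show "\<eta> \<notin> orb \<epsilon>'" "\<eta> \<notin> orb (sw \<epsilon>')" using \<eta> \<epsilon> sw_closed e(3) unfolding \<epsilon>'_def by metis+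
    qed
    have eq: "(\<lambda>x. if x \<in> orb \<eta> then J x else rR x) = rI" by (auto simp: rI_def rR_def)
    have J1: "J (b h \<eta>) = a h (rR (sw \<epsilon>'))" if "h \<in> carrier G" for h
      using that insert.prems(2) e1 by simp
    have o1: "rR \<eta> = rR \<epsilon>'" using False e1 by (simp add: rR_def)
    have "sys rI" "slide (Eo rR) (Eo rI)"
      using sys_slide[OF IH(1) \<eta>(1) e(1) o1 n J1] unfolding eq by simp_all
    then show ?thesis using IH(2) unfolding rI_def by (auto intro: rtranclp.rtrancl_into_rtrancl)
  qed
qed

lemma ex_equivariant:
  assumes "x \<in> A" "t \<in> V" "\<And>g. g \<in> carrier G \<Longrightarrow> b g x = x \<Longrightarrow> a g t = t"
  shows "\<exists>J. \<forall>g\<in>carrier G. J (b g x) = a g t"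
proof -
  define J where "J y = a (SOME g. g \<in> carrier G \<and> b g x = y) t" for y
  have "J (b g x) = a g t" if g: "g \<in> carrier G" for g
  proof -
    define h where "h = (SOME h. h \<in> carrier G \<and> b h x = b g x)"
    have "h \<in> carrier G \<and> b h x = b g x" unfolding h_def by (rule someI[of _ g]) (use g in simp)
    then have h: "h \<in> carrier G" "b h x = b g x" by auto
    then have "a (inv g \<otimes> h) t = t" using assms A.act_eq_iff g by simp
    then have "a h t = a g t" using act_eq_iff h g assms by simp
    then show ?thesis unfolding J_def h_def by simp
  qed
  then show ?thesis by blast
qed

end

section \<open>Partially folded trees\<close>

lemma (in cut_tree) between_trans2:
  assumes "btw a z b" "btw z y b" "a \<in> V" "b \<in> V" "y \<in> V" "z \<in> V"
  shows "btw a y b" "btw a z y"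
  using between_trans[of b z a y] assms between_sym by metis+

text \<open>Let \<open>K\<close> be the edge group of \<open>vw\<close> and \<open>w = g v\<close>.
  As \<open>g\<close> conjugates \<open>K\<close> into \<open>St w\<close> and \<open>inv g\<close>
  conjugates it into \<open>St v\<close> in any case, the last assumption says that \<open>g\<close>
  cannot conjugate \<open>K\<close> properly into itself. It is required for every tree on
  \<open>V\<close>, because it is applied to whichever tree \<open>Eo r\<close> the slides have
  reached.\<close>

locale folding = arcs G V a A b sw + F: gtree G V a F
  for G :: "('g, 'm) monoid_scheme" (structure) and V :: "'v set" and a :: "'g \<Rightarrow> 'v \<Rightarrow> 'v"
    and A :: "'e set" and b :: "'g \<Rightarrow> 'e \<Rightarrow> 'e" and sw :: "'e \<Rightarrow> 'e" and F :: "'v set set" +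
  assumes finitely_many_arcs: "\<exists>R. finite R \<and> R \<subseteq> A \<and> A \<subseteq> \<Union>(orb ` R)"
    and non_ascending: "gtree G V a E \<Longrightarrow> {v, w} \<in> E \<Longrightarrow> g \<in> carrier G \<Longrightarrow> a g v = w \<Longrightarrow>
      (\<And>h. h \<in> St v \<inter> St w \<Longrightarrow> g \<otimes> h \<otimes> inv g \<in> St v) \<Longrightarrow> h \<in> St v \<inter> St w \<Longrightarrow> inv g \<otimes> h \<otimes> g \<in> St w"
begin

text \<open>
  A partially folded tree has vertex set \<open>W\<close>: the pairs \<open>(v, y)\<close> with fixed \<open>v\<close> form a copy of a
  subtree of \<open>F\<close>, attached to the vertex \<open>v = (v, v)\<close>, and the arc \<open>x\<close> leads from \<open>(r x, l x)\<close> to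
  \<open>(r (sw x), l (sw x))\<close>. The projection \<open>(v, y) \<mapsto> y\<close> to \<open>F\<close> maps edges to edges, and collapsing the
  copies gives \<open>Eo r\<close>.
\<close>

definition support :: "('v \<times> 'v) set \<Rightarrow> bool" where
  "support W \<longleftrightarrow> W \<subseteq> V \<times> V \<and> (\<forall>v\<in>V. (v, v) \<in> W) \<and> (\<forall>g\<in>carrier G. \<forall>v y. (v, y) \<in> W \<longrightarrow> (a g v, a g y) \<in> W)
     \<and> (\<forall>v y z. (v, y) \<in> W \<longrightarrow> z \<in> V \<longrightarrow> F.btw v z y \<longrightarrow> (v, z) \<in> W)"

definition labelling :: "('e \<Rightarrow> 'v) \<Rightarrow> ('e \<Rightarrow> 'v) \<Rightarrow> ('v \<times> 'v) set \<Rightarrow> bool" where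
  "labelling r l W \<longleftrightarrow> (\<forall>x\<in>A. (r x, l x) \<in> W \<and> {l x, l (sw x)} \<in> F \<and> (\<forall>g\<in>carrier G. l (b g x) = a g (l x)))"

definition state :: "('e \<Rightarrow> 'v) \<Rightarrow> ('e \<Rightarrow> 'v) \<Rightarrow> ('v \<times> 'v) set \<Rightarrow> bool" where
  "state r l W \<longleftrightarrow> sys r \<and> support W \<and> labelling r l W"

lemma supportD:
  assumes "support W"
  shows "(v, y) \<in> W \<Longrightarrow> v \<in> V" "(v, y) \<in> W \<Longrightarrow> y \<in> V" "v \<in> V \<Longrightarrow> (v, v) \<in> W"
    "g \<in> carrier G \<Longrightarrow> (v, y) \<in> W \<Longrightarrow> (a g v, a g y) \<in> W"
    "(v, y) \<in> W \<Longrightarrow> z \<in> V \<Longrightarrow> F.btw v z y \<Longrightarrow> (v, z) \<in> W"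
  using assms by (auto simp: support_def)

lemma labellingD:
  assumes "labelling r l W" "x \<in> A"
  shows "(r x, l x) \<in> W" "{l x, l (sw x)} \<in> F" "g \<in> carrier G \<Longrightarrow> l (b g x) = a g (l x)"
  using assms by (auto simp: labelling_def)

text \<open>
  A shift detaches from the subtree at \<open>w\<close> the branch beginning with \<open>q\<close> and attaches it to the
  subtree at \<open>v\<close>. The conditions below make this well defined for the whole orbit; the last one
  concerns the case that \<open>v\<close> is itself a translate of \<open>w\<close>, where the branch must not contain the
  point that has to receive its translate.
\<close>

definition shiftable :: "'v \<Rightarrow> 'v \<Rightarrow> 'v \<Rightarrow> bool" where
  "shiftable v w q \<longleftrightarrow> q \<noteq> w \<and> St w \<inter> St q \<subseteq> St v \<and> (\<forall>g\<in>carrier G. a g v = w \<longrightarrow> \<not> F.btw w q (a g q))"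

definition mv :: "'v \<Rightarrow> 'v \<Rightarrow> 'v \<Rightarrow> 'v \<Rightarrow> 'g \<Rightarrow> bool" where
  "mv w q u y g \<longleftrightarrow> g \<in> carrier G \<and> u = a g w \<and> F.btw u (a g q) y"

definition shift :: "'v \<Rightarrow> 'v \<Rightarrow> 'v \<Rightarrow> 'v \<times> 'v \<Rightarrow> 'v \<times> 'v" where
  "shift v w q = (\<lambda>(u, y). if \<exists>g. mv w q u y g then (a (SOME g. mv w q u y g) v, y) else (u, y))"

lemma snd_shift[simp]: "snd (shift v w q p) = snd p"
  by (cases p) (auto simp: shift_def)

lemma shift_fixed: "\<not> (\<exists>g. mv w q u y g) \<Longrightarrow> shift v w q (u, y) = (u, y)"
  unfolding shift_def prod.case by (rule if_not_P)

context
  fixes v w q :: 'v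
  assumes sh: "shiftable v w q" and V: "v \<in> V" "w \<in> V" "q \<in> V"
begin

text \<open>\<open>a g q\<close> and \<open>a h q\<close> lie on one geodesic at the same distance
  from \<open>u\<close>, so they agree. Then \<open>inv h \<otimes> g\<close> fixes \<open>w\<close>
  and \<open>q\<close>, hence \<open>v\<close> by the stabilizer condition. The choice made in
  \<open>shift\<close> is therefore harmless.\<close>

lemma mv_unique:
  assumes "mv w q u y g" "mv w q u y h" "y \<in> V"
  shows "a g v = a h v"
proof -
  have gh: "g \<in> carrier G" "h \<in> carrier G" "u = a g w" "u = a h w" "F.btw u (a g q) y" "F.btw u (a h q) y"
    using assms by (auto simp: mv_def)
  have "F.d u (a g q) = F.d w q" using gh(1,3) V F.act_gdist by simp
  moreover have "F.d u (a h q) = F.d w q" using gh(2,4) V F.act_gdist by simp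
  ultimately have "a g q = a h q" using F.between_unique[OF gh(5,6)] gh V assms(3) act_closed by metis
  moreover have "a g w = a h w" using gh by simp
  ultimately have "inv h \<otimes> g \<in> St w \<inter> St q" using gh(1,2) V act_eq_iff[of g h] by (simp add: St_def)
  then have "inv h \<otimes> g \<in> St v" using sh by (auto simp: shiftable_def)
  then show ?thesis using gh V act_eq_iff[of g h v v] by (auto simp: St_def)
qed

lemma shift_moved: assumes "mv w q u y g" "y \<in> V" shows "shift v w q (u, y) = (a g v, y)"
proof -
  have "mv w q u y (SOME g. mv w q u y g)" using assms(1) by (rule someI)
  then have "a (SOME g. mv w q u y g) v = a g v" using mv_unique assms by blast
  then show ?thesis using assms(1) by (auto simp: shift_def)
qed

lemma mv_act: assumes "mv w q u y h" "g \<in> carrier G" "y \<in> V" shows "mv w q (a g u) (a g y) (g \<otimes> h)"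
  using assms V act_closed F.act_between[of g "a h w" "a h q" y] by (auto simp: mv_def act_mult)

lemma shift_act:
  assumes "g \<in> carrier G" "u \<in> V" "y \<in> V"
  shows "shift v w q (a g u, a g y) = (a g (fst (shift v w q (u, y))), a g y)"
proof (cases "\<exists>h. mv w q u y h")
  case True
  then obtain h where h: "mv w q u y h" by blast
  then show ?thesis using shift_moved[OF h] shift_moved[OF mv_act[OF h assms(1)]] assms act_closed V
    by (simp add: mv_def act_mult)
next
  case False
  have "\<not> (\<exists>h. mv w q (a g u) (a g y) h)"
  proof
    assume "\<exists>h. mv w q (a g u) (a g y) h"
    then obtain h where "mv w q (a g u) (a g y) h" by blast
    then have "mv w q (a (inv g) (a g u)) (a (inv g) (a g y)) (inv g \<otimes> h)" using mv_act assms act_closed by simp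
    then show False using False act_inv assms by auto
  qed
  then show ?thesis using False by (simp add: shift_fixed)
qed

text \<open>The path in the copy at \<open>v\<close> along which the branch is attached must itself
  stay. If a point of it moved, \<open>v = a g w\<close>, and translating by \<open>inv g\<close>
  would put \<open>q\<close> between \<open>w\<close> and \<open>a (inv g) q\<close>; the last
  clause of \<open>shiftable\<close> forbids this.\<close>

lemma shift_between: assumes "z \<in> V" "F.btw v z q" shows "\<not> mv w q v z g"
proof
  assume "mv w q v z g"
  then have g: "g \<in> carrier G" "v = a g w" "F.btw v (a g q) z" by (auto simp: mv_def)
  then have "F.btw v (a g q) q" using F.between_trans(1)[OF assms(2) g(3)] V assms act_closed by simp
  then have "F.btw (a (inv g) v) (a (inv g) (a g q)) (a (inv g) q)" using F.act_between g V act_closed by simp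
  then have "F.btw w q (a (inv g) q)" using g act_inv V by simp
  moreover have "a (inv g) v = w" using g act_inv V by simp
  ultimately show False using sh g by (auto simp: shiftable_def)
qed

text \<open>A root that moves would give \<open>a g q = a g w\<close>, but \<open>q\<close> differs
  from \<open>w\<close>.\<close>

lemma shift_root: assumes "u \<in> V" shows "\<not> mv w q u u g"
proof
  assume "mv w q u u g"
  then have g: "g \<in> carrier G" "u = a g w" "F.btw u (a g q) u" by (auto simp: mv_def)
  then have "F.d u (a g q) = 0" by (simp add: between_def)
  then have "a g w = a g q" using F.gdist_eq_0 g V act_closed by metis
  then show False using sh act_inj g V by (metis shiftable_def)
qed

text \<open>By \<open>below\<close>, the path from \<open>v\<close> to \<open>q\<close> is attached
  at \<open>v\<close> up to its last vertex, so the branch has a place to go. The geodesic from a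
  moved vertex to its new root splits into a part inside the moved branch and a part of a translate
  of that path, which stays.\<close>

lemma shift_support:
  assumes W: "support W" and wq: "(w, q) \<in> W"
    and below: "\<And>z. z \<in> V \<Longrightarrow> F.btw v z q \<Longrightarrow> z \<noteq> q \<Longrightarrow> (v, z) \<in> W"
  shows "support (shift v w q ` W)"
proof -
  note WD = supportD[OF W]
  have img: "shift v w q (u, y) = (u', y) \<Longrightarrow> (u, y) \<in> W \<Longrightarrow> (u', y) \<in> shift v w q ` W" for u y u'
    by (metis imageI)
  have VV: "fst (shift v w q (u, y)) \<in> V" if "(u, y) \<in> W" for u y
  proof (cases "\<exists>g. mv w q u y g")
    case True
    then obtain g where g: "mv w q u y g" by blast
    then show ?thesis using shift_moved[OF g] WD(2)[OF that] V act_closed by (simp add: mv_def)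
  next
    case False
    then show ?thesis using shift_fixed WD(1)[OF that] by simp
  qed
  show ?thesis
    unfolding support_def
  proof (intro conjI ballI allI impI)
    show "shift v w q ` W \<subseteq> V \<times> V"
    proof
      fix p assume "p \<in> shift v w q ` W"
      then obtain u y where "(u, y) \<in> W" "p = shift v w q (u, y)" by auto
      then show "p \<in> V \<times> V" using VV[of u y] WD(2)[of u y] snd_shift[of v w q "(u, y)"] by (simp add: mem_Times_iff)
    qed
    show "(u, u) \<in> shift v w q ` W" if "u \<in> V" for u
      using img[of u u u] shift_fixed shift_root that WD(3) by blast
    show "(a g u', a g y') \<in> shift v w q ` W" if g: "g \<in> carrier G" and m: "(u', y') \<in> shift v w q ` W" for g u' y'
    proof -
      obtain u y where uy: "(u, y) \<in> W" "(u', y') = shift v w q (u, y)" using m by auto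
      then have y: "y' = y" "u' = fst (shift v w q (u, y))" using snd_shift[of v w q "(u, y)"] by (metis snd_conv, metis fst_conv)
      then have "shift v w q (a g u, a g y) = (a g u', a g y')" using shift_act g WD(1,2)[OF uy(1)] by simp
      then show ?thesis using WD(4)[OF g uy(1)] by (metis imageI)
    qed
    show "(u', z) \<in> shift v w q ` W" if m: "(u', y') \<in> shift v w q ` W" and z: "z \<in> V" "F.btw u' z y'" for u' y' z
    proof -
      obtain u y where uy: "(u, y) \<in> W" "(u', y') = shift v w q (u, y)" using m by auto
      then have yy: "y' = y" using snd_shift[of v w q "(u, y)"] by (metis snd_conv)
      note uyV = WD(1,2)[OF uy(1)]
      show ?thesis
      proof (cases "\<exists>g. mv w q u y g")
        case True
        then obtain g where mg: "mv w q u y g" by blast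
        then have g: "g \<in> carrier G" "u = a g w" "F.btw u (a g q) y" by (auto simp: mv_def)
        have u': "u' = a g v" using shift_moved[OF mg] uy uyV by simp
        have gV: "a g v \<in> V" "a g q \<in> V" "a g w \<in> V" using g V act_closed by auto
        have "F.btw (a g v) z (a g q) \<or> F.btw (a g q) z y" using F.tripod[of "a g v" z y "a g q"] z u' yy gV uyV by simp
        then consider (up) "F.btw (a g q) z y" | (low) "F.btw (a g v) z (a g q)" "z \<noteq> a g q" by fastforce
        then show ?thesis
        proof cases
          case up
          have "F.btw u z y" "F.btw u (a g q) z" using F.between_trans2[OF g(3) up] gV uyV z by auto
          then have "(u, z) \<in> W" "mv w q u z g" using WD(5)[OF uy(1)] z g by (auto simp: mv_def)
          then show ?thesis using img shift_moved z u' by blast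
        next
          case low
          have iz: "a (inv g) z \<in> V" "a g (a (inv g) z) = z" using g z act_closed act_inv by auto
          have bz: "F.btw v (a (inv g) z) q" using F.act_between[of g v "a (inv g) z" q] low iz g V by simp
          have nq: "a (inv g) z \<noteq> q" using low(2) iz by auto
          have inW: "(v, a (inv g) z) \<in> W" using below[OF iz(1) bz nq] .
          have "shift v w q (v, a (inv g) z) = (v, a (inv g) z)" using shift_fixed shift_between[OF iz(1) bz] by blast
          then have "shift v w q (a g v, z) = (a g v, z)" using shift_act[OF g(1) V(1) iz(1)] iz by simp
          moreover have "(a g v, z) \<in> W" using WD(4)[OF g(1) inW] iz by simp
          ultimately show ?thesis using img u' by blast
        qed
      next
        case False
        then have u': "u' = u" using uy shift_fixed by simp
        have zW: "(u, z) \<in> W" using WD(5)[OF uy(1) z(1)] z(2) u' yy by simp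
        have "\<not> (\<exists>h. mv w q u z h)"
        proof
          assume "\<exists>h. mv w q u z h"
          then obtain h where h: "h \<in> carrier G" "u = a h w" "F.btw u (a h q) z" by (auto simp: mv_def)
          then have "F.btw u (a h q) y" using F.between_trans(1)[of u z y "a h q"] z u' yy uyV V act_closed by simp
          then show False using False h by (auto simp: mv_def)
        qed
        then show ?thesis using img shift_fixed zW u' by blast
      qed
    qed
  qed
qed

end

lemma orb_sw: assumes "x \<in> A" "y \<in> A" shows "y \<in> orb (sw x) \<longleftrightarrow> sw y \<in> orb x"
proof
  assume "y \<in> orb (sw x)"
  then obtain g where g: "g \<in> carrier G" "y = b g (sw x)" by (auto simp: orb_def)
  then have "sw y = b g x" using sw_act sw_sw sw_closed assms by metis
  then show "sw y \<in> orb x" using g orbI by simp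
next
  assume "sw y \<in> orb x"
  then obtain g where g: "g \<in> carrier G" "sw y = b g x" by (auto simp: orb_def)
  then have "y = b g (sw x)" using sw_act sw_sw assms by metis
  then show "y \<in> orb (sw x)" using g orbI by simp
qed

text \<open>Arcs attached to the branch must follow it from \<open>w\<close> to \<open>v\<close>,
  which they do by sliding across \<open>\<epsilon>\<close>. The arc \<open>\<epsilon>\<close> keeps
  its ends but changes its role: the edge that held the branch in the copy at \<open>w\<close>, from
  \<open>q\<close> to its neighbour \<open>q2\<close> towards \<open>w\<close>, now connects the two
  copies, and \<open>\<epsilon>\<close> is labelled accordingly. \<open>Kq\<close> makes these
  labels well defined on the orbit.\<close>

lemma shift_state:
  assumes st: "state r l W" and \<epsilon>: "\<epsilon> \<in> A" and v: "v = r \<epsilon>" and w: "w = r (sw \<epsilon>)" and q: "q \<in> V"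
    and sh: "shiftable v w q" and Kq: "St v \<inter> St w \<subseteq> St q" and wq: "(w, q) \<in> W"
    and below: "\<And>z. z \<in> V \<Longrightarrow> F.btw v z q \<Longrightarrow> z \<noteq> q \<Longrightarrow> (v, z) \<in> W"
  shows "\<exists>r2 l2 q2. slide\<^sup>*\<^sup>* (Eo r) (Eo r2) \<and> state r2 l2 (shift v w q ` W) \<and>
    (\<forall>x\<in>A. x \<notin> orb \<epsilon> \<longrightarrow> x \<notin> orb (sw \<epsilon>) \<longrightarrow> (r2 x, l2 x) = shift v w q (r x, l x)) \<and>
    (\<forall>g\<in>carrier G. r2 (b g \<epsilon>) = a g v \<and> l2 (b g \<epsilon>) = a g q \<and> r2 (b g (sw \<epsilon>)) = a g w \<and> l2 (b g (sw \<epsilon>)) = a g q2) \<and>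
    {q, q2} \<in> F \<and> F.btw w q2 q"
proof -
  have r: "sys r" and W: "support W" and l: "labelling r l W" using st by (auto simp: state_def)
  have sA: "sw \<epsilon> \<in> A" using \<epsilon> sw_closed by blast
  have V: "v \<in> V" "w \<in> V" using sysD(1)[OF r] \<epsilon> sA v w by auto
  note WD = supportD[OF W] note lD = labellingD[OF l]
  have qw: "q \<noteq> w" using sh by (simp add: shiftable_def)
  obtain q2 where q2: "{q, q2} \<in> F" "F.d q w = Suc (F.d q2 w)" using F.closer_ex q V qw by blast
  have q2V: "q2 \<in> V" using F.edge_in_V q2 by blast
  have bq2: "F.btw w q2 q" using F.between_adjI[of q2 q w] q2 between_sym[of F] by (metis insert_commute)
  define J where "J x = fst (shift v w q (r x, l x))" for x
  have Jl: "shift v w q (r x, l x) = (J x, l x)" for x unfolding J_def by (metis prod.collapse snd_conv snd_shift)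
  have rlV: "r x \<in> V" "l x \<in> V" if "x \<in> A" for x using WD(1,2)[OF lD(1)[OF that]] .
  have Jact: "J (b g x) = a g (J x)" if "g \<in> carrier G" "x \<in> A" for g x
    using shift_act[OF sh V q that(1) rlV[OF that(2)]] sysD(2)[OF r that] lD(3)[OF that(2,1)] by (simp add: J_def)
  obtain R0 where R0: "finite R0" "R0 \<subseteq> A" "A \<subseteq> \<Union>(orb ` R0)" using finitely_many_arcs by blast
  define H where "H = {x \<in> A. x \<notin> orb \<epsilon> \<and> x \<notin> orb (sw \<epsilon>) \<and> (\<exists>g. mv w q (r x) (l x) g)}"
  have Hact: "x \<in> H" if g: "g \<in> carrier G" and x: "x \<in> A" "b g x \<in> H" for g x
  proof -
    obtain h where "mv w q (r (b g x)) (l (b g x)) h" using x by (auto simp: H_def)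
    then have "mv w q (a g (r x)) (a g (l x)) h" using sysD(2)[OF r g] lD(3)[OF _ g] x by simp
    then have "mv w q (a (inv g) (a g (r x))) (a (inv g) (a g (l x))) (inv g \<otimes> h)"
      using mv_act[OF sh V q] g rlV x act_closed by simp
    then have "mv w q (r x) (l x) (inv g \<otimes> h)" using act_inv g rlV x by simp
    then show ?thesis using x orb_act_iff[OF \<epsilon> x(1) g] orb_act_iff[OF sA x(1) g] by (auto simp: H_def)
  qed
  have Hact': "b g x \<in> H" if g: "g \<in> carrier G" and x: "x \<in> H" for g x
    using Hact[of "inv g" "b g x"] A.act_inv[of g x] A.act_closed g x by (auto simp: H_def)
  define R where "R = R0 \<inter> H"
  have RH: "\<Union>(orb ` R) = H"
  proof
    show "\<Union>(orb ` R) \<subseteq> H" using Hact' by (auto simp: R_def orb_def)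
    show "H \<subseteq> \<Union>(orb ` R)"
    proof
      fix x assume x: "x \<in> H"
      then obtain \<rho> where \<rho>: "\<rho> \<in> R0" "x \<in> orb \<rho>" using R0 by (auto simp: H_def)
      then obtain g where "g \<in> carrier G" "x = b g \<rho>" by (auto simp: orb_def)
      then have "\<rho> \<in> H" using Hact x \<rho> R0 by blast
      then show "x \<in> \<Union>(orb ` R)" using \<rho> by (auto simp: R_def)
    qed
  qed
  define r2 where "r2 = (\<lambda>x. if x \<in> H then J x else r x)"
  \<comment> \<open>The slides go from \<open>w\<close> to \<open>v\<close>, so the arc they cross
    is \<open>sw \<epsilon>\<close>.\<close>
  have "sys r2 \<and> slide\<^sup>*\<^sup>* (Eo r) (Eo r2)"
    unfolding r2_def RH[symmetric]
  proof (rule multi_slide[OF r sA])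
    show "finite R" using R0 by (simp add: R_def)
    fix x assume x: "x \<in> R"
    then obtain g where g: "mv w q (r x) (l x) g" "x \<in> A" by (auto simp: R_def H_def)
    then have "J x = a g v" "r x = a g w" "g \<in> carrier G" using shift_moved[OF sh V q g(1)] rlV by (auto simp: J_def mv_def)
    then show "x \<in> A \<and> x \<notin> orb (sw \<epsilon>) \<and> x \<notin> orb (sw (sw \<epsilon>)) \<and> (\<exists>g\<in>carrier G. r x = a g (r (sw \<epsilon>)) \<and> J x = a g (r (sw (sw \<epsilon>))))"
      using x v w sw_sw \<epsilon> by (auto simp: R_def H_def)
  qed (use Jact R0 sA in \<open>auto simp: R_def\<close>)
  then have r2: "sys r2" "slide\<^sup>*\<^sup>* (Eo r) (Eo r2)" by auto
  have "\<exists>J. \<forall>g\<in>carrier G. J (b g \<epsilon>) = a g q"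
  proof (rule ex_equivariant[OF \<epsilon> q])
    fix g assume "g \<in> carrier G" "b g \<epsilon> = \<epsilon>"
    then have "g \<in> St v \<inter> St w" using sysD(2)[OF r, of g \<epsilon>] sysD(2)[OF r, of g "sw \<epsilon>"] sw_act[of g \<epsilon>] \<epsilon> sA v w by (auto simp: St_def)
    then show "a g q = q" using Kq by (auto simp: St_def)
  qed
  then obtain L1 where L1: "\<And>g. g \<in> carrier G \<Longrightarrow> L1 (b g \<epsilon>) = a g q" by blast
  have "\<exists>J. \<forall>g\<in>carrier G. J (b g (sw \<epsilon>)) = a g q2"
  proof (rule ex_equivariant[OF sA q2V])
    fix g assume "g \<in> carrier G" "b g (sw \<epsilon>) = sw \<epsilon>"
    then have "g \<in> St v \<inter> St w"
      using sysD(2)[OF r, of g \<epsilon>] sysD(2)[OF r, of g "sw \<epsilon>"] sw_act[of g "sw \<epsilon>"] sw_sw \<epsilon> sA v w by (auto simp: St_def)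
    then have "g \<in> St q2" using Kq F.fix_between[of g w q q2] bq2 V q q2V by auto
    then show "a g q2 = q2" by (auto simp: St_def)
  qed
  then obtain L2 where L2: "\<And>g. g \<in> carrier G \<Longrightarrow> L2 (b g (sw \<epsilon>)) = a g q2" by blast
  define l2 where "l2 = (\<lambda>x. if x \<in> orb \<epsilon> then L1 x else if x \<in> orb (sw \<epsilon>) then L2 x else l x)"
  have disj: "b g (sw \<epsilon>) \<notin> orb \<epsilon>" if "g \<in> carrier G" for g
    using sw_notin_orb[OF \<epsilon> orbI[OF that]] sw_act \<epsilon> that by simp
  have on: "r2 (b g \<epsilon>) = a g v" "l2 (b g \<epsilon>) = a g q" "r2 (b g (sw \<epsilon>)) = a g w" "l2 (b g (sw \<epsilon>)) = a g q2" if g: "g \<in> carrier G" for g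
    using orbI[OF g] disj[OF g] L1[OF g] L2[OF g] sysD(2)[OF r g] \<epsilon> sA v w by (auto simp: r2_def l2_def H_def)
  have off: "(r2 x, l2 x) = shift v w q (r x, l x)" if "x \<in> A" "x \<notin> orb \<epsilon>" "x \<notin> orb (sw \<epsilon>)" for x
    using that shift_fixed[of w q "r x" "l x" v] Jl[of x] by (auto simp: r2_def l2_def H_def)
  have W2: "support (shift v w q ` W)" using shift_support[OF sh V q W wq below] .
  have vq: "(v, q) \<in> shift v w q ` W"
  proof -
    have "mv w q w q \<one>" using act_one V q by (simp add: mv_def)
    then have "shift v w q (w, q) = (v, q)" using shift_moved[OF sh V q] act_one V q by simp
    then show ?thesis using wq by (metis imageI)
  qed
  have wq2: "(w, q2) \<in> shift v w q ` W"
  proof -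
    \<comment> \<open>An element fixing \<open>w\<close> preserves the distance from
      \<open>w\<close> to \<open>q\<close>, and \<open>q2\<close> is nearer than that.\<close>
    have "\<not> mv w q w q2 g" for g
    proof
      assume "mv w q w q2 g"
      then have g: "g \<in> carrier G" "w = a g w" "F.btw w (a g q) q2" by (auto simp: mv_def)
      then have "F.d w q = F.d w (a g q)" using F.act_gdist[of g w q] V q by simp
      also have "\<dots> \<le> F.d w q2" using g(3) by (simp add: between_def)
      finally show False using q2(2) gdist_sym[of F] by (metis Suc_n_not_le_n)
    qed
    then have "shift v w q (w, q2) = (w, q2)" using shift_fixed by blast
    moreover have "(w, q2) \<in> W" using WD(5)[OF wq q2V bq2] .
    ultimately show ?thesis by (metis imageI)
  qed
  have "labelling r2 l2 (shift v w q ` W)"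
    unfolding labelling_def
  proof (intro ballI conjI)
    fix x assume x: "x \<in> A"
    consider (1) g where "g \<in> carrier G" "x = b g \<epsilon>" | (2) g where "g \<in> carrier G" "x = b g (sw \<epsilon>)"
      | (3) "x \<notin> orb \<epsilon>" "x \<notin> orb (sw \<epsilon>)" by (auto simp: orb_def)
    note cs = this
    from cs show "(r2 x, l2 x) \<in> shift v w q ` W"
    proof cases
      case 1 then show ?thesis using on supportD(4)[OF W2 _ vq] by simp
    next
      case 2 then show ?thesis using on supportD(4)[OF W2 _ wq2] by simp
    next
      case 3 then show ?thesis using off[OF x] lD(1)[OF x] by simp
    qed
    from cs show "{l2 x, l2 (sw x)} \<in> F"
    proof cases
      case 1 then show ?thesis using on F.act_edge[OF _ q2(1)] sw_act \<epsilon> by simp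
    next
      case 2 then show ?thesis using on F.act_edge[OF _ q2(1)] sw_act sw_sw \<epsilon> sA by (simp add: insert_commute)
    next
      case 3
      then have "sw x \<notin> orb \<epsilon>" "sw x \<notin> orb (sw \<epsilon>)" using orb_sw[OF \<epsilon> x] orb_sw[OF \<epsilon> sw_closed[OF x]] sw_sw[OF x] by auto
      then show ?thesis using 3 lD(2)[OF x] by (simp add: l2_def)
    qed
    fix h assume h: "h \<in> carrier G"
    from cs show "l2 (b h x) = a h (l2 x)"
    proof cases
      case 1 then show ?thesis using on(2)[of "h \<otimes> _"] on(2) A.act_mult act_mult h \<epsilon> q by (metis m_closed)
    next
      case 2 then show ?thesis using on(4)[of "h \<otimes> _"] on(4) A.act_mult act_mult h sA q2V by (metis m_closed)
    next
      case 3
      then have "b h x \<notin> orb \<epsilon>" "b h x \<notin> orb (sw \<epsilon>)" using orb_act_iff \<epsilon> sA x h by auto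
      then show ?thesis using 3 lD(3)[OF x h] by (simp add: l2_def)
    qed
  qed
  then have "state r2 l2 (shift v w q ` W)" using r2 W2 by (simp add: state_def)
  then show ?thesis using r2 on off q2 bq2 by blast
qed

end

section \<open>Counting the orbits of attached vertices\<close>

context folding
begin

text \<open>Roots are excluded from the count: they never move, and they are the vertices of the
  final tree.\<close>

definition ext :: "('v \<times> 'v) set \<Rightarrow> ('v \<times> 'v) set" where "ext W = {p \<in> W. fst p \<noteq> snd p}"

definition orb2 :: "'v \<times> 'v \<Rightarrow> ('v \<times> 'v) set" where
  "orb2 p = {(a g (fst p), a g (snd p)) | g. g \<in> carrier G}"

definition orbs :: "('v \<times> 'v) set \<Rightarrow> ('v \<times> 'v) set set" where "orbs W = orb2 ` ext W"

lemma orb2_self: "fst p \<in> V \<Longrightarrow> snd p \<in> V \<Longrightarrow> p \<in> orb2 p"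
  unfolding orb2_def using act_one by (auto intro!: exI[of _ \<one>])

lemma shift_orb2:
  assumes sh: "shiftable v w q" and V: "v \<in> V" "w \<in> V" "q \<in> V" and p: "fst p \<in> V" "snd p \<in> V"
  shows "shift v w q ` orb2 p = orb2 (shift v w q p)"
proof -
  have *: "shift v w q (a g (fst p), a g (snd p)) = (a g (fst (shift v w q p)), a g (snd (shift v w q p)))"
    if "g \<in> carrier G" for g using shift_act[OF sh V that p] by simp
  show ?thesis
  proof (rule equalityI; rule subsetI)
    fix y assume "y \<in> shift v w q ` orb2 p"
    then obtain g where "g \<in> carrier G" "y = shift v w q (a g (fst p), a g (snd p))" by (auto simp: orb2_def)
    then show "y \<in> orb2 (shift v w q p)" using * by (auto simp: orb2_def)
  next
    fix y assume "y \<in> orb2 (shift v w q p)"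
    then obtain g where g: "g \<in> carrier G" "y = shift v w q (a g (fst p), a g (snd p))" using * by (auto simp: orb2_def)
    moreover have "(a g (fst p), a g (snd p)) \<in> orb2 p" using g by (auto simp: orb2_def)
    ultimately show "y \<in> shift v w q ` orb2 p" by blast
  qed
qed

lemma shift_in_V:
  assumes "shiftable v w q" "v \<in> V" "w \<in> V" "q \<in> V" "fst p \<in> V" "snd p \<in> V"
  shows "fst (shift v w q p) \<in> V"
proof (cases "\<exists>g. mv w q (fst p) (snd p) g")
  case True
  then obtain g where g: "mv w q (fst p) (snd p) g" by blast
  then have "shift v w q p = (a g v, snd p)" using shift_moved[OF assms(1-4) g assms(6)] by simp
  then show ?thesis using g assms(2) act_closed by (simp add: mv_def)
next
  case False
  then show ?thesis using shift_fixed[OF False, of v] assms(5) by simp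
qed

text \<open>A shift is equivariant and fixes the roots, so every counted orbit is the image of a
  counted one. The count drops when an image consists of roots or when two orbits have the same
  image.\<close>

lemma shift_orbs:
  assumes sh: "shiftable v w q" and V: "v \<in> V" "w \<in> V" "q \<in> V" and W: "support W" and fin: "finite (orbs W)"
  shows "finite (orbs (shift v w q ` W))" "card (orbs (shift v w q ` W)) \<le> card (orbs W)"
    "p \<in> ext W \<Longrightarrow> fst (shift v w q p) = snd p \<Longrightarrow> card (orbs (shift v w q ` W)) < card (orbs W)"
    "p \<in> ext W \<Longrightarrow> p' \<in> ext W \<Longrightarrow> shift v w q p = shift v w q p' \<Longrightarrow> orb2 p \<noteq> orb2 p' \<Longrightarrow>
      card (orbs (shift v w q ` W)) < card (orbs W)"
proof -
  let ?s = "shift v w q"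
  have inV: "fst p \<in> V" "snd p \<in> V" if "p \<in> W" for p using supportD(1,2)[OF W, of "fst p" "snd p"] that by auto
  have sub: "orbs (?s ` W) \<subseteq> (`) ?s ` orbs W"
  proof
    fix B assume "B \<in> orbs (?s ` W)"
    then obtain p where p: "p \<in> W" "fst (?s p) \<noteq> snd (?s p)" "B = orb2 (?s p)" by (auto simp: orbs_def ext_def)
    have "p \<in> ext W"
    proof (rule ccontr)
      assume "p \<notin> ext W"
      then have "p = (fst p, fst p)" using p by (auto simp: ext_def prod_eq_iff)
      then have "?s p = p" using shift_fixed shift_root[OF sh V inV(1)[OF p(1)]] by metis
      then show False using p \<open>p = _\<close> by (metis fst_conv snd_conv)
    qed
    moreover have "B = ?s ` orb2 p" using shift_orb2[OF sh V] inV p by simp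
    ultimately show "B \<in> (`) ?s ` orbs W" by (auto simp: orbs_def)
  qed
  show "finite (orbs (?s ` W))" using sub fin finite_surj by blast
  show "card (orbs (?s ` W)) \<le> card (orbs W)"
    using sub fin by (meson card_image_le card_mono finite_imageI order_trans)
  have strict: "card (orbs (?s ` W)) < card (orbs W)" if p: "p \<in> ext W" and s: "orbs (?s ` W) \<subseteq> (`) ?s ` (orbs W - {orb2 p})" for p
  proof -
    have "card (orbs (?s ` W)) \<le> card (orbs W - {orb2 p})"
      using s fin by (meson card_image_le card_mono finite_Diff finite_imageI order_trans)
    also have "\<dots> < card (orbs W)" using fin p by (intro card_Diff1_less) (auto simp: orbs_def)
    finally show ?thesis .
  qed
  show "card (orbs (?s ` W)) < card (orbs W)" if p: "p \<in> ext W" "fst (?s p) = snd p"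
  proof (rule strict[OF p(1)])
    have pW: "p \<in> W" using p by (simp add: ext_def)
    have "?s ` orb2 p \<notin> orbs (?s ` W)"
    proof
      assume "?s ` orb2 p \<in> orbs (?s ` W)"
      then have "orb2 (?s p) \<in> orbs (?s ` W)" using shift_orb2[OF sh V] inV pW by simp
      then obtain p1 where p1: "p1 \<in> W" "fst (?s p1) \<noteq> snd (?s p1)" "orb2 (?s p1) = orb2 (?s p)"
        by (auto simp: orbs_def ext_def)
      define p' where "p' = ?s p1"
      have "p' \<in> orb2 (?s p)"
        unfolding p'_def p1(3)[symmetric] using shift_in_V[OF sh V] inV p1(1) by (intro orb2_self) auto
      then have "fst p' = snd p'" using p(2) by (auto simp: orb2_def)
      then show False using p1(2) by (simp add: p'_def)
    qed
    then show "orbs (?s ` W) \<subseteq> (`) ?s ` (orbs W - {orb2 p})" using sub by blast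
  qed
  show "card (orbs (?s ` W)) < card (orbs W)"
    if p: "p \<in> ext W" "p' \<in> ext W" "?s p = ?s p'" "orb2 p \<noteq> orb2 p'"
  proof (rule strict[OF p(1)])
    have "?s ` orb2 p = ?s ` orb2 p'" using shift_orb2[OF sh V] inV p by (simp add: ext_def)
    moreover have "orb2 p' \<in> orbs W - {orb2 p}" using p by (auto simp: orbs_def)
    ultimately show "orbs (?s ` W) \<subseteq> (`) ?s ` (orbs W - {orb2 p})" using sub by blast
  qed
qed

text \<open>This is the only use of the hypothesis on ascending edges.\<close>

lemma not_shiftable:
  assumes E: "gtree G V a E" "{v, w} \<in> E" and q: "q \<in> V" and K: "St v \<inter> St w \<subseteq> St q" and n: "\<not> shiftable v w q"
  shows "St v \<inter> St q \<subseteq> St w"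
proof -
  interpret T: gtree G V a E by fact
  note V = T.edge_in_V[OF E(2)]
  consider "q = w" | "\<not> St w \<inter> St q \<subseteq> St v"
    | g where "St w \<inter> St q \<subseteq> St v" "g \<in> carrier G" "a g v = w" "F.btw w q (a g q)"
    using n by (auto simp: shiftable_def)
  then show ?thesis
  proof cases
    case 1 then show ?thesis by simp
  next
    case 2 then show ?thesis using T.stabilizer_side[OF E(2) q] by blast
  next
    case 3
    \<comment> \<open>The conjugate fixes \<open>w\<close> and \<open>a g q\<close>, hence
      \<open>q\<close> between them, and then \<open>v\<close> by the stabilizer inclusion of this
      case.\<close>
    have conj: "g \<otimes> h \<otimes> inv g \<in> St v" if "h \<in> St v \<inter> St q" for h
    proof -
      have 1: "g \<otimes> h \<otimes> inv g \<in> St w" "g \<otimes> h \<otimes> inv g \<in> St (a g q)"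
        using St_conj[OF 3(2) V(1)] St_conj[OF 3(2) q] that 3(3) by auto
      then have "g \<otimes> h \<otimes> inv g \<in> St q" using F.fix_between[OF 1 3(4)] V q act_closed 3(2) by blast
      then show ?thesis using 1 3(1) by blast
    qed
    \<comment> \<open>As \<open>K\<close> puts the edge group inside
      \<open>St v \<inter> St q\<close>, \<open>conj\<close> applies to it. Conversely,
      \<open>conj\<close> takes \<open>St v \<inter> St q\<close> into the edge group, and
      \<open>NA\<close> brings it back into \<open>St w\<close>.\<close>
    have NA: "inv g \<otimes> h \<otimes> g \<in> St w" if "h \<in> St v \<inter> St w" for h
      using non_ascending[OF E 3(2,3) _ that] conj K by blast
    show ?thesis
    proof
      fix m assume m: "m \<in> St v \<inter> St q"
      have mc: "m \<in> carrier G" using m St_carrier by blast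
      have "g \<otimes> m \<otimes> inv g \<in> St v \<inter> St w" using conj[OF m] St_conj[OF 3(2) V(1)] m 3(3) by auto
      then have "inv g \<otimes> (g \<otimes> m \<otimes> inv g) \<otimes> g \<in> St w" using NA by blast
      moreover have "inv g \<otimes> (g \<otimes> m \<otimes> inv g) \<otimes> g = m" using mc 3(2) by (simp add: m_assoc) (simp add: m_assoc[symmetric])
      ultimately show "m \<in> St w" by simp
    qed
  qed
qed

text \<open>An element fixing both ends of the edge fixes the arc, hence its equivariant
  labels.\<close>

lemma label_fixed:
  assumes "state r l W" "x \<in> A"
  shows "St (r x) \<inter> St (r (sw x)) \<subseteq> St (l x)" "St (r x) \<inter> St (r (sw x)) \<subseteq> St (l (sw x))"
proof -
  have r: "sys r" and l: "labelling r l W" using assms by (auto simp: state_def)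
  have sA: "sw x \<in> A" using assms sw_closed by blast
  have "b g x = x" if g: "g \<in> St (r x) \<inter> St (r (sw x))" for g
  proof (rule sysD(4)[OF r])
    have gc: "g \<in> carrier G" using g St_carrier by blast
    show "b g x \<in> A" using A.act_closed gc assms(2) by blast
    show "r (b g x) = r x" "r (sw (b g x)) = r (sw x)"
      using sysD(2)[OF r gc] sw_act[OF gc] assms(2) sA g by (auto simp: St_def)
  qed (rule assms(2))
  then show "St (r x) \<inter> St (r (sw x)) \<subseteq> St (l x)" "St (r x) \<inter> St (r (sw x)) \<subseteq> St (l (sw x))"
    using labellingD(3)[OF l assms(2)] labellingD(3)[OF l sA] sw_act[OF _ assms(2)] unfolding St_def
    by (smt (verit) Int_iff mem_Collect_eq subsetI)+
qed

definition improves :: "('e \<Rightarrow> 'v) \<Rightarrow> ('v \<times> 'v) set \<Rightarrow> bool" where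
  "improves r W \<longleftrightarrow> (\<exists>r2 l2 W2. slide\<^sup>*\<^sup>* (Eo r) (Eo r2) \<and> state r2 l2 W2 \<and> finite (orbs W2) \<and> card (orbs W2) < card (orbs W))"

text \<open>The shift carries \<open>(w, q)\<close> onto \<open>(v, q)\<close>, which stays. This
  loses an orbit: \<open>(v, q)\<close> is a root or belongs to another orbit, because an element
  taking \<open>v\<close> to \<open>w\<close> and fixing \<open>q\<close> would contradict
  \<open>parity\<close>.\<close>

lemma fold_into_support1:
  assumes st: "state r l W" and fin: "finite (orbs W)" and \<epsilon>: "\<epsilon> \<in> A" and q: "q \<in> V"
    and m: "(r \<epsilon>, q) \<in> W" "(r (sw \<epsilon>), q) \<in> W" and sh: "shiftable (r \<epsilon>) (r (sw \<epsilon>)) q"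
    and K: "St (r \<epsilon>) \<inter> St (r (sw \<epsilon>)) \<subseteq> St q"
  shows "improves r W"
proof -
  define v w where "v = r \<epsilon>" and "w = r (sw \<epsilon>)"
  have r: "sys r" and W: "support W" using st by (auto simp: state_def)
  interpret T: gtree G V a "Eo r" using sysD(3)[OF r] .
  have V: "v \<in> V" "w \<in> V" using sysD(1)[OF r] \<epsilon> sw_closed by (auto simp: v_def w_def)
  have vw: "{v, w} \<in> Eo r" using EoI \<epsilon> by (simp add: v_def w_def)
  have m': "(v, q) \<in> W" "(w, q) \<in> W" and sh': "shiftable v w q" using m sh by (auto simp: v_def w_def)
  obtain r2 l2 where r2: "slide\<^sup>*\<^sup>* (Eo r) (Eo r2)" "state r2 l2 (shift v w q ` W)"
    using shift_state[OF st \<epsilon> v_def w_def q sh'] K m' supportD(5)[OF W m'(1)] unfolding v_def w_def by blast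
  have "mv w q w q \<one>" using act_one V q by (simp add: mv_def)
  then have s1: "shift v w q (w, q) = (v, q)" using shift_moved[OF sh' V q] act_one V q by simp
  have s2: "shift v w q (v, q) = (v, q)" using shift_fixed shift_between[OF sh' V q q] by simp
  have x1: "(w, q) \<in> ext W" using m' sh' by (auto simp: ext_def shiftable_def)
  have "card (orbs (shift v w q ` W)) < card (orbs W)"
  proof (cases "v = q")
    case True
    then show ?thesis using shift_orbs(3)[OF sh' V q W fin x1] s1 by simp
  next
    case False
    then have x2: "(v, q) \<in> ext W" using m' by (simp add: ext_def)
    have "orb2 (w, q) \<noteq> orb2 (v, q)"
    proof
      assume "orb2 (w, q) = orb2 (v, q)"
      then have "(w, q) \<in> orb2 (v, q)" using orb2_self[of "(w, q)"] V q by auto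
      then obtain g where "g \<in> carrier G" "w = a g v" "a g q = q" by (auto simp: orb2_def)
      then show False using T.parity[of g q v] vw q by simp
    qed
    then show ?thesis using shift_orbs(4)[OF sh' V q W fin x1 x2] s1 s2 by simp
  qed
  then show ?thesis unfolding improves_def using r2 shift_orbs(1)[OF sh' V q W fin] by blast
qed

lemma shiftable_end: assumes "v \<in> V" "w \<in> V" "v \<noteq> w" shows "shiftable v w v"
  using assms F.gdist_eq_0[of w v] by (auto simp: shiftable_def between_def)

text \<open>The arc is folded onto an edge of the copy at its origin, and it suffices that one of
  the two directions is shiftable. If neither is, \<open>not_shiftable\<close> gives both stabilizer
  inclusions, so there are \<open>g\<close> from \<open>v\<close> to \<open>w\<close> and
  \<open>h\<close> from \<open>w\<close> to \<open>v\<close>, with \<open>q\<close> between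
  \<open>w\<close> and \<open>g q\<close> and between \<open>v\<close> and \<open>h q\<close>. Then
  \<open>d w q \<le> d v q \<le> d w q\<close>, so \<open>g q = q\<close>, against
  \<open>parity\<close>.\<close>

lemma fold_into_support:
  assumes st: "state r l W" and fin: "finite (orbs W)" and \<epsilon>: "\<epsilon> \<in> A" and m: "(r \<epsilon>, l (sw \<epsilon>)) \<in> W"
  shows "improves r W"
proof -
  define v w q where "v = r \<epsilon>" and "w = r (sw \<epsilon>)" and "q = l (sw \<epsilon>)"
  have r: "sys r" and W: "support W" and l: "labelling r l W" using st by (auto simp: state_def)
  have sA: "sw \<epsilon> \<in> A" using \<epsilon> sw_closed by blast
  interpret T: gtree G V a "Eo r" using sysD(3)[OF r] .
  have vw: "{v, w} \<in> Eo r" using EoI \<epsilon> by (simp add: v_def w_def)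
  note V = T.edge_in_V[OF vw]
  have m': "(v, q) \<in> W" "(w, q) \<in> W" using m labellingD(1)[OF l sA] by (auto simp: v_def w_def q_def)
  have q: "q \<in> V" using supportD(2)[OF W m'(1)] .
  have K: "St v \<inter> St w \<subseteq> St q" using label_fixed[OF st \<epsilon>] by (simp add: v_def w_def q_def)
  have "shiftable v w q \<or> shiftable w v q"
  proof (rule ccontr)
    assume n: "\<not> ?thesis"
    have qn: "q \<noteq> v" "q \<noteq> w" using n shiftable_end V by metis+
    have wv: "{w, v} \<in> Eo r" using vw by (simp add: insert_commute)
    have M: "St v \<inter> St q \<subseteq> St w" "St w \<inter> St q \<subseteq> St v"
      using not_shiftable[OF T.gtree_axioms vw q K] not_shiftable[OF T.gtree_axioms wv q] K n by blast+
    obtain g where g: "g \<in> carrier G" "a g v = w" "F.btw w q (a g q)" using n M qn by (auto simp: shiftable_def)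
    obtain h where h: "h \<in> carrier G" "a h w = v" "F.btw v q (a h q)" using n M qn by (auto simp: shiftable_def)
    have e: "F.d w (a g q) = F.d v q" "F.d v (a h q) = F.d w q" using F.act_gdist[of g v q] F.act_gdist[of h w q] g h V q by auto
    then have "F.d q (a g q) = 0" using g(3) h(3) by (auto simp: between_def)
    then have "a g q = q" using F.gdist_eq_0 q act_closed g by metis
    then show False using T.parity[of g q v] g vw q by simp
  qed
  then show ?thesis
  proof
    assume "shiftable v w q"
    then show ?thesis using fold_into_support1[OF st fin \<epsilon> q] m' K by (simp add: v_def w_def)
  next
    assume "shiftable w v q"
    then show ?thesis using fold_into_support1[OF st fin sA q] m' K sw_sw[OF \<epsilon>] by (simp add: v_def w_def Int_commute)
  qed
qed

lemma improves_trans: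
  assumes "slide\<^sup>*\<^sup>* (Eo r) (Eo r')" "improves r' W'" "card (orbs W') \<le> card (orbs W)"
  shows "improves r W"
  using assms unfolding improves_def by (meson order_less_le_trans rtranclp_trans)

text \<open>Serves after a slide: the moved arc has a new origin, to which its old label need not be
  attached.\<close>

lemma relabel:
  assumes r: "sys r" and W: "support W" and \<eta>: "\<eta> \<in> A"
    and off: "\<And>x. x \<in> A \<Longrightarrow> x \<notin> orb \<eta> \<Longrightarrow> x \<notin> orb (sw \<eta>) \<Longrightarrow> (r x, l x) \<in> W \<and> {l x, l (sw x)} \<in> F"
    and lact: "\<And>g x. g \<in> carrier G \<Longrightarrow> x \<in> A \<Longrightarrow> l (b g x) = a g (l x)"
    and c: "(r \<eta>, c) \<in> W" and d: "(r (sw \<eta>), d) \<in> W" and cd: "{c, d} \<in> F"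
    and stab: "St (r \<eta>) \<inter> St (r (sw \<eta>)) \<subseteq> St c \<inter> St d"
  shows "\<exists>l1. state r l1 W \<and> l1 \<eta> = c \<and> l1 (sw \<eta>) = d"
proof -
  have sA: "sw \<eta> \<in> A" using \<eta> sw_closed by blast
  note V = supportD(1,2)[OF W c] supportD(1,2)[OF W d]
  have fx: "a g c = c \<and> a g d = d" if g: "g \<in> carrier G" "b g \<eta> = \<eta>" for g
  proof -
    have "g \<in> St (r \<eta>) \<inter> St (r (sw \<eta>))"
      using g sysD(2)[OF r g(1)] sw_act[OF g(1) \<eta>] \<eta> sA unfolding St_def by (metis (mono_tags, lifting) Int_iff mem_Collect_eq)
    then show ?thesis using stab by (auto simp: St_def)
  qed
  obtain L1 where L1: "\<And>g. g \<in> carrier G \<Longrightarrow> L1 (b g \<eta>) = a g c" using ex_equivariant[OF \<eta> V(2)] fx by blast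
  have "b g \<eta> = \<eta>" if "g \<in> carrier G" "b g (sw \<eta>) = sw \<eta>" for g
    using that sw_act[OF that(1) sA] sw_sw \<eta> by metis
  then obtain L2 where L2: "\<And>g. g \<in> carrier G \<Longrightarrow> L2 (b g (sw \<eta>)) = a g d" using ex_equivariant[OF sA V(4)] fx by blast
  define l1 where "l1 = (\<lambda>x. if x \<in> orb \<eta> then L1 x else if x \<in> orb (sw \<eta>) then L2 x else l x)"
  have disj: "b g (sw \<eta>) \<notin> orb \<eta>" if "g \<in> carrier G" for g
    using sw_notin_orb[OF \<eta> orbI[OF that]] sw_act \<eta> that by simp
  have on: "l1 (b g \<eta>) = a g c" "l1 (b g (sw \<eta>)) = a g d" if g: "g \<in> carrier G" for g
    using orbI[OF g] disj[OF g] L1[OF g] L2[OF g] by (auto simp: l1_def)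
  have "labelling r l1 W"
    unfolding labelling_def
  proof (intro ballI conjI)
    fix x assume x: "x \<in> A"
    consider (1) g where "g \<in> carrier G" "x = b g \<eta>" | (2) g where "g \<in> carrier G" "x = b g (sw \<eta>)"
      | (3) "x \<notin> orb \<eta>" "x \<notin> orb (sw \<eta>)" by (auto simp: orb_def)
    note cs = this
    from cs show "(r x, l1 x) \<in> W"
    proof cases
      case 1 then show ?thesis using on supportD(4)[OF W _ c] sysD(2)[OF r] \<eta> by simp
    next
      case 2 then show ?thesis using on supportD(4)[OF W _ d] sysD(2)[OF r] sA by simp
    next
      case 3 then show ?thesis using off[OF x] by (simp add: l1_def)
    qed
    from cs show "{l1 x, l1 (sw x)} \<in> F"
    proof cases
      case 1 then show ?thesis using on F.act_edge[OF _ cd] sw_act \<eta> by simp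
    next
      case 2 then show ?thesis using on F.act_edge[OF _ cd] sw_act sw_sw \<eta> sA by (simp add: insert_commute)
    next
      case 3
      then have "sw x \<notin> orb \<eta>" "sw x \<notin> orb (sw \<eta>)" using orb_sw[OF \<eta> x] orb_sw[OF \<eta> sw_closed[OF x]] sw_sw[OF x] by auto
      then show ?thesis using 3 off[OF x] by (simp add: l1_def)
    qed
    fix h assume h: "h \<in> carrier G"
    from cs show "l1 (b h x) = a h (l1 x)"
    proof cases
      case 1 then show ?thesis using on(1)[of "h \<otimes> _"] on(1) A.act_mult act_mult h \<eta> V by (metis m_closed)
    next
      case 2 then show ?thesis using on(2)[of "h \<otimes> _"] on(2) A.act_mult act_mult h sA V by (metis m_closed)
    next
      case 3
      then have "b h x \<notin> orb \<eta>" "b h x \<notin> orb (sw \<eta>)" using orb_act_iff \<eta> sA x h by auto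
      then show ?thesis using 3 lact[OF h x] by (simp add: l1_def)
    qed
  qed
  moreover have "l1 \<eta> = c" "l1 (sw \<eta>) = d" using on[OF one_closed] A.act_one \<eta> sA act_one V by auto
  ultimately show ?thesis using r W by (auto simp: state_def)
qed

end

section \<open>Adjacency in the partially folded tree and the fold of two arcs\<close>

context folding
begin

text \<open>The edges of the partially folded tree.\<close>

definition adj :: "('e \<Rightarrow> 'v) \<Rightarrow> ('e \<Rightarrow> 'v) \<Rightarrow> ('v \<times> 'v) set \<Rightarrow> 'v \<times> 'v \<Rightarrow> 'v \<times> 'v \<Rightarrow> bool" where
  "adj r l W p p' \<longleftrightarrow> (p \<in> W \<and> p' \<in> W \<and> fst p = fst p' \<and> {snd p, snd p'} \<in> F) \<or>
     (\<exists>x\<in>A. p = (r x, l x) \<and> p' = (r (sw x), l (sw x)))"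

lemma adj_sym: assumes "adj r l W p p'" shows "adj r l W p' p"
  using assms unfolding adj_def
proof
  assume "\<exists>x\<in>A. p = (r x, l x) \<and> p' = (r (sw x), l (sw x))"
  then obtain x where x: "x \<in> A" "p = (r x, l x)" "p' = (r (sw x), l (sw x))" by blast
  then show "(p' \<in> W \<and> p \<in> W \<and> fst p' = fst p \<and> {snd p', snd p} \<in> F) \<or>
      (\<exists>x\<in>A. p' = (r x, l x) \<and> p = (r (sw x), l (sw x)))"
    using sw_closed[OF x(1)] sw_sw[OF x(1)] by (intro disjI2 bexI[of _ "sw x"]) auto
qed (auto simp: insert_commute)

lemma adj_edge: assumes "state r l W" "adj r l W p p'" shows "{snd p, snd p'} \<in> F" "p \<in> W" "p' \<in> W"
  using assms labellingD(1,2)[of r l W] sw_closed unfolding adj_def state_def by auto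

text \<open>\<open>y'\<close> is the vertex nearer to the root. If \<open>y\<close> moves and
  \<open>y'\<close> does not, \<open>y\<close> is the first vertex of a translated branch, and the
  edge is a translate of the cut edge from \<open>q\<close> to \<open>q2\<close>. Its place is taken
  by a translate of the relabelled arc, so adjacency survives the shift.\<close>

lemma shift_adj_flow:
  assumes sh: "shiftable v w q" and V: "v \<in> V" "w \<in> V" "q \<in> V" and W: "support W"
    and q2: "{q, q2} \<in> F" "F.btw w q2 q"
    and uy: "(u, y) \<in> W" "(u, y') \<in> W" "{y, y'} \<in> F" "F.btw u y' y"
  shows "fst (shift v w q (u, y)) = fst (shift v w q (u, y')) \<or>
    (\<exists>g\<in>carrier G. y = a g q \<and> y' = a g q2 \<and> shift v w q (u, y) = (a g v, y) \<and> shift v w q (u, y') = (a g w, y'))"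
proof (cases "\<exists>g. mv w q u y g")
  case False
  have uV: "u \<in> V" "y \<in> V" "y' \<in> V" using supportD(1,2)[OF W] uy by auto
  have "\<not> (\<exists>g. mv w q u y' g)"
    using False F.between_trans(1)[OF uy(4)] uV V act_closed unfolding mv_def by blast
  then show ?thesis using False shift_fixed by simp
next
  case True
  have uV: "u \<in> V" "y \<in> V" "y' \<in> V" using supportD(1,2)[OF W] uy by auto
  obtain g where mg: "mv w q u y g" using True by blast
  then have g: "g \<in> carrier G" "u = a g w" "F.btw u (a g q) y" by (auto simp: mv_def)
  have gV: "a g q \<in> V" "a g w \<in> V" "a g q2 \<in> V" using g V act_closed F.edge_in_V[OF q2(1)] by auto
  show ?thesis
  proof (cases "F.btw u (a g q) y'")
    case True
    then have "mv w q u y' g" using g by (simp add: mv_def)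
    then show ?thesis using mg shift_moved[OF sh V] uV by simp
  next
    case no: False
    have "F.btw y' (a g q) y" using F.tripod[OF g(3) uV(1,2) gV(1) uV(3)] no by blast
    then have "F.d y' (a g q) + F.d (a g q) y = 1"
      using F.gdist_edge[OF uy(3)] gdist_sym[of F y y'] by (simp add: between_def)
    then have "F.d y' (a g q) = 0 \<or> F.d (a g q) y = 0" by linarith
    then have "y' = a g q \<or> y = a g q" using F.gdist_eq_0 uV gV by metis
    then have yq: "y = a g q" using no by auto
    have "\<not> (\<exists>h. mv w q u y' h)"
    proof
      assume "\<exists>h. mv w q u y' h"
      then obtain h where h: "h \<in> carrier G" "u = a h w" "F.btw u (a h q) y'" by (auto simp: mv_def)
      have "F.d u (a h q) = F.d u (a g q)" using F.act_gdist[of h w q] F.act_gdist[of g w q] g(1,2) h(1,2) V by metis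
      moreover have "F.d u y = Suc (F.d u y')"
        using uy(4) F.gdist_edge[OF uy(3)] gdist_sym[of F y y'] by (simp add: between_def)
      ultimately show False using h(3) yq by (simp add: between_def)
    qed
    then have s: "shift v w q (u, y') = (a g w, y')" using shift_fixed g by simp
    have "y' = a g q2"
    proof (rule F.closer_unique[of y])
      show "{y, y'} \<in> F" by (rule uy)
      show "{y, a g q2} \<in> F" using F.act_edge[OF g(1) q2(1)] yq by simp
      show "u \<in> V" by (rule uV)
      show "F.d y u = Suc (F.d y' u)"
        using uy(4) F.gdist_edge[OF uy(3)] gdist_sym[of F] by (metis between_def Suc_eq_plus1)
      have "F.d q w = Suc (F.d q2 w)" using q2(2) F.gdist_edge[OF q2(1)] gdist_sym[of F] by (metis between_def Suc_eq_plus1)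
      then show "F.d y u = Suc (F.d (a g q2) u)"
        using F.act_gdist[of g q w] F.act_gdist[of g q2 w] g V yq F.edge_in_V[OF q2(1)] by simp
    qed
    then show ?thesis using s yq g(1) shift_moved[OF sh V mg uV(2)] by blast
  qed
qed

text \<open>The two arcs start at one vertex and end over the same \<open>q\<close>. If the branch
  can move from \<open>w\<close> to \<open>v\<close>, the shift identifies the ends of the arcs, or
  else \<open>(v, q)\<close> is now attached and \<open>\<eta>\<close> folds into the copy at
  \<open>v\<close>. If it cannot move, \<open>St v \<inter> St q \<subseteq> St w\<close>, which
  permits \<open>\<eta>\<close> to slide across \<open>\<epsilon>\<close>. It then joins
  \<open>w\<close> and \<open>x\<close>, which both carry \<open>q\<close>, and folds into one of
  their copies.\<close>

lemma fold_turn: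
  assumes st: "state r l W" and fin: "finite (orbs W)" and A: "\<epsilon> \<in> A" "\<eta> \<in> A" "\<epsilon> \<noteq> \<eta>"
    and same: "r \<epsilon> = r \<eta>" "l \<epsilon> = l \<eta>" "l (sw \<epsilon>) = l (sw \<eta>)"
    and vqW: "(r \<epsilon>, l (sw \<epsilon>)) \<notin> W"
  shows "improves r W \<or> (\<exists>r2 l2 v w q. slide\<^sup>*\<^sup>* (Eo r) (Eo r2) \<and> state r2 l2 (shift v w q ` W) \<and>
    shiftable v w q \<and> v \<in> V \<and> w \<in> V \<and> q \<in> V \<and>
    shift v w q (r (sw \<epsilon>), l (sw \<epsilon>)) = shift v w q (r (sw \<eta>), l (sw \<eta>)) \<and>
    (\<forall>p p'. adj r l W p p' \<longrightarrow> adj r2 l2 (shift v w q ` W) (shift v w q p) (shift v w q p')))"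
proof -
  define v w x p q where "v = r \<epsilon>" and "w = r (sw \<epsilon>)" and "x = r (sw \<eta>)" and "p = l \<epsilon>" and "q = l (sw \<epsilon>)"
  have r: "sys r" and W: "support W" and l: "labelling r l W" using st by (auto simp: state_def)
  have sA: "sw \<epsilon> \<in> A" "sw \<eta> \<in> A" using A sw_closed by auto
  interpret T: gtree G V a "Eo r" using sysD(3)[OF r] .
  have vw: "{v, w} \<in> Eo r" using EoI A by (simp add: v_def w_def)
  have vx: "{v, x} \<in> Eo r" using EoI[of \<eta> r] A same by (simp add: v_def x_def)
  note V = T.edge_in_V[OF vw] T.edge_in_V[OF vx]
  have inW: "(v, p) \<in> W" "(w, q) \<in> W" "(x, q) \<in> W" "(v, q) \<notin> W"
    using labellingD(1)[OF l A(1)] labellingD(1)[OF l sA(1)] labellingD(1)[OF l sA(2)] same vqW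
    unfolding v_def w_def x_def p_def q_def by simp_all
  have pq: "{p, q} \<in> F" using labellingD(2)[OF l A(1)] by (simp add: p_def q_def)
  note pqV = F.edge_in_V[OF pq]
  have K: "St v \<inter> St w \<subseteq> St q" using label_fixed[OF st A(1)] by (simp add: v_def w_def q_def)
  have wx: "w \<noteq> x" using sysD(4)[OF r A(1,2)] A(3) same by (auto simp: w_def x_def)
  \<comment> \<open>Otherwise some element exchanges the labels \<open>p\<close> and
    \<open>q\<close>, an inversion of \<open>F\<close>.\<close>
  have n2: "\<eta> \<notin> orb (sw \<epsilon>)"
  proof
    assume "\<eta> \<in> orb (sw \<epsilon>)"
    then obtain g where g: "g \<in> carrier G" "\<eta> = b g (sw \<epsilon>)" by (auto simp: orb_def)
    then have "sw \<eta> = b g \<epsilon>" using sw_act sw_sw A sA by metis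
    then have "a g q = p" "a g p = q" using g same labellingD(3)[OF l _ g(1)] A sA by (auto simp: p_def q_def)
    then show False using F.no_inv[OF g(1) pq] by blast
  qed
  show ?thesis
  proof (cases "shiftable v w q")
    case False
    have M: "St v \<inter> St q \<subseteq> St w" using not_shiftable[OF T.gtree_axioms vw pqV(2) K False] .
    have n1: "\<eta> \<notin> orb \<epsilon>"
    proof
      assume "\<eta> \<in> orb \<epsilon>"
      then obtain g where g: "g \<in> carrier G" "\<eta> = b g \<epsilon>" by (auto simp: orb_def)
      then have "sw \<eta> = b g (sw \<epsilon>)" using sw_act A by simp
      then have "a g v = v" "a g q = q" "x = a g w"
        using g same labellingD(3)[OF l _ g(1)] sysD(2)[OF r g(1)] A sA by (auto simp: v_def q_def x_def w_def)
      then show False using M g wx by (auto simp: St_def)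
    qed
    obtain J where J: "\<And>g. g \<in> carrier G \<Longrightarrow> J (b g \<eta>) = a g (r (sw \<epsilon>))"
    proof -
      have "a g w = w" if g: "g \<in> carrier G" "b g \<eta> = \<eta>" for g
      proof -
        have "a g v = v" "a g q = q"
          using g same labellingD(3)[OF l sA(2) g(1)] sysD(2)[OF r g(1) A(2)] sw_act[OF g(1) A(2)] by (auto simp: v_def q_def)
        then show ?thesis using M g by (auto simp: St_def)
      qed
      then show ?thesis using ex_equivariant[OF A(2) V(2)] that by (auto simp: w_def)
    qed
    define r1 where "r1 = (\<lambda>x. if x \<in> orb \<eta> then J x else r x)"
    have r1: "sys r1" "slide (Eo r) (Eo r1)"
      using sys_slide[OF r A(2,1) same(1)[symmetric] n1 n2 J] by (auto simp: r1_def)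
    have r1e: "r1 \<eta> = w" "r1 (sw \<eta>) = x"
      using J[OF one_closed] A.act_one[OF A(2)] act_one V orb_self[OF A(2)] sw_notin_orb[OF A(2) orb_self[OF A(2)]]
      by (auto simp: r1_def w_def x_def)
    have off: "(r1 y, l y) \<in> W \<and> {l y, l (sw y)} \<in> F" if "y \<in> A" "y \<notin> orb \<eta>" "y \<notin> orb (sw \<eta>)" for y
      using that labellingD(1,2)[OF l that(1)] by (simp add: r1_def)
    note rel = relabel[OF r1(1) W A(2) off labellingD(3)[OF l], unfolded r1e]
    have vK: "St w \<inter> St x \<subseteq> St v" using T.fix_between T.gdist_two(2)[OF vw vx wx] V by blast
    have qK: "St v \<inter> St x \<subseteq> St q" using label_fixed[OF st A(2)] same by (simp add: v_def x_def q_def)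
    \<comment> \<open>The slid arc needs labels forming an edge of \<open>F\<close>:
      \<open>q\<close> at one end and, at the other, the neighbour of \<open>q\<close> towards that
      end, which exists unless \<open>q\<close> is that end. As \<open>w\<close> and
      \<open>x\<close> differ, one of them serves.\<close>
    have "improves r1 W"
    proof (cases "q = w")
      case False
      obtain q2 where q2: "{q, q2} \<in> F" "F.d q w = Suc (F.d q2 w)" using F.closer_ex pqV V False by blast
      have q2V: "q2 \<in> V" using F.edge_in_V q2 by blast
      have bq2: "F.btw w q2 q" using F.between_adjI[of q2 q w] q2 between_sym[of F] by (metis insert_commute)
      have "St w \<inter> St x \<subseteq> St q2 \<inter> St q" using F.fix_between[OF _ _ bq2] vK qK V pqV q2V by blast
      then obtain l1 where l1: "state r1 l1 W" "l1 \<eta> = q2" "l1 (sw \<eta>) = q"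
        using rel[of q2 q] supportD(5)[OF W inW(2) q2V bq2] inW q2(1) by (auto simp: insert_commute)
      then show ?thesis using fold_into_support[OF l1(1) fin A(2)] inW r1e by simp
    next
      case True
      then have "q \<noteq> x" using wx by simp
      then obtain q2 where q2: "{q, q2} \<in> F" "F.d q x = Suc (F.d q2 x)" using F.closer_ex pqV V by blast
      have q2V: "q2 \<in> V" using F.edge_in_V q2 by blast
      have bq2: "F.btw x q2 q" using F.between_adjI[of q2 q x] q2 between_sym[of F] by (metis insert_commute)
      have "St w \<inter> St x \<subseteq> St q \<inter> St q2" using F.fix_between[OF _ _ bq2] vK qK V pqV q2V by blast
      then obtain l1 where l1: "state r1 l1 W" "l1 \<eta> = q" "l1 (sw \<eta>) = q2"
        using rel[of q q2] supportD(5)[OF W inW(3) q2V bq2] inW q2(1) by auto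
      then show ?thesis using fold_into_support[OF l1(1) fin sA(2)] inW r1e sw_sw[OF A(2)] by simp
    qed
    then show ?thesis using improves_trans[of r r1 W W] r1(2) by blast
  next
    case sh: True
    let ?s = "shift v w q"
    \<comment> \<open>Otherwise \<open>q\<close> would lie between \<open>v\<close> and
      \<open>p\<close> and be attached to \<open>v\<close> already.\<close>
    have bpq: "F.btw v p q"
      using F.gdist_adj[OF pq V(1)] F.between_adjI supportD(5)[OF W inW(1) pqV(2)] inW(4) pq gdist_sym[of F v]
        F.gdist_edge[OF pq] gdist_sym[of F p q] unfolding between_def by (metis Suc_eq_plus1)
    have below: "(v, z) \<in> W" if z: "z \<in> V" "F.btw v z q" "z \<noteq> q" for z
    proof -
      consider "F.btw v z p" | "F.btw p z q" using F.tripod[OF z(2) V(1) pqV(2) z(1) pqV(1)] by blast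
      then show ?thesis
      proof cases
        case 1 then show ?thesis using supportD(5)[OF W inW(1) z(1)] by blast
      next
        case 2
        then have "F.d p z + F.d z q = 1" using F.gdist_edge[OF pq] by (simp add: between_def)
        moreover have "F.d z q \<noteq> 0" using F.gdist_eq_0 z pqV by blast
        ultimately have "F.d p z = 0" by linarith
        then show ?thesis using F.gdist_eq_0 z pqV inW(1) by blast
      qed
    qed
    obtain r2 l2 q2 where r2: "slide\<^sup>*\<^sup>* (Eo r) (Eo r2)" "state r2 l2 (?s ` W)"
      and off: "\<And>y. y \<in> A \<Longrightarrow> y \<notin> orb \<epsilon> \<Longrightarrow> y \<notin> orb (sw \<epsilon>) \<Longrightarrow> (r2 y, l2 y) = ?s (r y, l y)"
      and on: "\<And>g. g \<in> carrier G \<Longrightarrow> r2 (b g \<epsilon>) = a g v \<and> l2 (b g \<epsilon>) = a g q \<and> r2 (b g (sw \<epsilon>)) = a g w \<and> l2 (b g (sw \<epsilon>)) = a g q2"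
      and q2: "{q, q2} \<in> F" "F.btw w q2 q"
      using shift_state[OF st A(1) v_def w_def pqV(2) sh K inW(2) below] by blast
    note shV = sh V(1,2) pqV(2)
    have "mv w q w q \<one>" using act_one V pqV by (simp add: mv_def)
    then have swq: "?s (w, q) = (v, q)" using shift_moved[OF shV] act_one V pqV by simp
    have svp: "?s (v, p) = (v, p)" using shift_fixed shift_between[OF shV pqV(1) bpq] by blast
    have W2: "support (?s ` W)" using r2 by (simp add: state_def)
    show ?thesis
    proof (cases "?s (x, q) = (v, q)")
      case False
      have "\<eta> \<notin> orb \<epsilon>"
      proof
        assume "\<eta> \<in> orb \<epsilon>"
        then obtain g where g: "g \<in> carrier G" "\<eta> = b g \<epsilon>" by (auto simp: orb_def)
        then have "sw \<eta> = b g (sw \<epsilon>)" using sw_act A by simp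
        then have "a g v = v" "a g q = q" "x = a g w"
          using g same labellingD(3)[OF l _ g(1)] sysD(2)[OF r g(1)] A sA by (auto simp: v_def q_def x_def w_def)
        then have "?s (x, q) = (v, q)" using shift_act[OF shV g(1) V(2) pqV(2)] swq by simp
        then show False using False by simp
      qed
      then have e: "(r2 \<eta>, l2 \<eta>) = (v, p)" "(r2 (sw \<eta>), l2 (sw \<eta>)) = ?s (x, q)"
        using off[OF A(2)] off[OF sA(2)] n2 orb_sw[OF A(1) A(2)] orb_sw[OF A(1) sA(2)] sw_sw[OF A(2)] svp same
        by (auto simp: v_def p_def x_def q_def)
      have "l2 (sw \<eta>) = q" using e(2) snd_shift[of v w q "(x, q)"] by (metis snd_conv)
      moreover have "(v, q) \<in> ?s ` W" using swq inW(2) by (metis imageI)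
      ultimately have "improves r2 (?s ` W)"
        using fold_into_support[OF r2(2) shift_orbs(1)[OF shV W fin] A(2)] e(1) by simp
      then show ?thesis using improves_trans r2(1) shift_orbs(2)[OF shV W fin] by blast
    next
      case True
      have flow: "adj r2 l2 (?s ` W) (?s (u, y)) (?s (u, y'))"
        if uy: "(u, y) \<in> W" "(u, y') \<in> W" "{y, y'} \<in> F" "F.btw u y' y" for u y y'
        using shift_adj_flow[OF shV W q2 uy]
      proof
        assume "fst (?s (u, y)) = fst (?s (u, y'))"
        then show ?thesis using uy by (auto simp: adj_def)
      next
        assume "\<exists>g\<in>carrier G. y = a g q \<and> y' = a g q2 \<and> ?s (u, y) = (a g v, y) \<and> ?s (u, y') = (a g w, y')"
        then obtain g where g: "g \<in> carrier G" "y = a g q" "y' = a g q2" "?s (u, y) = (a g v, y)" "?s (u, y') = (a g w, y')" by blast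
        moreover have "sw (b g \<epsilon>) = b g (sw \<epsilon>)" "b g \<epsilon> \<in> A" using sw_act A A.act_closed g by auto
        ultimately show ?thesis using on[OF g(1)] unfolding adj_def by (intro disjI2 bexI[of _ "b g \<epsilon>"]) auto
      qed
      \<comment> \<open>Before the shift, the translates of \<open>\<epsilon>\<close> join those of
        \<open>(v, p)\<close> to those of \<open>(w, q)\<close>; afterwards these pairs are edges
        inside the copies at translates of \<open>v\<close>.\<close>
      have base: "adj r2 l2 (?s ` W) (?s (a g v, a g p)) (?s (a g w, a g q))" if g: "g \<in> carrier G" for g
      proof -
        have s: "?s (a g v, a g p) = (a g v, a g p)" "?s (a g w, a g q) = (a g v, a g q)"
          using shift_act[OF shV g] V pqV svp swq by auto
        moreover have "?s (a g v, a g p) \<in> ?s ` W" "?s (a g w, a g q) \<in> ?s ` W" using supportD(4)[OF W g] inW by auto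
        ultimately show ?thesis using F.act_edge[OF g pq] by (simp add: adj_def)
      qed
      have "adj r2 l2 (?s ` W) (?s P) (?s P')" if "adj r l W P P'" for P P'
        using that unfolding adj_def[of r]
      proof
        assume h: "P \<in> W \<and> P' \<in> W \<and> fst P = fst P' \<and> {snd P, snd P'} \<in> F"
        define u y y' where "u = fst P" and "y = snd P" and "y' = snd P'"
        have P: "P = (u, y)" "P' = (u, y')" using h by (auto simp: u_def y_def y'_def prod_eq_iff)
        have "F.btw u y' y \<or> F.btw u y y'"
          using F.between_adj_cases[of y y' u] h P supportD(1)[OF W] between_sym[of F] by auto
        moreover have "{y', y} \<in> F" using h P by (simp add: insert_commute)
        ultimately show ?thesis using flow[of u y y'] adj_sym[OF flow[of u y' y]] h P by auto
      next
        assume "\<exists>y\<in>A. P = (r y, l y) \<and> P' = (r (sw y), l (sw y))"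
        then obtain y where y: "y \<in> A" "P = (r y, l y)" "P' = (r (sw y), l (sw y))" by blast
        consider (1) g where "g \<in> carrier G" "y = b g \<epsilon>" | (2) g where "g \<in> carrier G" "y = b g (sw \<epsilon>)"
          | (3) "y \<notin> orb \<epsilon>" "y \<notin> orb (sw \<epsilon>)" by (auto simp: orb_def)
        then show ?thesis
        proof cases
          case 1
          then have "P = (a g v, a g p)" "P' = (a g w, a g q)"
            using y sw_act A sA sysD(2)[OF r] labellingD(3)[OF l] by (auto simp: v_def w_def p_def q_def)
          then show ?thesis using base 1 by simp
        next
          case 2
          then have "P' = (a g v, a g p)" "P = (a g w, a g q)"
            using y sw_act sw_sw A sA sysD(2)[OF r] labellingD(3)[OF l] by (auto simp: v_def w_def p_def q_def)
          then show ?thesis using base 2 adj_sym by simp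
        next
          case 3
          then have "sw y \<notin> orb \<epsilon>" "sw y \<notin> orb (sw \<epsilon>)"
            using orb_sw[OF A(1) y(1)] orb_sw[OF A(1) sw_closed[OF y(1)]] sw_sw[OF y(1)] by auto
          then have "(r2 y, l2 y) = ?s P" "(r2 (sw y), l2 (sw y)) = ?s P'" using off y 3 sw_closed by auto
          then show ?thesis using y(1) unfolding adj_def by (intro disjI2 bexI[of _ y]) auto
        qed
      qed
      moreover have "?s (r (sw \<epsilon>), l (sw \<epsilon>)) = ?s (r (sw \<eta>), l (sw \<eta>))"
        using True swq same by (simp add: w_def x_def q_def)
      ultimately show ?thesis using r2 shV by blast
    qed
  qed
qed

section \<open>Connectedness and the double induction\<close>

lemma adj_to_root:
  assumes st: "state r l W" and "(v, y) \<in> W"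
  shows "(adj r l W)\<^sup>*\<^sup>* (v, y) (v, v)"
  using assms(2)
proof (induction "F.d y v" arbitrary: y)
  case 0
  have W: "support W" using st by (simp add: state_def)
  have "y = v" using 0 F.gdist_eq_0[of y v] supportD(1,2)[OF W] by auto
  then show ?case by simp
next
  case (Suc n)
  have W: "support W" using st by (simp add: state_def)
  note V = supportD(1,2)[OF W Suc.prems]
  have "y \<noteq> v" using Suc.hyps(2) by auto
  then obtain z where z: "{y, z} \<in> F" "F.d y v = Suc (F.d z v)" using F.closer_ex V by blast
  have zV: "z \<in> V" using F.edge_in_V z by blast
  have "F.btw v z y" using F.between_adjI[of z y v] z between_sym[of F] by (metis insert_commute)
  then have "(v, z) \<in> W" using supportD(5)[OF W Suc.prems zV] by blast
  then have "adj r l W (v, y) (v, z)" "(adj r l W)\<^sup>*\<^sup>* (v, z) (v, v)"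
    using z Suc by (auto simp: adj_def)
  then show ?case by (meson converse_rtranclp_into_rtranclp)
qed

lemma adj_rtranclp_sym: "(adj r l W)\<^sup>*\<^sup>* p p' \<Longrightarrow> (adj r l W)\<^sup>*\<^sup>* p' p"
  by (induction rule: rtranclp_induct) (auto intro: adj_sym converse_rtranclp_into_rtranclp)

text \<open>Every edge of \<open>Eo r\<close> lifts to a path between roots, running through the
  copies at its ends and along its arc, and \<open>Eo r\<close> is connected.\<close>

lemma adj_connected:
  assumes st: "state r l W" and vy: "(v, y) \<in> W"
  shows "(adj r l W)\<^sup>*\<^sup>* (v, y) (y, y)"
proof -
  have r: "sys r" and W: "support W" and l: "labelling r l W" using st by (auto simp: state_def)
  interpret T: gtree G V a "Eo r" using sysD(3)[OF r] .
  have step: "(adj r l W)\<^sup>*\<^sup>* (r x, r x) (r (sw x), r (sw x))" if x: "x \<in> A" for x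
  proof -
    have "(adj r l W)\<^sup>*\<^sup>* (r x, r x) (r x, l x)"
      using adj_rtranclp_sym adj_to_root[OF st] labellingD(1)[OF l x] by blast
    moreover have "adj r l W (r x, l x) (r (sw x), l (sw x))" using x by (auto simp: adj_def)
    moreover have "(adj r l W)\<^sup>*\<^sup>* (r (sw x), l (sw x)) (r (sw x), r (sw x))"
      using adj_to_root[OF st] labellingD(1)[OF l sw_closed[OF x]] by blast
    ultimately show ?thesis by (meson rtranclp.rtrancl_into_rtrancl rtranclp_trans)
  qed
  have "(v, y) \<in> (adjacent (Eo r))\<^sup>*" using T.connected supportD(1,2)[OF W vy] by blast
  then have "(adj r l W)\<^sup>*\<^sup>* (v, v) (y, y)"
  proof induction
    case (step y z)
    then obtain x where x: "x \<in> A" "{y, z} = {r x, r (sw x)}" by (auto simp: adjacent_def Eo_def)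
    then have "(adj r l W)\<^sup>*\<^sup>* (y, y) (z, z)"
      using \<open>\<And>x. x \<in> A \<Longrightarrow> (adj r l W)\<^sup>*\<^sup>* (r x, r x) (r (sw x), r (sw x))\<close>[OF x(1)] adj_rtranclp_sym
      unfolding doubleton_eq_iff by metis
    then show ?case using step.IH by (meson rtranclp_trans)
  qed simp
  then show ?thesis using adj_to_root[OF st vy] by (meson rtranclp_trans)
qed

text \<open>When only roots are left, the labels are the ends of the arcs, so the edges of
  \<open>Eo r\<close> are edges of \<open>F\<close>, and a tree on all of \<open>V\<close> inside
  \<open>F\<close> is \<open>F\<close>.\<close>

lemma unfolded:
  assumes st: "state r l W" and "ext W = {}"
  shows "Eo r = F"
proof -
  have r: "sys r" and W: "support W" and l: "labelling r l W" using st by (auto simp: state_def)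
  interpret T: gtree G V a "Eo r" using sysD(3)[OF r] .
  have lr: "l x = r x" if "x \<in> A" for x using labellingD(1)[OF l that] assms(2) unfolding ext_def by fastforce
  have "Eo r \<subseteq> F" using labellingD(2)[OF l] lr sw_closed unfolding Eo_def by fastforce
  then show ?thesis using F.subtree_eq T.cut_tree_axioms by blast
qed

text \<open>\<open>(v, y)\<close> and the root \<open>(y, y)\<close> lie over the same vertex of
  \<open>F\<close>, so a walk between them projects to a closed walk, which backtracks. There two
  neighbours of a vertex lie over one vertex of \<open>F\<close>, and folding them together removes
  an orbit or shortens the walk by two steps. The outer induction is on the number of orbits; the
  inner one is on the length \<open>n\<close> of any such walk.\<close>

theorem slides_to_target:
  assumes "state r l W" "finite (orbs W)"
  shows "slide\<^sup>*\<^sup>* (Eo r) F"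
  using assms
proof (induction "card (orbs W)" arbitrary: r l W rule: less_induct)
  case (less W)
  note outer = less.hyps
  have via: "slide\<^sup>*\<^sup>* (Eo r') F" if imp: "improves r' W'" and le: "card (orbs W') \<le> card (orbs W)" for r' W'
  proof -
    obtain r2 l2 W2 where "slide\<^sup>*\<^sup>* (Eo r') (Eo r2)" "state r2 l2 W2" "finite (orbs W2)" "card (orbs W2) < card (orbs W')"
      using imp unfolding improves_def by blast
    then show ?thesis using outer[of W2 r2 l2] le by (meson order_less_le_trans rtranclp_trans)
  qed
  have inner: "slide\<^sup>*\<^sup>* (Eo r') F"
    if "state r' l' W'" "finite (orbs W')" "card (orbs W') \<le> card (orbs W)" "p \<in> ext W'" "(adj r' l' W' ^^ n) p (snd p, snd p)"
    for r' l' W' p n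
    using that
  proof (induction n arbitrary: r' l' W' p rule: less_induct)
    case (less n)
    note st = less.prems(1) and fin = less.prems(2) and le = less.prems(3) and p = less.prems(4)
    have r: "sys r'" and W: "support W'" using st by (auto simp: state_def)
    have pV: "snd p \<in> V" using supportD(2)[OF W, of "fst p" "snd p"] p by (simp add: ext_def)
    obtain s where s: "s 0 = p" "s n = (snd p, snd p)" "\<And>i. i < n \<Longrightarrow> adj r' l' W' (s i) (s (Suc i))"
      using less.prems(5) unfolding relpowp_fun_conv by blast
    have n: "n > 0"
    proof (rule ccontr)
      assume "\<not> 0 < n"
      then have "p = (snd p, snd p)" using s by simp
      then have "fst p = snd p" by (metis fst_conv)
      then show False using p by (simp add: ext_def)
    qed
    have seg: "(adj r' l' W' ^^ (j - i)) (s i) (s j)" if "i \<le> j" "j \<le> n" for i j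
      unfolding relpowp_fun_conv using that s(3) by (intro exI[of _ "\<lambda>k. s (i + k)"]) auto
    obtain i where i: "0 < i" "i < n" "snd (s (i - 1)) = snd (s (i + 1))"
      using F.backtrack[of "\<lambda>i. snd (s i)" n] s adj_edge(1)[OF st] n by auto
    have a1: "adj r' l' W' (s i) (s (i - 1))" using s(3)[of "i - 1"] i adj_sym by simp
    have a2: "adj r' l' W' (s i) (s (i + 1))" using s(3)[of i] i by simp
    show ?case
    proof (cases "s (i - 1) = s (i + 1)")
      case True
      have "(adj r' l' W' ^^ (i - 1)) p (s (i - 1))" "(adj r' l' W' ^^ (n - (i + 1))) (s (i - 1)) (snd p, snd p)"
        using seg[of 0 "i - 1"] seg[of "i + 1" n] i s True by auto
      then have "(adj r' l' W' ^^ ((i - 1) + (n - (i + 1)))) p (snd p, snd p)" using relpowp_trans by metis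
      moreover have "(i - 1) + (n - (i + 1)) < n" using i by simp
      ultimately show ?thesis using less.IH st fin le p by blast
    next
      case False
      have bridge: "slide\<^sup>*\<^sup>* (Eo r') F" if "x \<in> A" "(r' x, l' (sw x)) \<in> W'" for x
        using via[OF fold_into_support[OF st fin that] le] .
      have flow_bridge: "slide\<^sup>*\<^sup>* (Eo r') F"
        if "c \<in> W'" "c' \<in> W'" "fst c = fst c'" "x \<in> A" "c = (r' x, l' x)" "d = (r' (sw x), l' (sw x))" "snd c' = snd d" for c c' d x
      proof -
        have "c' = (r' x, l' (sw x))" using that by (simp add: prod_eq_iff)
        then show ?thesis using bridge that by simp
      qed
      from a1 a2 consider
        (ff) "fst (s i) = fst (s (i - 1))" "fst (s i) = fst (s (i + 1))"
        | (fb) x where "s i \<in> W'" "s (i - 1) \<in> W'" "fst (s i) = fst (s (i - 1))" "x \<in> A" "s i = (r' x, l' x)" "s (i + 1) = (r' (sw x), l' (sw x))"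
        | (bf) x where "s i \<in> W'" "s (i + 1) \<in> W'" "fst (s i) = fst (s (i + 1))" "x \<in> A" "s i = (r' x, l' x)" "s (i - 1) = (r' (sw x), l' (sw x))"
        | (bb) \<epsilon> \<eta> where "\<epsilon> \<in> A" "\<eta> \<in> A" "s i = (r' \<epsilon>, l' \<epsilon>)" "s (i - 1) = (r' (sw \<epsilon>), l' (sw \<epsilon>))"
            "s i = (r' \<eta>, l' \<eta>)" "s (i + 1) = (r' (sw \<eta>), l' (sw \<eta>))"
        unfolding adj_def by metis
      then show ?thesis
      proof cases
        case ff
        then have "s (i - 1) = s (i + 1)" using i by (simp add: prod_eq_iff)
        then show ?thesis using False by simp
      next
        case fb
        then show ?thesis using flow_bridge i(3) by blast
      next
        case bf
        then show ?thesis using flow_bridge i(3) by metis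
      next
        case bb
        show ?thesis
        proof (cases "(r' \<epsilon>, l' (sw \<epsilon>)) \<in> W'")
          case True
          then show ?thesis using bridge bb by blast
        next
          case nW: False
          have "\<epsilon> \<noteq> \<eta>" "r' \<epsilon> = r' \<eta>" "l' \<epsilon> = l' \<eta>" "l' (sw \<epsilon>) = l' (sw \<eta>)" using bb False i(3) by auto
          then consider "improves r' W'" | r2 l2 v w q where "slide\<^sup>*\<^sup>* (Eo r') (Eo r2)" "state r2 l2 (shift v w q ` W')"
              "shiftable v w q" "v \<in> V" "w \<in> V" "q \<in> V" "shift v w q (s (i - 1)) = shift v w q (s (i + 1))"
              "\<And>p p'. adj r' l' W' p p' \<Longrightarrow> adj r2 l2 (shift v w q ` W') (shift v w q p) (shift v w q p')"
            using fold_turn[OF st fin bb(1,2) _ _ _ _ nW] unfolding bb(4,6) by blast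
          then show ?thesis
          proof cases
            case 1
            then show ?thesis using via le by blast
          next
            case 2
            let ?s = "shift v w q"
            have sub: "card (orbs (?s ` W')) \<le> card (orbs W)" using shift_orbs(2)[OF 2(3-6) W fin] le by simp
            have fin2: "finite (orbs (?s ` W'))" using shift_orbs(1)[OF 2(3-6) W fin] .
            show ?thesis
            \<comment> \<open>If the start of the walk has become a root, its orbit is no longer
              counted and the outer induction applies.\<close>
            proof (cases "fst (?s p) = snd p")
              case True
              then have "card (orbs (?s ` W')) < card (orbs W)" using shift_orbs(3)[OF 2(3-6) W fin p] le by simp
              then have "slide\<^sup>*\<^sup>* (Eo r2) F" using outer 2(2) fin2 by blast
              then show ?thesis using 2(1) by (meson rtranclp_trans)
            next
              case ne: False
              have walk: "(adj r2 l2 (?s ` W') ^^ m) (?s c) (?s d)" if cd: "(adj r' l' W' ^^ m) c d" for m c d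
              proof -
                obtain f where f: "f 0 = c" "f m = d" "\<And>i. i < m \<Longrightarrow> adj r' l' W' (f i) (f (Suc i))"
                  using cd unfolding relpowp_fun_conv by blast
                then show ?thesis unfolding relpowp_fun_conv using 2(8) by (intro exI[of _ "\<lambda>i. ?s (f i)"]) auto
              qed
              have root: "?s (snd p, snd p) = (snd p, snd p)" using shift_fixed shift_root[OF 2(3-6) pV] by blast
              have "(adj r2 l2 (?s ` W') ^^ (i - 1)) (?s p) (?s (s (i - 1)))"
                "(adj r2 l2 (?s ` W') ^^ (n - (i + 1))) (?s (s (i - 1))) (snd p, snd p)"
                using walk[OF seg[of 0 "i - 1"]] walk[OF seg[of "i + 1" n]] i s root 2(7) by auto
              then have "(adj r2 l2 (?s ` W') ^^ ((i - 1) + (n - (i + 1)))) (?s p) (snd (?s p), snd (?s p))"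
                using relpowp_trans by (metis snd_shift)
              moreover have "(i - 1) + (n - (i + 1)) < n" using i by simp
              moreover have "?s p \<in> ext (?s ` W')" using p ne by (auto simp: ext_def)
              ultimately have "slide\<^sup>*\<^sup>* (Eo r2) F" using less.IH 2(2) fin2 sub by blast
              then show ?thesis using 2(1) by (meson rtranclp_trans)
            qed
          qed
        qed
      qed
    qed
  qed
  show ?case
  proof (cases "ext W = {}")
    case True
    then show ?thesis using unfolded less.prems by simp
  next
    case False
    then obtain v y where vy: "(v, y) \<in> ext W" by auto
    then have "(adj r l W)\<^sup>*\<^sup>* (v, y) (y, y)" using adj_connected[OF less.prems(1)] by (simp add: ext_def)
    then obtain n where "(adj r l W ^^ n) (v, y) (snd (v, y), snd (v, y))" using rtranclp_imp_relpowp by fastforce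
    then show ?thesis using inner[OF less.prems order_refl vy] by blast
  qed
qed

end

section \<open>Deformation spaces of reduced trees\<close>

subsection \<open>Transport of structure\<close>

lemma (in gset) transport_gset:
  assumes "\<And>g x. g \<in> carrier G \<Longrightarrow> x \<in> V \<Longrightarrow> c g (f x) = f (a g x)"
  shows "gset G (f ` V) c"
  by unfold_locales (use assms act_closed act_one act_mult in auto)

lemma (in gtree) transport_gtree:
  assumes c: "\<And>g x. g \<in> carrier G \<Longrightarrow> x \<in> V \<Longrightarrow> c g (f x) = f (a g x)" and f: "inj_on f V"
  shows "gtree G (f ` V) c ((`) f ` E)"
proof -
  interpret C: gset G "f ` V" c using transport_gset c by blast
  have edge: "\<exists>u w. {u, w} \<in> E \<and> p = f u \<and> r = f w" if pr: "{p, r} \<in> (`) f ` E" for p r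
  proof -
    obtain e where e: "e \<in> E" "{p, r} = f ` e" using pr by blast
    then obtain u w where uw: "e = {u, w}" using edge_ends by blast
    then have "(p = f u \<and> r = f w) \<or> (p = f w \<and> r = f u)" using e(2) by (auto simp: doubleton_eq_iff)
    moreover have "{u, w} \<in> E" "{w, u} \<in> E" using e(1) uw by (simp_all add: insert_commute)
    ultimately show ?thesis by blast
  qed
  have edgeI: "{f u, f w} \<in> (`) f ` E" if "{u, w} \<in> E" for u w using imageI[OF that, of "(`) f"] by simp
  show ?thesis
  proof
    fix e assume "e \<in> (`) f ` E"
    then obtain e' where e': "e' \<in> E" "e = f ` e'" by blast
    then obtain u w where uw: "u \<in> V" "w \<in> V" "u \<noteq> w" "e' = {u, w}" using edge_ends by blast
    then show "\<exists>u\<in>f ` V. \<exists>w\<in>f ` V. u \<noteq> w \<and> e = {u, w}" using e' f by (auto simp: inj_on_eq_iff)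
  next
    fix p r assume "p \<in> f ` V" "r \<in> f ` V"
    then obtain u w where uw: "u \<in> V" "w \<in> V" "p = f u" "r = f w" by blast
    have "(u, w) \<in> (adjacent E)\<^sup>*" using connected uw by blast
    then have "(f u, f w) \<in> (adjacent ((`) f ` E))\<^sup>*"
    proof induction
      case (step y z)
      then have "(f y, f z) \<in> adjacent ((`) f ` E)" using edgeI by (auto simp: adjacent_def)
      then show ?case using step.IH by (rule rtrancl.rtrancl_into_rtrancl[rotated])
    qed simp
    then show "(p, r) \<in> (adjacent ((`) f ` E))\<^sup>*" using uw by simp
  next
    fix p r assume "{p, r} \<in> (`) f ` E"
    then obtain u w where uw: "{u, w} \<in> E" "p = f u" "r = f w" using edge by blast
    obtain S where S: "separates E S u w" using cut uw by blast
    have mem: "f z \<in> f ` (S \<inter> V) \<longleftrightarrow> z \<in> S" if "z \<in> V" for z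
      using inj_on_image_mem_iff[OF f that, of "S \<inter> V"] that by auto
    have "separates ((`) f ` E) (f ` (S \<inter> V)) p r"
      unfolding separates_def
    proof (intro conjI allI impI)
      show "p \<notin> f ` (S \<inter> V)" "r \<in> f ` (S \<inter> V)" using uw S mem edge_in_V[OF uw(1)] by (auto simp: separates_def)
      fix y z assume yz: "{y, z} \<in> (`) f ` E" "y \<in> f ` (S \<inter> V)" "z \<notin> f ` (S \<inter> V)"
      then obtain y' z' where y': "{y', z'} \<in> E" "y = f y'" "z = f z'" using edge by blast
      then have "y' \<in> S" "z' \<notin> S" using yz mem edge_in_V[OF y'(1)] by auto
      then have "y' = w" "z' = u" using S y'(1) unfolding separates_def by blast+
      then show "y = r" "z = p" using y' uw by auto
    qed
    then show "\<exists>S. separates ((`) f ` E) S p r" by blast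
  next
    fix g p r assume g: "g \<in> carrier G" and "{p, r} \<in> (`) f ` E"
    then obtain u w where uw: "{u, w} \<in> E" "p = f u" "r = f w" using edge by blast
    note V = edge_in_V[OF uw(1)]
    then show "{c g p, c g r} \<in> (`) f ` E" using edgeI[OF act_edge[OF g uw(1)]] c g uw by simp
    assume "c g p = r" "c g r = p"
    then have "a g u = w" "a g w = u" using c g uw V f act_closed by (auto simp: inj_on_eq_iff)
    then show False using no_inv g uw by blast
  qed
qed

subsection \<open>Strict ascending loops\<close>

lemma G_tree_gtree:
  assumes "group G" "G_tree G T"
  shows "gtree G (verts T) (act T) (edges T)"
proof -
  interpret group G by fact
  interpret ga: group_action G "verts T" "act T" using assms by (simp add: G_tree_def)
  interpret gset G "verts T" "act T"
  proof
    show "act T g x \<in> verts T" if "g \<in> carrier G" "x \<in> verts T" for g x using ga.element_image that by blast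
    show "act T \<one>\<^bsub>G\<^esub> x = x" if "x \<in> verts T" for x using ga.id_eq_one that by (metis restrict_apply')
    show "act T (g \<otimes>\<^bsub>G\<^esub> h) x = act T g (act T h x)" if "g \<in> carrier G" "h \<in> carrier G" "x \<in> verts T" for g h x
      using ga.composition_rule that by blast
  qed
  interpret cut_tree "verts T" "edges T" using assms simplicial_tree_imp_cut_tree by (auto simp: G_tree_def)
  show ?thesis
  proof
    fix g u w assume g: "g \<in> carrier G" "{u, w} \<in> edges T"
    then have "edge_act T g {u, w} \<in> edges T" using assms(2) by (auto simp: G_tree_def)
    then show "{act T g u, act T g w} \<in> edges T" by (simp add: edge_act_def)
    show False if "act T g u = w" "act T g w = u"
      using that g assms(2) unfolding G_tree_def without_inversions_def by blast
  qed
qed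

text \<open>The values of a \<open>group_action\<close> are extensional bijections, hence the
  restriction to \<open>V\<close>.\<close>

lemma (in gset) group_actionI: "group_action G V (\<lambda>g. restrict (a g) V)"
proof -
  have bij: "bij_betw (a g) V V" if "g \<in> carrier G" for g
    by (rule bij_betw_byWitness[of _ "a (inv g)"]) (use that act_inv act_closed in auto)
  have Bij: "restrict (a g) V \<in> Bij V" if "g \<in> carrier G" for g
    using bij[OF that] by (simp add: Bij_def bij_betw_restrict_eq)
  have "(\<lambda>g. restrict (a g) V) \<in> hom G (BijGroup V)"
  proof (rule homI)
    fix g h assume gh: "g \<in> carrier G" "h \<in> carrier G"
    show "restrict (a (g \<otimes> h)) V = restrict (a g) V \<otimes>\<^bsub>BijGroup V\<^esub> restrict (a h) V"
      using gh Bij act_mult act_closed by (auto simp: BijGroup_def compose_def fun_eq_iff)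
  qed (use Bij in \<open>simp add: BijGroup_def\<close>)
  then show ?thesis using group_BijGroup is_group
    by (auto simp: group_action_def group_hom_def group_hom_axioms_def)
qed

lemma (in gset) edge_stabilizer_eq:
  assumes "gtree G V a E" "{u, w} \<in> E" "\<And>g e. c g e = a g ` e"
  shows "stabilizer G c {u, w} = St u \<inter> St w"
proof -
  interpret gtree G V a E by fact
  show ?thesis using no_inv[OF _ assms(2)] assms(3) by (auto simp: stabilizer_def St_def doubleton_eq_iff)
qed

lemma (in gset) St_image_conj:
  assumes "g \<in> carrier G" "x \<in> V"
  shows "(\<lambda>h. g \<otimes> h \<otimes> inv g) ` St x = St (a g x)"
proof (rule equalityI; rule subsetI)
  fix h assume h: "h \<in> St (a g x)"
  then have "h = g \<otimes> (inv g \<otimes> h \<otimes> g) \<otimes> inv g"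
    using assms St_carrier[OF h] by (simp add: m_assoc) (simp add: m_assoc[symmetric])
  then show "h \<in> (\<lambda>h. g \<otimes> h \<otimes> inv g) ` St x" using St_conj'[OF assms h] by blast
qed (use St_conj[OF assms] in auto)

lemma (in gset) St_act_subset:
  assumes "g \<in> carrier G" "x \<in> V" "y \<in> V"
  shows "St (a g x) \<subseteq> St (a g y) \<longleftrightarrow> St x \<subseteq> St y"
proof -
  have "inj_on (\<lambda>h. g \<otimes> h \<otimes> inv g) (carrier G)" using assms by (auto simp: inj_on_def)
  moreover have "St x \<subseteq> carrier G" "St y \<subseteq> carrier G" using St_carrier by auto
  ultimately show ?thesis unfolding St_image_conj[OF assms(1,2), symmetric] St_image_conj[OF assms(1,3), symmetric]
    unfolding inj_on_def by blast
qed

text \<open>The representatives chosen in the quotient change the groups only by conjugation, which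
  preserves inclusions between stabilizers.\<close>

lemma loop_inclusion_onto:
  fixes G :: "('g, 'm) monoid_scheme" (structure) and T :: "('g, 'v) action_tree"
  assumes "group G" "G_tree G T" "{p, q} \<in> edges T"
  defines "z \<equiv> {(act T h p, act T h q) | h. h \<in> carrier G}"
  defines "\<Gamma> \<equiv> quotient_graph_of_groups G T"
  shows "gog_inclusion \<Gamma> z ` gog_edge_group \<Gamma> z = gog_vertex_group \<Gamma> (gog_origin \<Gamma> z) \<longleftrightarrow>
    gset.St G (act T) p \<subseteq> gset.St G (act T) q"
proof -
  interpret gtree G "verts T" "act T" "edges T" using G_tree_gtree assms by blast
  note V = edge_in_V[OF assms(3)]
  have z: "(act T h p, act T h q) \<in> z" if "h \<in> carrier G" for h using that by (auto simp: z_def)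
  have "edge_rep z \<in> (\<lambda>(u, w). {u, w}) ` z" unfolding edge_rep_def
    by (rule someI[of _ "{act T \<one>\<^bsub>G\<^esub> p, act T \<one>\<^bsub>G\<^esub> q}"]) (use z[OF one_closed] in force)
  then obtain h where h: "h \<in> carrier G" "edge_rep z = {act T h p, act T h q}" by (auto simp: z_def)
  have "\<exists>w. (origin_rep z, w) \<in> z \<and> {origin_rep z, w} = edge_rep z" unfolding origin_rep_def
    by (rule someI[of _ "act T h p"]) (use z h in auto)
  then obtain k where k: "k \<in> carrier G" "origin_rep z = act T k p" "{act T k p, act T k q} = {act T h p, act T h q}"
    using h by (auto simp: z_def)
  have o: "origin_rep z = act T h p" using orbE_eqD[OF assms(3) k(1) h(1) k(3)] k by simp
  have "vertex_rep (fst ` z) \<in> fst ` z" unfolding vertex_rep_def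
    by (rule someI[of _ "act T h p"]) (use z[OF h(1)] in force)
  then obtain m where m: "m \<in> carrier G" "vertex_rep (fst ` z) = act T m p" by (auto simp: z_def)
  define t where "t = transport G T z"
  have "t \<in> carrier G \<and> act T t (origin_rep z) = vertex_rep (fst ` z)" unfolding t_def transport_def
  proof (rule someI[of _ "m \<otimes> inv h"])
    show "m \<otimes> inv h \<in> carrier G \<and> act T (m \<otimes> inv h) (origin_rep z) = vertex_rep (fst ` z)"
      using m h o act_mult act_inv act_closed V by simp
  qed
  then have t: "t \<in> carrier G" "act T t (act T h p) = vertex_rep (fst ` z)" using o by auto
  have es: "edge_stabilizer G T (edge_rep z) = St (act T h p) \<inter> St (act T h q)"
    unfolding h(2) by (rule edge_stabilizer_eq[OF gtree_axioms act_edge[OF h(1) assms(3)]]) (simp add: edge_act_def)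
  have vs: "vertex_stabilizer G T y = St y" for y by (simp add: stabilizer_def St_def)
  have hV: "act T h p \<in> verts T" "act T h q \<in> verts T" using h V act_closed by auto
  have inj: "inj_on (\<lambda>x. t \<otimes> x \<otimes> inv t) (carrier G)" using t by (auto simp: inj_on_def)
  have "gog_inclusion \<Gamma> z ` gog_edge_group \<Gamma> z = gog_vertex_group \<Gamma> (gog_origin \<Gamma> z) \<longleftrightarrow>
      (\<lambda>x. t \<otimes> x \<otimes> inv t) ` (St (act T h p) \<inter> St (act T h q)) = (\<lambda>x. t \<otimes> x \<otimes> inv t) ` St (act T h p)"
    unfolding \<Gamma>_def quotient_graph_of_groups_def
    by (simp add: es vs t_def[symmetric] t(2)[symmetric] St_image_conj[OF t(1) hV(1)])
  also have "\<dots> \<longleftrightarrow> St (act T h p) \<inter> St (act T h q) = St (act T h p)"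
    by (rule inj_on_image_eq_iff[OF inj]) (auto simp: St_def)
  also have "\<dots> \<longleftrightarrow> St p \<subseteq> St q" using St_act_subset[OF h(1) V(1,2)] by blast
  finally show ?thesis .
qed

text \<open>As \<open>g\<close> relates its ends, the edge becomes a loop in the quotient; this loop
  would be strictly ascending if just one of the inclusions between \<open>St u\<close> and
  \<open>St w\<close> held.\<close>

lemma no_strict_ascending_loop:
  fixes G :: "('g, 'm) monoid_scheme" (structure) and T :: "('g, 'v) action_tree"
  assumes G: "group G" and T: "G_tree G T" and n: "\<not> (\<exists>y. strict_ascending_loop (quotient_graph_of_groups G T) y)"
    and e: "{u, w} \<in> edges T" and g: "g \<in> carrier G" "act T g u = w"
    and s: "gset.St G (act T) u \<subseteq> gset.St G (act T) w"
  shows "gset.St G (act T) w \<subseteq> gset.St G (act T) u"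
proof (rule ccontr)
  interpret gtree G "verts T" "act T" "edges T" using G_tree_gtree assms by blast
  note V = edge_in_V[OF e]
  assume c: "\<not> St w \<subseteq> St u"
  define y where "y = {(act T h u, act T h w) | h. h \<in> carrier G}"
  define y' where "y' = {(act T h w, act T h u) | h. h \<in> carrier G}"
  define \<Gamma> where "\<Gamma> = quotient_graph_of_groups G T"
  have rev: "gog_rev \<Gamma> y = y'" unfolding \<Gamma>_def quotient_graph_of_groups_def y_def y'_def by force
  have "y \<in> gog_edges \<Gamma>"
    unfolding \<Gamma>_def quotient_graph_of_groups_def orbits_def orbit_def y_def oriented_edges_def oriented_edge_act_def
    using e by (auto intro!: exI[of _ "(u, w)"])
  moreover have "gog_origin \<Gamma> y = gog_origin \<Gamma> y'"
  proof -
    have "fst ` y = {act T h u | h. h \<in> carrier G}" "fst ` y' = {act T h w | h. h \<in> carrier G}"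
      unfolding y_def y'_def by force+
    moreover have "{act T h u | h. h \<in> carrier G} = {act T h w | h. h \<in> carrier G}"
    proof (rule equalityI; rule subsetI)
      fix x assume "x \<in> {act T h u | h. h \<in> carrier G}"
      then obtain h where h: "h \<in> carrier G" "x = act T h u" by blast
      have "x = act T (h \<otimes> inv g) w" using h g act_mult[of h "inv g" w] act_inv(1)[OF g(1) V(1)] V by simp
      then show "x \<in> {act T h w | h. h \<in> carrier G}" using h g by blast
    next
      fix x assume "x \<in> {act T h w | h. h \<in> carrier G}"
      then obtain h where h: "h \<in> carrier G" "x = act T h w" by blast
      have "x = act T (h \<otimes> g) u" using h g act_mult V by simp
      then show "x \<in> {act T h u | h. h \<in> carrier G}" using h g by blast
    qed
    ultimately show ?thesis unfolding \<Gamma>_def quotient_graph_of_groups_def by simp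
  qed
  moreover have "{w, u} \<in> edges T" using e by (simp add: insert_commute)
  ultimately have "strict_ascending_loop \<Gamma> y"
    unfolding strict_ascending_loop_def Let_def rev
    using loop_inclusion_onto[OF G T e] loop_inclusion_onto[OF G T, of w u] s c
    unfolding \<Gamma>_def[symmetric] y_def[symmetric] y'_def[symmetric] by simp
  then show False using n \<Gamma>_def by blast
qed

subsection \<open>Maximal vertex stabilizers\<close>

text \<open>The form in which reducedness enters everything that follows.\<close>

definition (in gset) maximal_stabilizers :: bool where
  "maximal_stabilizers \<longleftrightarrow> (\<forall>v\<in>V. \<forall>w\<in>V. St v \<subseteq> St w \<longrightarrow> St w \<subseteq> St v \<and> (\<exists>g\<in>carrier G. w = a g v))"

text \<open>Induction along the geodesic from \<open>v\<close> to \<open>w\<close>. Elements of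
  \<open>St v\<close> fix \<open>w\<close>, hence the next vertex \<open>u\<close>; reducedness
  makes \<open>u\<close> a translate of \<open>v\<close>, and as the loop is not strictly ascending,
  \<open>St u = St v\<close>. The argument continues from \<open>u\<close>.\<close>

lemma reduced_maximal_stabilizers:
  fixes G :: "('g, 'm) monoid_scheme" (structure) and T :: "('g, 'v) action_tree"
  assumes G: "group G" and T: "G_tree G T" and n: "\<not> (\<exists>y. strict_ascending_loop (quotient_graph_of_groups G T) y)"
    and red: "reduced G T"
  shows "gset.maximal_stabilizers G (verts T) (act T)"
proof -
  interpret gtree G "verts T" "act T" "edges T" using G_tree_gtree assms by blast
  have "St w \<subseteq> St v \<and> (\<exists>g\<in>carrier G. w = act T g v)" if "v \<in> verts T" "w \<in> verts T" "St v \<subseteq> St w" for v w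
    using that
  proof (induction "d v w" arbitrary: v)
    case 0
    then have "v = w" using gdist_eq_0 by simp
    then show ?case using act_one 0 by (metis one_closed order_refl)
  next
    case (Suc m)
    have "v \<noteq> w" using Suc.hyps(2) by auto
    then obtain u where u: "{v, u} \<in> edges T" "d v w = Suc (d u w)" using closer_ex Suc.prems by blast
    have uV: "u \<in> verts T" using edge_in_V u by blast
    have "{u, v} \<in> edges T" using u by (simp add: insert_commute)
    then have "btw v u w" using between_adjI u by blast
    then have vu: "St v \<subseteq> St u" using fix_between Suc.prems uV by blast
    have "edge_stabilizer G T {v, u} = vertex_stabilizer G T v"
      using edge_stabilizer_eq[OF gtree_axioms u(1), of "edge_act T"] vu by (auto simp: edge_act_def stabilizer_def St_def)
    then have "u \<in> orbit G (act T) v" using red u by (simp add: reduced_def)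
    then obtain g where g: "g \<in> carrier G" "act T g v = u" by (auto simp: orbit_def)
    have uv: "St u \<subseteq> St v" using no_strict_ascending_loop[OF G T n u(1) g vu] .
    have "m = d u w" using Suc.hyps(2) u(2) by simp
    then have "St w \<subseteq> St u \<and> (\<exists>h\<in>carrier G. w = act T h u)" using Suc.hyps(1) uV Suc.prems uv by blast
    then obtain h where h: "St w \<subseteq> St u" "h \<in> carrier G" "w = act T h u" by blast
    then have "w = act T (h \<otimes> g) v" using act_mult g Suc.prems by simp
    then show ?case using h g uv by blast
  qed
  then show ?thesis unfolding maximal_stabilizers_def by blast
qed

section \<open>Invariant subtrees and minimality\<close>

lemma (in cut_tree) subtree_convex:
  assumes "cut_tree V0 E0" "V0 \<subseteq> V" "E0 \<subseteq> E" "x \<in> V0" "y \<in> V0" "z \<in> V" "btw x z y"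
  shows "z \<in> V0"
proof (cases "z = x")
  case False
  have V: "x \<in> V" "y \<in> V" using assms by auto
  obtain t where t: "{z, t} \<in> E" "d z x = Suc (d t x)" using closer_ex assms False V by blast
  have tV: "t \<in> V" using edge_in_V t by blast
  obtain S where S: "separates E S z t" using cut t by blast
  have xS: "x \<in> S" using side(1)[OF S t(1) V(1)] t(2) by simp
  have yS: "y \<notin> S"
  proof
    assume "y \<in> S"
    then have "d z y = Suc (d t y)" using side(1)[OF S t(1) V(2)] by simp
    then have "d x t + d t y < d x y" using assms(7) t(2) gdist_sym[of E x] by (simp add: between_def)
    then show False using triangle[of x t y] V tV by simp
  qed
  have "(x, y) \<in> (adjacent E0)\<^sup>*" using cut_tree.connected[OF assms(1)] assms by blast
  then have "y \<in> S \<or> {z, t} \<in> E0"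
  proof induction
    case (step p r)
    have pr: "{p, r} \<in> E0" using step.hyps by (simp add: adjacent_def)
    have "p \<in> S \<Longrightarrow> r \<notin> S \<Longrightarrow> p = t \<and> r = z" using S pr assms(3) unfolding separates_def by blast
    then show ?case using step.IH pr by (metis insert_commute)
  qed (use xS in simp)
  then have "{z, t} \<in> E0" using yS by simp
  then show ?thesis using cut_tree.edge_in_V(1)[OF assms(1)] by blast
qed (use assms in simp)

text \<open>The vertex of the subtree nearest to \<open>v\<close> is unique, because subtrees are
  convex, and so \<open>St v\<close> fixes it.\<close>

lemma (in gtree) subtree_stabilizer:
  assumes "cut_tree V0 E0" "V0 \<subseteq> V" "E0 \<subseteq> E" "V0 \<noteq> {}" "\<And>g x. g \<in> carrier G \<Longrightarrow> x \<in> V0 \<Longrightarrow> a g x \<in> V0"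
    and v: "v \<in> V"
  shows "\<exists>x\<in>V0. St v \<subseteq> St x"
proof -
  define m where "m = (LEAST n. \<exists>x\<in>V0. d v x = n)"
  obtain x0 where "x0 \<in> V0" using assms(4) by blast
  then have ex: "\<exists>n. \<exists>x\<in>V0. d v x = n" by blast
  have "\<exists>x\<in>V0. d v x = m" unfolding m_def by (rule LeastI_ex[OF ex])
  then obtain x where x: "x \<in> V0" "d v x = m" by blast
  have min: "m \<le> d v y" if "y \<in> V0" for y unfolding m_def using that by (intro Least_le) blast
  have "g \<in> St x" if g: "g \<in> St v" for g
  proof (rule ccontr)
    assume "g \<notin> St x"
    have gc: "g \<in> carrier G" "a g v = v" using g by (auto simp: St_def)
    define y where "y = a g x"
    have ne: "y \<noteq> x" using \<open>g \<notin> St x\<close> gc by (auto simp: y_def St_def)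
    have y: "y \<in> V0" using assms(5) gc x by (simp add: y_def)
    have V: "x \<in> V" "y \<in> V" using x y assms(2) by auto
    have dy: "d v y = m" using act_gdist[of g v x] gc v V x by (simp add: y_def)
    obtain z where z: "{x, z} \<in> E" "d x y = Suc (d z y)" using closer_ex V ne by metis
    have zV: "z \<in> V" using edge_in_V z by blast
    have "{z, x} \<in> E" using z by (simp add: insert_commute)
    then have bz: "btw x z y" using between_adjI z by blast
    then have z0: "z \<in> V0" using subtree_convex[OF assms(1-3) x(1) y zV] by blast
    have "d x v = Suc (d z v) \<or> d z v = Suc (d x v)" using gdist_adj z v by blast
    then have dz: "d v z = Suc m" using min[OF z0] x gdist_sym[of E v] by (metis Suc_n_not_le_n)
    have "\<not> btw x z v" using dz x gdist_sym[of E] by (auto simp: between_def)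
    then have "btw v z y" using tripod[OF bz V(1,2) zV v] by blast
    then show False using dz dy by (simp add: between_def)
  qed
  then show ?thesis using x by blast
qed

text \<open>For minimality it suffices that an invariant subtree contains all vertices; its edges
  are then determined by \<open>subtree_eq\<close>.\<close>

lemma G_treeI:
  fixes G :: "('g, 'm) monoid_scheme" (structure) and T :: "('g, 'v) action_tree"
  assumes "gtree G (verts T) (act T) (edges T)" "group_action G (verts T) (act T)" "verts T \<noteq> {}"
    and sub: "\<And>V0 E0 v. cut_tree V0 E0 \<Longrightarrow> V0 \<subseteq> verts T \<Longrightarrow> E0 \<subseteq> edges T \<Longrightarrow> V0 \<noteq> {} \<Longrightarrow>
      (\<And>g x. g \<in> carrier G \<Longrightarrow> x \<in> V0 \<Longrightarrow> act T g x \<in> V0) \<Longrightarrow> v \<in> verts T \<Longrightarrow> v \<in> V0"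
  shows "G_tree G T"
proof -
  interpret gtree G "verts T" "act T" "edges T" by fact
  have "minimal_action G T"
    unfolding minimal_action_def
  proof (intro allI impI)
    fix V0 E0 assume h: "simplicial_tree V0 E0" "V0 \<subseteq> verts T" "E0 \<subseteq> edges T"
      "\<forall>g\<in>carrier G. act T g ` V0 \<subseteq> V0 \<and> edge_act T g ` E0 \<subseteq> E0"
    have c: "cut_tree V0 E0" using simplicial_tree_imp_cut_tree h by blast
    have "v \<in> V0" if "v \<in> verts T" for v
      using sub[OF c h(2,3) _ _ that] h(1,4) by (auto simp: simplicial_tree_def)
    then have V0: "V0 = verts T" using h by blast
    then show "V0 = verts T \<and> E0 = edges T" using subtree_eq c h(3) by blast
  qed
  moreover have "edge_act T g ` edges T \<subseteq> edges T" if g: "g \<in> carrier G" for g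
  proof
    fix e assume "e \<in> edge_act T g ` edges T"
    then obtain e' where e': "e' \<in> edges T" "e = act T g ` e'" by (auto simp: edge_act_def)
    then obtain u w where uw: "e' = {u, w}" using edge_ends by blast
    then show "e \<in> edges T" using act_edge[OF g, of u w] e' by simp
  qed
  moreover have "without_inversions G T" unfolding without_inversions_def using no_inv by blast
  ultimately show ?thesis
    using cut_tree_imp_simplicial_tree[OF cut_tree_axioms assms(3)] assms(2) by (auto simp: G_tree_def)
qed

subsection \<open>Blowing up a loop\<close>

lemma separates_crossing:
  assumes "separates E S u w" "{c, b} \<in> E" "(c \<in> S) \<noteq> (b \<in> S)"
  shows "{c, b} = {u, w}"
proof (cases "c \<in> S")
  case True
  then have "c = w \<and> b = u" using assms unfolding separates_def by blast
  then show ?thesis by auto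
next
  case False
  have "{b, c} \<in> E" using assms(2) by (simp add: insert_commute)
  then have "b = w \<and> c = u" using assms False unfolding separates_def by blast
  then show ?thesis by auto
qed

context gtree
begin

text \<open>The edges in the orbit play the role of their own midpoints.\<close>

definition sub_verts :: "'v \<Rightarrow> 'v \<Rightarrow> 'v set set" where
  "sub_verts v w = (\<lambda>x. {x}) ` V \<union> orbE v w"

definition sub_edges :: "'v \<Rightarrow> 'v \<Rightarrow> 'v set set set" where
  "sub_edges v w = {{{x}, {y}} | x y. {x, y} \<in> E \<and> {x, y} \<notin> orbE v w} \<union>
     {{{a k v}, {a k v, a k w}} | k. k \<in> carrier G} \<union> {{{a k w}, {a k v, a k w}} | k. k \<in> carrier G}"

lemma sub_gset:
  assumes vw: "{v, w} \<in> E" shows "gset G (sub_verts v w) (\<lambda>g. (`) (a g))"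
proof
  note V = edge_in_V[OF vw]
  have sub: "e \<subseteq> V" if "e \<in> sub_verts v w" for e
    using that V act_closed by (auto simp: sub_verts_def orbE_def)
  fix g e assume g: "g \<in> carrier G" and e: "e \<in> sub_verts v w"
  show "a g ` e \<in> sub_verts v w"
  proof (cases "e \<in> orbE v w")
    case True
    then obtain k where k: "k \<in> carrier G" "e = {a k v, a k w}" by (auto simp: orbE_def)
    then have "a g ` e = {a (g \<otimes> k) v, a (g \<otimes> k) w}" using g V act_mult by simp
    then show ?thesis using g k by (auto simp: sub_verts_def orbE_def)
  next
    case False
    then show ?thesis using e g act_closed by (auto simp: sub_verts_def)
  qed
  show "a (g \<otimes> h) ` e = a g ` a h ` e" if h: "h \<in> carrier G" for h
    using sub[OF e] act_mult[OF g h] by (auto simp: image_image intro!: image_cong)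
next
  note V = edge_in_V[OF vw]
  fix e assume "e \<in> sub_verts v w"
  then have "e \<subseteq> V" using V act_closed by (auto simp: sub_verts_def orbE_def)
  then show "a \<one> ` e = e" using act_one by (force simp: image_iff)
qed

lemma sub_edgesE:
  assumes "e \<in> sub_edges v w"
  obtains (old) x y where "e = {{x}, {y}}" "{x, y} \<in> E" "{x, y} \<notin> orbE v w"
  | (left) k where "k \<in> carrier G" "e = {{a k v}, {a k v, a k w}}"
  | (right) k where "k \<in> carrier G" "e = {{a k w}, {a k v, a k w}}"
  using assms unfolding sub_edges_def by blast

lemma subdivide:
  assumes vw: "{v, w} \<in> E" shows "gtree G (sub_verts v w) (\<lambda>g. (`) (a g)) (sub_edges v w)"
proof -
  note V = edge_in_V[OF vw]
  let ?E = "sub_edges v w"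
  define mid where "mid k = {a k v, a k w}" for k
  have midD: "a k v = a h v" "a k w = a h w" if "mid k = mid h" "k \<in> carrier G" "h \<in> carrier G" for k h
    using orbE_eqD[OF vw that(2,3)] that(1) by (auto simp: mid_def)
  have ne: "a k v \<noteq> a k w" if "k \<in> carrier G" for k using that V act_inj by blast
  have single: "{x} \<noteq> mid k" if "k \<in> carrier G" for x k using ne[OF that] by (auto simp: mid_def)
  interpret C: gset G "sub_verts v w" "\<lambda>g. (`) (a g)" using sub_gset[OF vw] .
  have left: "{{a k v}, mid k} \<in> ?E" and right: "{{a k w}, mid k} \<in> ?E" if "k \<in> carrier G" for k
    using that by (auto simp: sub_edges_def mid_def)
  have old: "{{x}, {y}} \<in> ?E" if "{x, y} \<in> E" "{x, y} \<notin> orbE v w" for x y using that by (auto simp: sub_edges_def)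
  have midU: "mid k \<in> sub_verts v w" if "k \<in> carrier G" for k using that by (auto simp: sub_verts_def orbE_def mid_def)
  have sgU: "{x} \<in> sub_verts v w" if "x \<in> V" for x using that by (auto simp: sub_verts_def)
  have U: "(\<exists>x\<in>V. e = {x}) \<or> (\<exists>k\<in>carrier G. e = mid k)" if "e \<in> sub_verts v w" for e
    using that by (auto simp: sub_verts_def orbE_def mid_def)
  have cut1: "\<exists>S. separates ?E S p r" if pr: "{p, r} \<in> ?E" for p r
  proof -
    have flip: "(\<exists>S. separates ?E S y z) \<Longrightarrow> {p, r} = {y, z} \<Longrightarrow> \<exists>S. separates ?E S p r" for y z
      using separates_compl by (metis doubleton_eq_iff)
    \<comment> \<open>Lifts a cut \<open>S\<close> to the subdivision. \<open>M k\<close> says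
      whether the midpoint \<open>mid k\<close> is put on the lifted side, and the last premises say
      that no edge is crossed except the one from \<open>p0\<close> to \<open>r0\<close>.\<close>
    have gen: "\<exists>S. separates ?E S p0 r0"
      if S: "separates E S x y" and M: "\<And>k h. k \<in> carrier G \<Longrightarrow> h \<in> carrier G \<Longrightarrow> mid k = mid h \<Longrightarrow> M k \<longleftrightarrow> M h"
        and p0: "p0 \<notin> {{z} | z. z \<in> S} \<union> {mid k | k. k \<in> carrier G \<and> M k}"
        and r0: "r0 \<in> {{z} | z. z \<in> S} \<union> {mid k | k. k \<in> carrier G \<and> M k}"
        and o: "{x, y} \<in> E \<Longrightarrow> {x, y} \<notin> orbE v w \<Longrightarrow> p0 = {x} \<and> r0 = {y}"
        and l: "\<And>k. k \<in> carrier G \<Longrightarrow> (a k v \<in> S) \<noteq> M k \<Longrightarrow> {{a k v}, mid k} = {p0, r0}"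
        and rr: "\<And>k. k \<in> carrier G \<Longrightarrow> (a k w \<in> S) \<noteq> M k \<Longrightarrow> {{a k w}, mid k} = {p0, r0}"
      for S x y M p0 r0
    proof -
      define S' where "S' = {{z} | z. z \<in> S} \<union> {mid k | k. k \<in> carrier G \<and> M k}"
      have sg: "{z} \<in> S' \<longleftrightarrow> z \<in> S" for z using single by (auto simp: S'_def)
      have md: "mid k \<in> S' \<longleftrightarrow> M k" if kc: "k \<in> carrier G" for k
      proof
        assume "mid k \<in> S'"
        then have "\<exists>h. mid k = mid h \<and> h \<in> carrier G \<and> M h" using single[OF kc] unfolding S'_def by fastforce
        then show "M k" using M[OF kc] by blast
      qed (use kc in \<open>auto simp: S'_def\<close>)
      have "c = r0 \<and> d = p0" if cd: "{c, d} \<in> ?E" "c \<in> S'" "d \<notin> S'" for c d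
      proof -
        have fin: "c = r0 \<and> d = p0" if "{c, d} = {p0, r0}"
          using that cd p0 r0 unfolding S'_def[symmetric] by (auto simp: doubleton_eq_iff)
        from cd(1) show ?thesis
        proof (cases rule: sub_edgesE)
          case (old z z')
          then consider "c = {z}" "d = {z'}" | "c = {z'}" "d = {z}" by (auto simp: doubleton_eq_iff)
          then show ?thesis
          proof cases
            case 1
            then have "z = y" "z' = x" using S old(2) cd sg by (auto simp: separates_def)
            then show ?thesis using o old 1 by (simp add: insert_commute)
          next
            case 2
            moreover have "{z', z} \<in> E" using old(2) by (simp add: insert_commute)
            ultimately have "z' = y" "z = x" using S cd sg unfolding separates_def by blast+
            then show ?thesis using o old 2 by simp
          qed
        next
          case (left k)
          then have "(a k v \<in> S) \<noteq> M k" using cd sg md[OF left(1)] by (auto simp: doubleton_eq_iff mid_def[symmetric])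
          then show ?thesis using l left fin by (simp add: mid_def)
        next
          case (right k)
          then have "(a k w \<in> S) \<noteq> M k" using cd sg md[OF right(1)] by (auto simp: doubleton_eq_iff mid_def[symmetric])
          then show ?thesis using rr right fin by (simp add: mid_def)
        qed
      qed
      then show ?thesis using p0 r0 unfolding S'_def[symmetric] separates_def by blast
    qed
    from pr show ?thesis
    proof (cases rule: sub_edgesE)
      case (old x y)
      obtain S where S: "separates E S x y" using cut old by blast
      have eq: "a k v \<in> S \<longleftrightarrow> a k w \<in> S" if k: "k \<in> carrier G" for k
      proof (rule ccontr)
        assume "\<not> ?thesis"
        then have "{a k v, a k w} = {x, y}" using separates_crossing[OF S act_edge[OF k vw]] by blast
        then show False using old(3) k by (auto simp: orbE_def)
      qed
      have "\<exists>S. separates ?E S {x} {y}"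
      proof (rule gen[OF S, of "\<lambda>k. a k w \<in> S"])
        show "(a h w \<in> S) = (a h' w \<in> S)" if "h \<in> carrier G" "h' \<in> carrier G" "mid h = mid h'" for h h'
          using midD(2)[OF that(3,1,2)] by simp
        show "{x} \<notin> {{z} |z. z \<in> S} \<union> {mid k |k. k \<in> carrier G \<and> a k w \<in> S}"
          using S single by (auto simp: separates_def)
        show "{y} \<in> {{z} |z. z \<in> S} \<union> {mid k |k. k \<in> carrier G \<and> a k w \<in> S}" using S by (auto simp: separates_def)
        show "{{a h v}, mid h} = {{x}, {y}}" if h: "h \<in> carrier G" "(a h v \<in> S) \<noteq> (a h w \<in> S)" for h
          using eq[OF h(1)] h(2) by blast
      qed simp_all
      then show ?thesis using flip old by blast
    next
      case (left k)
      obtain S where S: "separates E S (a k v) (a k w)" using cut act_edge[OF left(1) vw] by blast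
      have eq: "mid h = mid k \<and> a h v \<notin> S" if h: "h \<in> carrier G" "(a h v \<in> S) \<noteq> (a h w \<in> S)" for h
      proof -
        have "mid h = mid k" using separates_crossing[OF S act_edge[OF h(1) vw] h(2)] by (simp add: mid_def)
        then show ?thesis using midD[OF _ h(1) left(1)] S by (simp add: separates_def)
      qed
      have "\<exists>S. separates ?E S {a k v} (mid k)"
      proof (rule gen[OF S, of "\<lambda>h. a h w \<in> S"])
        show "(a h w \<in> S) = (a h' w \<in> S)" if "h \<in> carrier G" "h' \<in> carrier G" "mid h = mid h'" for h h'
          using midD(2)[OF that(3,1,2)] by simp
        show "{a k v} \<notin> {{z} |z. z \<in> S} \<union> {mid k |k. k \<in> carrier G \<and> a k w \<in> S}" using S single by (auto simp: separates_def)
        show "mid k \<in> {{z} |z. z \<in> S} \<union> {mid k |k. k \<in> carrier G \<and> a k w \<in> S}" using S left by (auto simp: separates_def)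
        show "{a k v} = {a k v} \<and> mid k = {a k w}" if "{a k v, a k w} \<notin> orbE v w" using that left by (auto simp: orbE_def)
        show "{{a h v}, mid h} = {{a k v}, mid k}" if h: "h \<in> carrier G" "(a h v \<in> S) \<noteq> (a h w \<in> S)" for h
          using eq[OF h] midD[OF _ h(1) left(1)] by metis
      qed simp
      then show ?thesis using flip left by (auto simp: mid_def)
    next
      case (right k)
      obtain S where S: "separates E S (a k v) (a k w)" using cut act_edge[OF right(1) vw] by blast
      have eq: "mid h = mid k" if h: "h \<in> carrier G" "(a h v \<in> S) \<noteq> (a h w \<in> S)" for h
      proof -
        show "mid h = mid k" using separates_crossing[OF S act_edge[OF h(1) vw] h(2)] by (simp add: mid_def)
      qed
      have kS: "a k v \<notin> S" "a k w \<in> S" using S by (auto simp: separates_def)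
      have "\<exists>S. separates ?E S (mid k) {a k w}"
      \<comment> \<open>The midpoint of the edge being cut goes to the side of \<open>a k v\<close>;
        all other midpoints follow their end \<open>a h w\<close>.\<close>
      proof (rule gen[OF S, of "\<lambda>h. a h w \<in> S \<and> mid h \<noteq> mid k"])
        show "(a h w \<in> S \<and> mid h \<noteq> mid k) = (a h' w \<in> S \<and> mid h' \<noteq> mid k)" if "h \<in> carrier G" "h' \<in> carrier G" "mid h = mid h'" for h h'
          using midD(2)[OF that(3,1,2)] that(3) by simp
        show "mid k \<notin> {{z} |z. z \<in> S} \<union> {mid h |h. h \<in> carrier G \<and> a h w \<in> S \<and> mid h \<noteq> mid k}"
          using single[OF right(1)] by auto
        show "{a k w} \<in> {{z} |z. z \<in> S} \<union> {mid h |h. h \<in> carrier G \<and> a h w \<in> S \<and> mid h \<noteq> mid k}" using kS by auto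
        show "mid k = {a k v} \<and> {a k w} = {a k w}" if "{a k v, a k w} \<notin> orbE v w" using that right by (auto simp: orbE_def)
        show "{{a h v}, mid h} = {mid k, {a k w}}" if h: "h \<in> carrier G" "(a h v \<in> S) \<noteq> (a h w \<in> S \<and> mid h \<noteq> mid k)" for h
        proof -
          have "mid h = mid k" using eq[OF h(1)] h(2) by blast
          then have "a h v \<in> S" "a h v = a k v" using h midD[OF _ h(1) right(1)] by auto
          then show ?thesis using kS by simp
        qed
        show "{{a h w}, mid h} = {mid k, {a k w}}" if h: "h \<in> carrier G" "(a h w \<in> S) \<noteq> (a h w \<in> S \<and> mid h \<noteq> mid k)" for h
        proof -
          have "mid h = mid k" using h(2) by blast
          then show ?thesis using midD[OF _ h(1) right(1)] by (simp add: insert_commute)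
        qed
      qed
      then show ?thesis using flip[of "mid k" "{a k w}"] right by (auto simp: mid_def insert_commute)
    qed
  qed
  have conn1: "({x}, {y}) \<in> (adjacent ?E)\<^sup>*" if "x \<in> V" "y \<in> V" for x y
  proof -
    have "(x, y) \<in> (adjacent E)\<^sup>*" using connected that by blast
    then show ?thesis
    proof induction
      case (step y z)
      have yz: "{y, z} \<in> E" using step.hyps by (simp add: adjacent_def)
      have "({y}, {z}) \<in> (adjacent ?E)\<^sup>*"
      proof (cases "{y, z} \<in> orbE v w")
        case False
        then show ?thesis using old[OF yz] by (auto simp: adjacent_def)
      next
        case True
        then obtain k where k: "k \<in> carrier G" "{y, z} = {a k v, a k w}" by (auto simp: orbE_def)
        have "({a k v}, mid k) \<in> adjacent ?E" "({a k w}, mid k) \<in> adjacent ?E" using left right k by (auto simp: adjacent_def)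
        then have "({a k v}, {a k w}) \<in> (adjacent ?E)\<^sup>*" "({a k w}, {a k v}) \<in> (adjacent ?E)\<^sup>*"
          using adjacent_sym by (meson converse_rtrancl_into_rtrancl r_into_rtrancl)+
        then show ?thesis using k by (auto simp: doubleton_eq_iff)
      qed
      then show ?case using step.IH by (rule rtrancl_trans[rotated])
    qed simp
  qed
  have conn2: "\<exists>x\<in>V. (e, {x}) \<in> (adjacent ?E)\<^sup>* \<and> ({x}, e) \<in> (adjacent ?E)\<^sup>*" if "e \<in> sub_verts v w" for e
    using U[OF that]
  proof
    assume "\<exists>k\<in>carrier G. e = mid k"
    then obtain k where k: "k \<in> carrier G" "e = mid k" by blast
    have "({a k v}, mid k) \<in> adjacent ?E" using left k by (auto simp: adjacent_def)
    then show ?thesis using k act_closed V adjacent_sym[of "{a k v}" "mid k"] by (intro bexI[of _ "a k v"]) auto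
  qed blast
  show ?thesis
  proof
    fix e assume "e \<in> ?E"
    then show "\<exists>u\<in>sub_verts v w. \<exists>t\<in>sub_verts v w. u \<noteq> t \<and> e = {u, t}"
    proof (cases rule: sub_edgesE)
      case (old x y)
      have "{x} \<in> sub_verts v w" "{y} \<in> sub_verts v w" "{x} \<noteq> {y}" using edge_in_V[OF old(2)] sgU by auto
      then show ?thesis using old(1) by (intro bexI conjI) assumption+
    next
      case (left k)
      have "{a k v} \<in> sub_verts v w" "{a k v} \<noteq> mid k" using sgU act_closed left(1) V single by auto
      then show ?thesis using left(2)[folded mid_def] midU[OF left(1)] by (intro bexI conjI) assumption+
    next
      case (right k)
      have "{a k w} \<in> sub_verts v w" "{a k w} \<noteq> mid k" using sgU act_closed right(1) V single by auto
      then show ?thesis using right(2)[folded mid_def] midU[OF right(1)] by (intro bexI conjI) assumption+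
    qed
  next
    fix e e' assume e: "e \<in> sub_verts v w" "e' \<in> sub_verts v w"
    obtain x where x: "x \<in> V" "(e, {x}) \<in> (adjacent ?E)\<^sup>*" using conn2[OF e(1)] by blast
    obtain y where y: "y \<in> V" "({y}, e') \<in> (adjacent ?E)\<^sup>*" using conn2[OF e(2)] by blast
    show "(e, e') \<in> (adjacent ?E)\<^sup>*" using x y conn1[OF x(1) y(1)] by (meson rtrancl_trans)
  next
    fix p r assume "{p, r} \<in> ?E"
    then show "\<exists>S. separates ?E S p r" by (rule cut1)
  next
    fix g p r assume g: "g \<in> carrier G" and pr: "{p, r} \<in> ?E"
    have mg: "a g ` mid k = mid (g \<otimes> k)" if "k \<in> carrier G" for k using that g V act_mult by (simp add: mid_def)
    from pr show "{a g ` p, a g ` r} \<in> ?E"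
    proof (cases rule: sub_edgesE)
      case (old x y)
      have "{a g x, a g y} \<notin> orbE v w"
      proof
        assume "{a g x, a g y} \<in> orbE v w"
        then obtain k where k: "k \<in> carrier G" "{a g x, a g y} = {a k v, a k w}" by (auto simp: orbE_def)
        have "{x, y} = {a (inv g \<otimes> k) v, a (inv g \<otimes> k) w}"
          using doubleton_act_eq[OF g k(1) edge_in_V(1,2)[OF old(2)] V(1,2)] k(2) by (rule iffD1)
        moreover have "inv g \<otimes> k \<in> carrier G" using g k by simp
        ultimately show False using old(3) by (auto simp: orbE_def)
      qed
      then have "{{a g x}, {a g y}} \<in> ?E" using act_edge[OF g old(2)] by (auto simp: sub_edges_def)
      then show ?thesis using old(1) by (auto simp: doubleton_eq_iff insert_commute)
    next
      case (left k)
      have "{{a (g \<otimes> k) v}, mid (g \<otimes> k)} \<in> ?E" using g left by (auto simp: sub_edges_def mid_def)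
      then show ?thesis using left g V act_mult by (auto simp: doubleton_eq_iff insert_commute mid_def)
    next
      case (right k)
      have "{{a (g \<otimes> k) w}, mid (g \<otimes> k)} \<in> ?E" using g right by (auto simp: sub_edges_def mid_def)
      then show ?thesis using right g V act_mult by (auto simp: doubleton_eq_iff insert_commute mid_def)
    qed
    assume i: "a g ` p = r" "a g ` r = p"
    from pr show False
    proof (cases rule: sub_edgesE)
      case (old x y)
      then have "a g x = y" "a g y = x" using i by (auto simp: doubleton_eq_iff)
      then show False using no_inv[OF g old(2)] by blast
    next
      case (left k)
      then have "a g ` {a k v} = mid k" using i by (auto simp: doubleton_eq_iff mid_def)
      then show False using single[OF left(1)] by auto
    next
      case (right k)
      then have "a g ` {a k w} = mid k" using i by (auto simp: doubleton_eq_iff mid_def)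
      then show False using single[OF right(1)] by auto
    qed
  qed
qed

text \<open>Let \<open>m\<close> be the midpoint \<open>{v, w}\<close>. As \<open>w = a g v\<close>,
  half edges lead from \<open>w\<close> to \<open>m\<close> and to the translate of \<open>m\<close>
  by \<open>g\<close>. The second slides across the first, which \<open>K\<close> permits: the
  translate has as stabilizer the edge group conjugated by \<open>g\<close>, and this fixes
  \<open>v\<close> and \<open>w\<close>. The result joins \<open>m\<close> to its translate, while
  \<open>w\<close> stays adjacent to \<open>m\<close>.\<close>

lemma blow_up:
  assumes vw: "{v, w} \<in> E" and g: "g \<in> carrier G" "a g v = w"
    and K: "\<And>h. h \<in> St v \<inter> St w \<Longrightarrow> g \<otimes> h \<otimes> inv g \<in> St v"
  shows "\<exists>E2. gtree G (sub_verts v w) (\<lambda>g. (`) (a g)) E2 \<and> {{v, w}, a g ` {v, w}} \<in> E2 \<and> {{w}, {v, w}} \<in> E2"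
proof -
  note V = edge_in_V[OF vw]
  interpret C: gtree G "sub_verts v w" "\<lambda>g. (`) (a g)" "sub_edges v w" using subdivide[OF vw] .
  have "{{a \<one> w}, {a \<one> v, a \<one> w}} \<in> sub_edges v w" "{{a \<one> v}, {a \<one> v, a \<one> w}} \<in> sub_edges v w"
    unfolding sub_edges_def by blast+
  then have e1: "{{w}, {v, w}} \<in> sub_edges v w" and e0: "{{v}, {v, w}} \<in> sub_edges v w" using act_one V by simp_all
  have e2: "{{w}, a g ` {v, w}} \<in> sub_edges v w" using C.act_edge[OF g(1) e0] g(2) by simp
  have n: False if h: "h \<in> carrier G" "a h w = w" "a h ` {v, w} = a g ` {v, w}" for h
  proof -
    have "a h v = a g w" using h g(2) V act_inj g(1) by (auto simp: doubleton_eq_iff)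
    then show False using no_inv2[OF vw h(1) g(1)] h(2) g(2) by simp
  qed
  have sl: "C.slidable (sub_edges v w) {w} {v, w} (a g ` {v, w})"
    unfolding C.slidable_def
  proof (intro conjI subsetI e1 e2)
    fix h assume "h \<in> C.St {w} \<inter> C.St (a g ` {v, w})"
    then have h: "h \<in> carrier G" "a h w = w" "a h ` {w, a g w} = {w, a g w}" using g by (auto simp: C.St_def)
    then have "a h (a g w) = a g w" by (auto simp: doubleton_eq_iff)
    then have s: "h \<in> St (a g v)" "h \<in> St (a g w)" using h g by (auto simp: St_def)
    have "inv g \<otimes> h \<otimes> g \<in> St v \<inter> St w" using St_conj'[OF g(1) V(1) s(1)] St_conj'[OF g(1) V(2) s(2)] by blast
    then have "g \<otimes> (inv g \<otimes> h \<otimes> g) \<otimes> inv g \<in> St v" by (rule K)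
    moreover have "g \<otimes> (inv g \<otimes> h \<otimes> g) \<otimes> inv g = h" using g h by (simp add: m_assoc) (simp add: m_assoc[symmetric])
    ultimately show "h \<in> C.St {v, w}" using h by (auto simp: C.St_def St_def)
  next
    show "{{w}, a g ` {v, w}} \<notin> C.orbE {w} {v, w}"
    proof
      assume "{{w}, a g ` {v, w}} \<in> C.orbE {w} {v, w}"
      then obtain h where h: "h \<in> carrier G" "{{w}, a g ` {v, w}} = {{a h w}, a h ` {v, w}}" by (auto simp: C.orbE_def)
      have "a h v \<noteq> a h w" using h V act_inj by blast
      then have "{w} \<noteq> a h ` {v, w}" by auto
      then have "{w} = {a h w}" "a h ` {v, w} = a g ` {v, w}" using h(2) by (auto simp: doubleton_eq_iff)
      then show False using n[OF h(1)] by auto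
    qed
  qed
  define E2 where "E2 = C.slide_edges (sub_edges v w) {w} {v, w} (a g ` {v, w})"
  have "gtree G (sub_verts v w) (\<lambda>g. (`) (a g)) E2" unfolding E2_def by (rule C.slide_tree[OF sl])
  moreover have "{{v, w}, a g ` {v, w}} \<in> E2"
    unfolding E2_def C.slide_edges_def using C.orbE_self C.edge_in_V[OF e1] C.edge_in_V[OF e2] by blast
  moreover have "{{w}, {v, w}} \<notin> C.orbE {w} (a g ` {v, w})"
  proof
    assume "{{w}, {v, w}} \<in> C.orbE {w} (a g ` {v, w})"
    then obtain h where h: "h \<in> carrier G" "{{w}, {v, w}} = {{a h w}, a h ` a g ` {v, w}}" by (auto simp: C.orbE_def)
    then have "{a h w} = {w} \<and> a h ` a g ` {v, w} = {v, w}" using V by (auto simp: doubleton_eq_iff)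
    then have 1: "a h w = w" "a h ` a g ` {v, w} = {v, w}" by auto
    have "a (inv h) w = w" using act_inv(1)[OF h(1) V(2)] 1(1) by simp
    moreover have "a (inv h) ` {v, w} = a g ` {v, w}"
    proof -
      have "a (inv h) ` a h ` a g ` {v, w} = a g ` {v, w}" using act_inv(1)[OF h(1)] act_closed[OF g(1)] V by simp
      then show ?thesis using 1(2) by metis
    qed
    ultimately show False using n[of "inv h"] h(1) by simp
  qed
  ultimately show ?thesis using e1 unfolding E2_def C.slide_edges_def by blast
qed

end

text \<open>To lie in the deformation space, the new tree must have its vertices in the given type.
  An infinite \<open>V\<close> has room for \<open>V \<times> V\<close>, hence for the
  midpoints.\<close>

lemma (in gtree) inj_sub_verts:
  assumes "infinite V" "{v, w} \<in> E"
  shows "\<exists>f. inj_on f (sub_verts v w) \<and> f ` sub_verts v w \<subseteq> V"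
proof -
  note V = edge_in_V[OF assms(2)]
  define pr where "pr e = (SOME p. fst p \<in> V \<and> snd p \<in> V \<and> e = {fst p, snd p})" for e
  have pr: "fst (pr e) \<in> V \<and> snd (pr e) \<in> V \<and> e = {fst (pr e), snd (pr e)}" if e: "e \<in> sub_verts v w" for e
  proof -
    have "\<exists>x y. x \<in> V \<and> y \<in> V \<and> e = {x, y}"
    proof (cases "e \<in> orbE v w")
      case True
      then obtain k where "k \<in> carrier G" "e = {a k v, a k w}" by (auto simp: orbE_def)
      then show ?thesis using V act_closed by blast
    next
      case False
      then obtain x where "x \<in> V" "e = {x}" using e by (auto simp: sub_verts_def)
      then show ?thesis by (intro exI[of _ x]) simp
    qed
    then obtain x y where "x \<in> V \<and> y \<in> V \<and> e = {x, y}" by blast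
    then show ?thesis unfolding pr_def by - (rule someI[of _ "(x, y)"], simp)
  qed
  have 1: "inj_on pr (sub_verts v w)" by (rule inj_onI) (metis pr)
  have "|V \<times> V| =o |V|" by (rule card_of_Times_same_infinite[OF assms(1)])
  then obtain q where q: "bij_betw q (V \<times> V) V" unfolding card_of_ordIso[symmetric] by blast
  have sub: "pr ` sub_verts v w \<subseteq> V \<times> V" by (intro image_subsetI) (use pr in \<open>simp add: mem_Times_iff\<close>)
  then have "inj_on q (pr ` sub_verts v w)" using q by (auto simp: bij_betw_def intro: inj_on_subset)
  then have "inj_on (q \<circ> pr) (sub_verts v w)" using 1 by (simp add: comp_inj_on)
  moreover have "(q \<circ> pr) ` sub_verts v w \<subseteq> V" using image_mono[OF sub, of q] q by (simp add: bij_betw_def image_comp)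
  ultimately show ?thesis by blast
qed

text \<open>\<open>s\<close> embeds the old vertices and \<open>m\<close> is the midpoint of
  \<open>vw\<close>. The action \<open>c\<close> is made extensional on \<open>U\<close> so that it
  is a \<open>group_action\<close>.\<close>

lemma (in gtree) blow_up_transported:
  assumes vw: "{v, w} \<in> E" and g: "g \<in> carrier G" "a g v = w"
    and K: "\<forall>h \<in> St v \<inter> St w. g \<otimes> h \<otimes> inv g \<in> St v" and inf: "infinite V"
  shows "\<exists>U c E2 s m. gtree G U c E2 \<and> group_action G U c \<and> U = s ` V \<union> (\<lambda>k. c k m) ` carrier G \<and>
    (\<forall>k\<in>carrier G. \<forall>x\<in>V. c k (s x) = s (a k x)) \<and> inj_on s V \<and> m \<in> U \<and> m \<notin> s ` V \<and>
    gset.St G c m = St v \<inter> St w \<and> {m, c g m} \<in> E2 \<and> {s w, m} \<in> (E2 :: 'v set set)"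
proof -
  note V = edge_in_V[OF vw]
  obtain f where f: "inj_on f (sub_verts v w)" "f ` sub_verts v w \<subseteq> V" using inj_sub_verts[OF inf vw] by blast
  obtain E2 where E2: "gtree G (sub_verts v w) (\<lambda>g. (`) (a g)) E2" "{{v, w}, a g ` {v, w}} \<in> E2" "{{w}, {v, w}} \<in> E2"
    using blow_up[OF vw g] K by blast
  interpret C: gtree G "sub_verts v w" "\<lambda>g. (`) (a g)" E2 by (rule E2(1))
  define U where "U = f ` sub_verts v w"
  define c where "c k = restrict (\<lambda>y. f (a k ` inv_into (sub_verts v w) f y)) U" for k
  have cf: "c k (f e) = f (a k ` e)" if "e \<in> sub_verts v w" for k e
    using that f(1) by (simp add: c_def U_def)
  have T: "gtree G U c ((`) f ` E2)" unfolding U_def by (rule C.transport_gtree[OF cf f(1)])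
  interpret B: gtree G U c "(`) f ` E2" by (rule T)
  have "(\<lambda>k. restrict (c k) U) = c" by (simp add: c_def fun_eq_iff restrict_def)
  then have ga: "group_action G U c" using B.group_actionI by simp
  have sg: "{x} \<in> sub_verts v w" if "x \<in> V" for x using that by (simp add: sub_verts_def)
  have md: "{v, w} \<in> sub_verts v w" using orbE_self[OF V(1,2)] by (simp add: sub_verts_def)
  have cm: "c k (f {v, w}) = f {a k v, a k w}" for k using cf[OF md] by simp
  show ?thesis
  proof (intro exI conjI ballI)
    show "gtree G U c ((`) f ` E2)" "group_action G U c" by (fact T ga)+
    have "sub_verts v w = (\<lambda>x. {x}) ` V \<union> (\<lambda>k. {a k v, a k w}) ` carrier G" by (auto simp: sub_verts_def orbE_def)
    then show "U = (\<lambda>x. f {x}) ` V \<union> (\<lambda>k. c k (f {v, w})) ` carrier G"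
      unfolding U_def cm by (simp add: image_Un image_image)
    show "c k (f {x}) = f {a k x}" if "k \<in> carrier G" "x \<in> V" for k x using cf[OF sg[OF that(2)]] by simp
    show "inj_on (\<lambda>x. f {x}) V" using f(1) sg by (auto simp: inj_on_def)
    show "f {v, w} \<in> U" using md by (simp add: U_def)
    show "f {v, w} \<notin> (\<lambda>x. f {x}) ` V"
    proof
      assume "f {v, w} \<in> (\<lambda>x. f {x}) ` V"
      then obtain x where "x \<in> V" "f {v, w} = f {x}" by blast
      then have "{v, w} = {x}" using inj_onD[OF f(1) _ md sg] by blast
      then show False using V(3) by auto
    qed
    show "B.St (f {v, w}) = St v \<inter> St w"
    proof -
      have "c k (f {v, w}) = f {v, w} \<longleftrightarrow> a k v = v \<and> a k w = w" if k: "k \<in> carrier G" for k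
      proof -
        have "a k ` {v, w} \<in> sub_verts v w" using C.act_closed[OF k md] .
        then have "c k (f {v, w}) = f {v, w} \<longleftrightarrow> a k ` {v, w} = {v, w}"
          using cf[OF md] f(1) md by (simp add: inj_on_eq_iff)
        also have "\<dots> \<longleftrightarrow> a k v = v \<and> a k w = w" using no_inv[OF k vw] by (auto simp: doubleton_eq_iff)
        finally show ?thesis .
      qed
      then show ?thesis by (auto simp: B.St_def St_def)
    qed
    show "{f {v, w}, c g (f {v, w})} \<in> (`) f ` E2" using imageI[OF E2(2), of "(`) f"] cf[OF md] by simp
    show "{f {w}, f {v, w}} \<in> (`) f ` E2" using imageI[OF E2(3), of "(`) f"] by simp
  qed
qed

text \<open>In the blown-up tree the edge from \<open>c g m\<close> to \<open>m\<close> gives a loop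
  of the quotient, and \<open>K\<close> puts the stabilizer of \<open>c g m\<close> inside that of
  \<open>m\<close>. Once the tree is known to lie in the deformation space, the two agree, which is
  the claim. Its elliptic subgroups are the old ones, since midpoint stabilizers lie in vertex
  stabilizers of \<open>T\<close>; maximal stabilizers enter in the proof of minimality.\<close>

lemma ascending_edge_in_deformation_space:
  fixes G :: "('g, 'm) monoid_scheme" (structure) and T :: "('g, 'v) action_tree"
  assumes G: "group G" and T: "G_tree G T" and max: "gset.maximal_stabilizers G (verts T) (act T)"
    and na: "\<And>T'. T' \<in> deformation_space G T \<Longrightarrow> \<not> (\<exists>y. strict_ascending_loop (quotient_graph_of_groups G T') y)"
    and inf: "infinite (verts T)"
    and E: "gtree G (verts T) (act T) E" and vw: "{v, w} \<in> E" and g: "g \<in> carrier G" "act T g v = w"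
    and K: "\<And>h. h \<in> gset.St G (act T) v \<inter> gset.St G (act T) w \<Longrightarrow> g \<otimes> h \<otimes> inv g \<in> gset.St G (act T) v"
    and h0: "h0 \<in> gset.St G (act T) v \<inter> gset.St G (act T) w"
  shows "inv g \<otimes> h0 \<otimes> g \<in> gset.St G (act T) w"
proof (rule ccontr)
  interpret gtree G "verts T" "act T" E by fact
  note V = edge_in_V[OF vw]
  assume c0: "\<not> ?thesis"
  have K': "\<forall>h \<in> St v \<inter> St w. g \<otimes> h \<otimes> inv g \<in> St v" using K by blast
  obtain U c s m and E2 :: "'v set set" where B: "gtree G U c E2" "group_action G U c"
    and U: "U = s ` verts T \<union> (\<lambda>k. c k m) ` carrier G"
    and cs0: "\<forall>k\<in>carrier G. \<forall>x\<in>verts T. c k (s x) = s (act T k x)" and s: "inj_on s (verts T)"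
    and m: "m \<in> U" "m \<notin> s ` verts T" "gset.St G c m = St v \<inter> St w" and e: "{m, c g m} \<in> E2" "{s w, m} \<in> E2"
    using blow_up_transported[OF vw g K' inf] by (elim exE conjE) (rule that)
  note cs = cs0[rule_format]
  interpret B: gtree G U c E2 by fact
  define T2 :: "('g, 'v) action_tree" where "T2 = \<lparr>verts = U, edges = E2, act = c\<rparr>"
  have sU: "s x \<in> U" if "x \<in> verts T" for x using U that by blast
  have Ss: "B.St (s x) = St x" if "x \<in> verts T" for x
    using cs that act_closed s by (auto simp: B.St_def St_def inj_on_eq_iff)
  have Sm: "B.St (c k m) \<subseteq> St (act T k v) \<inter> St (act T k w)" if k: "k \<in> carrier G" for k
  proof
    fix h assume h: "h \<in> B.St (c k m)"
    then have "inv k \<otimes> h \<otimes> k \<in> St v \<inter> St w" using B.St_conj'[OF k m(1)] m(3) by blast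
    then have "k \<otimes> (inv k \<otimes> h \<otimes> k) \<otimes> inv k \<in> St (act T k v) \<inter> St (act T k w)" using St_conj k V by blast
    moreover have "k \<otimes> (inv k \<otimes> h \<otimes> k) \<otimes> inv k = h"
      using k B.St_carrier[OF h] by (simp add: m_assoc) (simp add: m_assoc[symmetric])
    ultimately show "h \<in> St (act T k v) \<inter> St (act T k w)" by simp
  qed
  have cases: "(\<exists>x\<in>verts T. y = s x) \<or> (\<exists>k\<in>carrier G. y = c k m)" if "y \<in> U" for y using that U by blast
  have T2: "G_tree G T2"
  proof (rule G_treeI)
    show "gtree G (verts T2) (act T2) (edges T2)" "group_action G (verts T2) (act T2)" "verts T2 \<noteq> {}"
      using B m by (auto simp: T2_def)
    fix V0 E0 y
    assume "cut_tree V0 E0" "V0 \<subseteq> verts T2" "E0 \<subseteq> edges T2" and ne: "V0 \<noteq> {}"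
      and "\<And>g x. g \<in> carrier G \<Longrightarrow> x \<in> V0 \<Longrightarrow> act T2 g x \<in> V0" "y \<in> verts T2"
    then have V0: "cut_tree V0 E0" "V0 \<subseteq> U" "E0 \<subseteq> E2"
      and inv: "\<And>g x. g \<in> carrier G \<Longrightarrow> x \<in> V0 \<Longrightarrow> c g x \<in> V0" and y: "y \<in> U" by (simp_all add: T2_def)
    \<comment> \<open>An invariant subtree has a vertex \<open>z\<close> fixed by
      \<open>St x\<close>. An old vertex \<open>z\<close> is in the orbit of \<open>x\<close> by
      maximality. For a translated midpoint, maximality gives \<open>St v \<subseteq> St w\<close>,
      which contradicts \<open>c0\<close>.\<close>
    have s0: "s x \<in> V0" if x: "x \<in> verts T" for x
    proof -
      obtain z where z: "z \<in> V0" "B.St (s x) \<subseteq> B.St z" using B.subtree_stabilizer[OF V0 ne inv sU[OF x]] by blast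
      have "z \<in> U" using z V0 by blast
      from cases[OF this] show ?thesis
      proof (elim disjE bexE)
        fix y assume y: "y \<in> verts T" "z = s y"
        then obtain k where k: "k \<in> carrier G" "y = act T k x"
          using max[unfolded maximal_stabilizers_def, rule_format, OF x y(1)] z(2) y(2) Ss[OF x] Ss[OF y(1)] by auto
        then have "c (inv k) (s y) = s x" using cs y act_inv x by simp
        then show ?thesis using inv z(1) y(2) k by (metis inv_closed)
      next
        fix k assume k: "k \<in> carrier G" "z = c k m"
        have kV: "act T k v \<in> verts T" "act T k w \<in> verts T" using k V act_closed by auto
        have 1: "St x \<subseteq> B.St (c k m)" using z k Ss[OF x] by simp
        then have "St x \<subseteq> St (act T k v)" "St x \<subseteq> St (act T k w)" using Sm[OF k(1)] by auto
        then have "St (act T k v) \<subseteq> St x" "St (act T k w) \<subseteq> St x"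
          using max[unfolded maximal_stabilizers_def, rule_format, OF x kV(1)]
            max[unfolded maximal_stabilizers_def, rule_format, OF x kV(2)] by blast+
        then have "St (act T k v) \<subseteq> St (act T k w)" using 1 Sm[OF k(1)] by blast
        then have "St v \<subseteq> St w" using St_act_subset[OF k(1) V(1,2)] by simp
        moreover have "inv g \<otimes> h0 \<otimes> g \<in> St v" using St_conj'[OF g(1) V(1)] g(2) h0 by simp
        ultimately show ?thesis using c0 by blast
      qed
    qed
    \<comment> \<open>The geodesic from \<open>s w\<close> to \<open>s (act T g w)\<close> runs
      through \<open>m\<close> and \<open>c g m\<close>.\<close>
    have "m \<in> V0"
    proof -
      have gm: "c g m \<in> U" using B.act_closed g m by blast
      have e': "{c g m, s (act T g w)} \<in> E2" using B.act_edge[OF g(1) e(2)] cs g V by (simp add: insert_commute)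
      have ms: "{m, s w} \<in> E2" "{c g m, m} \<in> E2" using e by (simp_all add: insert_commute)
      have gw: "act T g w \<in> verts T" using act_closed g V by blast
      have "m \<noteq> s (act T g w)" using m(2) gw by blast
      then have "B.btw m (c g m) (s (act T g w))" using B.gdist_two[OF ms(2) e'] by blast
      moreover have "c g m \<noteq> s w"
      proof
        assume "c g m = s w"
        then have "m = s (act T (inv g) w)" using B.act_inv(1)[OF g(1) m(1)] cs g V by auto
        then show False using m(2) act_closed g V by blast
      qed
      ultimately have "B.btw (s w) m (s (act T g w))"
        using B.between_adj_other[OF e(1) ms(1)] sU[OF gw] by blast
      then show ?thesis using B.subtree_convex[OF V0 s0[OF V(2)] s0[OF gw] m(1)] by blast
    qed
    then show "y \<in> V0" using cases[OF y] s0 inv by blast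
  qed
  have "elliptic T2 H \<longleftrightarrow> elliptic T H" if H: "subgroup H G" for H
  proof -
    note Hc = subgroup.subset[OF H]
    have "elliptic T2 H \<longleftrightarrow> (\<exists>y\<in>U. H \<subseteq> B.St y)" using Hc by (auto simp: elliptic_def T2_def B.St_def)
    also have "\<dots> \<longleftrightarrow> (\<exists>x\<in>verts T. H \<subseteq> St x)"
    proof
      assume "\<exists>y\<in>U. H \<subseteq> B.St y"
      then obtain y where y: "y \<in> U" "H \<subseteq> B.St y" by blast
      from cases[OF y(1)] show "\<exists>x\<in>verts T. H \<subseteq> St x"
      proof (elim disjE bexE)
        fix k assume k: "k \<in> carrier G" "y = c k m"
        then have "H \<subseteq> St (act T k v)" using y Sm[OF k(1)] by blast
        then show ?thesis using act_closed k V by blast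
      qed (use y Ss in auto)
    qed (use Ss sU in blast)
    also have "\<dots> \<longleftrightarrow> elliptic T H" using Hc by (auto simp: elliptic_def St_def)
    finally show ?thesis .
  qed
  then have "T2 \<in> deformation_space G T" using T2 by (simp add: deformation_space_def)
  note na2 = na[OF this]
  have "B.St m \<subseteq> B.St (c g m)"
  proof -
    have 1: "{c g m, m} \<in> edges T2" "act T2 (inv g) (c g m) = m"
      using e B.act_inv[OF g(1) m(1)] by (simp_all add: T2_def insert_commute)
    have "gset.St G (act T2) (c g m) \<subseteq> gset.St G (act T2) m"
    proof
      fix x assume "x \<in> gset.St G (act T2) (c g m)"
      then have x: "x \<in> B.St (c g m)" by (simp add: T2_def)
      then have 2: "inv g \<otimes> x \<otimes> g \<in> St v \<inter> St w" using B.St_conj'[OF g(1) m(1)] m(3) by blast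
      have 3: "g \<otimes> (inv g \<otimes> x \<otimes> g) \<otimes> inv g = x"
        using g B.St_carrier[OF x] by (simp add: m_assoc) (simp add: m_assoc[symmetric])
      have "x \<in> St v" using K[OF 2] 3 by simp
      moreover have "x \<in> St w" using St_conj[OF g(1) V(1), of "inv g \<otimes> x \<otimes> g"] 2 3 g(2) by simp
      ultimately show "x \<in> gset.St G (act T2) m" using m(3) by (simp add: T2_def)
    qed
    from no_strict_ascending_loop[OF G T2 na2 1(1) _ 1(2) this] show ?thesis using g by (simp add: T2_def)
  qed
  then have "inv g \<otimes> h0 \<otimes> g \<in> B.St m" using h0 m(3) B.St_conj'[OF g(1) m(1)] by blast
  then show False using c0 m(3) by blast
qed

subsection \<open>Finitely many orbits of edges\<close>

lemma (in cut_tree) finite_interval: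
  assumes "u \<in> V" "w \<in> V" shows "finite {y \<in> V. btw u y w}"
proof (rule finite_imageD)
  show "finite (d u ` {y \<in> V. btw u y w})" by (rule finite_subset[of _ "{..d u w}"]) (auto simp: between_def)
  show "inj_on (d u) {y \<in> V. btw u y w}" using between_unique assms by (auto simp: inj_on_def)
qed

text \<open>\<open>E0\<close> stands for an invariant set of edges containing the geodesics from
  \<open>v0\<close> to its translates by generators; following a word in the generators connects
  \<open>v0\<close> to any translate.\<close>

lemma (in gtree) generated_connected:
  assumes S: "S \<subseteq> carrier G" "generate G S = carrier G" and v0: "v0 \<in> V"
    and E0: "\<forall>g\<in>carrier G. \<forall>u w. {u, w} \<in> E0 \<longrightarrow> {a g u, a g w} \<in> E0"
    and Q: "\<forall>s\<in>S. \<forall>x y. {x, y} \<in> E \<longrightarrow> btw v0 x (a s v0) \<longrightarrow> btw v0 y (a s v0) \<longrightarrow> {x, y} \<in> E0"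
  shows "s \<in> S \<Longrightarrow> x \<in> V \<Longrightarrow> btw v0 x (a s v0) \<Longrightarrow> (v0, x) \<in> (adjacent E0)\<^sup>*"
    and "g \<in> carrier G \<Longrightarrow> (v0, a g v0) \<in> (adjacent E0)\<^sup>*"
    and "g \<in> carrier G \<Longrightarrow> (u, w) \<in> (adjacent E0)\<^sup>* \<Longrightarrow> (a g u, a g w) \<in> (adjacent E0)\<^sup>*"
proof -
  show 1: "(v0, x) \<in> (adjacent E0)\<^sup>*" if s: "s \<in> S" and "x \<in> V" "btw v0 x (a s v0)" for s x
    using that(2,3)
  proof (induction "d x v0" arbitrary: x)
    case 0
    then show ?case using gdist_eq_0 v0 by simp
  next
    case (Suc n)
    have sV: "a s v0 \<in> V" using s S v0 act_closed by blast
    have "x \<noteq> v0" using Suc.hyps(2) by auto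
    then obtain y where y: "{x, y} \<in> E" "d x v0 = Suc (d y v0)" using closer_ex Suc.prems v0 by blast
    have "{y, x} \<in> E" using y(1) by (simp add: insert_commute)
    then have "btw v0 y x" using between_adjI[OF _ y(2)] between_sym by metis
    then have b: "btw v0 y (a s v0)" using between_trans(1)[OF Suc.prems(2)] v0 sV Suc.prems(1) edge_in_V[OF y(1)] by blast
    then have "(v0, y) \<in> (adjacent E0)\<^sup>*" using Suc.hyps(1)[of y] Suc.hyps(2) y edge_in_V[OF y(1)] by simp
    moreover have "(y, x) \<in> adjacent E0" using Q s b Suc.prems(2) \<open>{y, x} \<in> E\<close> by (simp add: adjacent_def)
    ultimately show ?case by (rule rtrancl.rtrancl_into_rtrancl)
  qed
  show 2: "(a g u, a g w) \<in> (adjacent E0)\<^sup>*" if g: "g \<in> carrier G" and "(u, w) \<in> (adjacent E0)\<^sup>*" for g u w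
    using that(2)
  proof induction
    case (step y z)
    then have "(a g y, a g z) \<in> adjacent E0" using E0 g by (simp add: adjacent_def)
    then show ?case using step.IH by (rule rtrancl.rtrancl_into_rtrancl[rotated])
  qed simp
  have flip: "(u, w) \<in> (adjacent E0)\<^sup>* \<Longrightarrow> (w, u) \<in> (adjacent E0)\<^sup>*" for u w
    using sym_rtrancl[of "adjacent E0"] adjacent_sym by (metis symI symD)
  have s: "(v0, a s v0) \<in> (adjacent E0)\<^sup>*" if "s \<in> S" for s using 1[OF that, of "a s v0"] that S v0 act_closed by auto
  show "(v0, a g v0) \<in> (adjacent E0)\<^sup>*" if "g \<in> carrier G"
    using that unfolding S(2)[symmetric]
  proof induction
    case one
    then show ?case using act_one v0 by simp
  next
    case (incl h)
    then show ?case using s by blast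
  next
    case (inv h)
    then have h: "h \<in> carrier G" using S by blast
    have "(a (inv h) v0, a (inv h) (a h v0)) \<in> (adjacent E0)\<^sup>*" using 2[of "inv h"] s[OF inv] h by simp
    then show ?case using flip act_inv h v0 by simp
  next
    case (eng g h)
    then have "g \<in> carrier G" "h \<in> carrier G" using S(2) by auto
    then have "(a g v0, a (g \<otimes> h) v0) \<in> (adjacent E0)\<^sup>*" using 2[OF _ eng.IH(2)] act_mult v0 by simp
    then show ?case using eng.IH(1) by (rule rtrancl_trans[rotated])
  qed
qed

text \<open>The translates of the finitely many geodesics from \<open>v0\<close> to
  \<open>act T s v0\<close>, with \<open>s\<close> a generator, form an invariant subtree, which by
  minimality is everything. So the edges on these geodesics represent all orbits.\<close>

lemma finitely_many_edge_orbits: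
  fixes G :: "('g, 'm) monoid_scheme" (structure) and T :: "('g, 'v) action_tree"
  assumes G: "group G" and S: "finite S" "S \<subseteq> carrier G" "generate G S = carrier G" and T: "G_tree G T"
  shows "\<exists>Q. finite Q \<and> Q \<subseteq> edges T \<and> (\<forall>e\<in>edges T. \<exists>q\<in>Q. \<exists>g\<in>carrier G. e = act T g ` q)"
proof -
  interpret gtree G "verts T" "act T" "edges T" using G_tree_gtree assms by blast
  obtain v0 where v0: "v0 \<in> verts T" using T by (auto simp: G_tree_def simplicial_tree_def)
  define I where "I s = {x \<in> verts T. btw v0 x (act T s v0)}" for s
  define Q where "Q = {e \<in> edges T. \<exists>s\<in>S. e \<subseteq> I s}"
  have sV: "act T s v0 \<in> verts T" if "s \<in> S" for s using that S v0 act_closed by blast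
  have "finite (\<Union>s\<in>S. Pow (I s))" using S(1) finite_interval[OF v0 sV] by (simp add: I_def)
  then have finQ: "finite Q" by (rule rev_finite_subset) (auto simp: Q_def)
  define E0 where "E0 = {act T g ` q | g q. g \<in> carrier G \<and> q \<in> Q}"
  \<comment> \<open>The orbit of \<open>v0\<close> keeps \<open>V0\<close> nonempty even if there
    are no edges.\<close>
  define V0 where "V0 = {act T g v0 | g. g \<in> carrier G} \<union> \<Union>E0"
  have E0I: "act T g ` q \<in> E0" if "g \<in> carrier G" "q \<in> Q" for g q using that by (auto simp: E0_def)
  have E0E: "E0 \<subseteq> edges T"
  proof
    fix e assume "e \<in> E0"
    then obtain g q where gq: "g \<in> carrier G" "q \<in> Q" "e = act T g ` q" by (auto simp: E0_def)
    then obtain u w where uw: "q = {u, w}" using edge_ends[of q] by (auto simp: Q_def)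
    then show "e \<in> edges T" using act_edge[OF gq(1), of u w] gq by (simp add: Q_def)
  qed
  have VV: "q \<subseteq> verts T" if "q \<in> edges T" for q using edge_ends[OF that] by auto
  have E0inv: "act T g ` e \<in> E0" if g: "g \<in> carrier G" and e: "e \<in> E0" for g e
  proof -
    obtain h q where h: "h \<in> carrier G" "q \<in> Q" "e = act T h ` q" using e by (auto simp: E0_def)
    have "q \<subseteq> verts T" using VV h by (simp add: Q_def)
    then have "act T g ` e = act T (g \<otimes> h) ` q"
      unfolding h(3) image_image using act_mult[OF g h(1)] by (intro image_cong) auto
    then show ?thesis using E0I g h by simp
  qed
  have QE0: "{x, y} \<in> E0" if s: "s \<in> S" and xy: "{x, y} \<in> edges T" "btw v0 x (act T s v0)" "btw v0 y (act T s v0)" for s x y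
  proof -
    have V: "x \<in> verts T" "y \<in> verts T" using edge_in_V xy by blast+
    then have "{x, y} \<in> Q" using that by (auto simp: Q_def I_def)
    then have "act T \<one> ` {x, y} \<in> E0" using E0I by blast
    then show ?thesis using V act_one by simp
  qed
  have ce: "\<forall>g\<in>carrier G. \<forall>u w. {u, w} \<in> E0 \<longrightarrow> {act T g u, act T g w} \<in> E0"
    using E0inv by (metis image_insert image_empty)
  have cq: "\<forall>s\<in>S. \<forall>x y. {x, y} \<in> edges T \<longrightarrow> btw v0 x (act T s v0) \<longrightarrow> btw v0 y (act T s v0) \<longrightarrow> {x, y} \<in> E0"
    using QE0 by blast
  note conn = generated_connected[OF S(2,3) v0 ce cq]
  have from_v0: "(v0, x) \<in> (adjacent E0)\<^sup>*" if x: "x \<in> V0" for x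
  proof (cases "x \<in> \<Union>E0")
    case True
    then obtain g q y where gq: "g \<in> carrier G" "q \<in> Q" "y \<in> q" "x = act T g y" by (auto simp: E0_def)
    then obtain s where s: "s \<in> S" "y \<in> I s" by (auto simp: Q_def)
    have "(v0, y) \<in> (adjacent E0)\<^sup>*" using conn(1)[OF s(1)] s(2) by (simp add: I_def)
    then have "(act T g v0, x) \<in> (adjacent E0)\<^sup>*" unfolding gq(4) by (intro conn(3)[OF gq(1)])
    moreover have "(v0, act T g v0) \<in> (adjacent E0)\<^sup>*" by (intro conn(2)[OF gq(1)])
    ultimately show ?thesis by (rule rtrancl_trans[rotated])
  next
    case False
    then obtain g where g: "g \<in> carrier G" "x = act T g v0" using x by (auto simp: V0_def)
    show ?thesis unfolding g(2) by (intro conn(2)[OF g(1)])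
  qed
  have flip: "(u, w) \<in> (adjacent E0)\<^sup>* \<Longrightarrow> (w, u) \<in> (adjacent E0)\<^sup>*" for u w
    using sym_rtrancl[of "adjacent E0"] adjacent_sym by (metis symI symD)
  have "cut_tree V0 E0"
  proof
    fix e assume e: "e \<in> E0"
    then obtain u w where "u \<noteq> w" "e = {u, w}" using E0E edge_ends by blast
    then show "\<exists>u\<in>V0. \<exists>w\<in>V0. u \<noteq> w \<and> e = {u, w}" using e by (auto simp: V0_def)
  next
    fix u w assume "u \<in> V0" "w \<in> V0"
    then show "(u, w) \<in> (adjacent E0)\<^sup>*" using from_v0 flip by (meson rtrancl_trans)
  next
    fix u w assume "{u, w} \<in> E0"
    then obtain S where "separates (edges T) S u w" using cut E0E by blast
    then have "separates E0 S u w" using E0E unfolding separates_def by blast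
    then show "\<exists>S. separates E0 S u w" by blast
  qed
  moreover have "V0 \<noteq> {}" by (auto simp: V0_def)
  ultimately have t: "simplicial_tree V0 E0" by (rule cut_tree_imp_simplicial_tree)
  have V0V: "V0 \<subseteq> verts T" using v0 act_closed VV E0E by (auto simp: V0_def)
  have "act T g ` V0 \<subseteq> V0 \<and> edge_act T g ` E0 \<subseteq> E0" if g: "g \<in> carrier G" for g
  proof
    show "edge_act T g ` E0 \<subseteq> E0" using E0inv[OF g] by (auto simp: edge_act_def)
    have "act T g (act T h v0) = act T (g \<otimes> h) v0" if "h \<in> carrier G" for h using act_mult g that v0 by simp
    moreover have "act T g x \<in> \<Union>E0" if "x \<in> e" "e \<in> E0" for x e using E0inv[OF g that(2)] that(1) by blast
    ultimately show "act T g ` V0 \<subseteq> V0" unfolding V0_def using g by (auto; metis m_closed)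
  qed
  then have "E0 = edges T" using T t V0V E0E unfolding G_tree_def minimal_action_def by blast
  moreover have "\<forall>e\<in>E0. \<exists>q\<in>Q. \<exists>g\<in>carrier G. e = act T g ` q"
  proof
    fix e assume "e \<in> E0"
    then obtain g q where "g \<in> carrier G" "q \<in> Q" "e = act T g ` q" unfolding E0_def by (elim CollectE exE conjE) (rule that)
    then show "\<exists>q\<in>Q. \<exists>g\<in>carrier G. e = act T g ` q" by (intro bexI)
  qed
  moreover have "Q \<subseteq> edges T" by (auto simp: Q_def)
  ultimately show ?thesis using finQ by (intro exI[of _ Q] conjI) simp_all
qed

subsection \<open>The initial state\<close>

text \<open>In each orbit of non-oriented edges one arc is chosen and its orbit declared positive;
  without inversions this orbit does not meet the reversed one. The initial labels treat the two
  ends of an edge differently and need such an orientation.\<close>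

lemma (in arcs) ex_orientation:
  "\<exists>P. (\<forall>x\<in>A. P (sw x) \<longleftrightarrow> \<not> P x) \<and> (\<forall>g\<in>carrier G. \<forall>x\<in>A. P (b g x) \<longleftrightarrow> P x)"
proof -
  have orb_eq: "orb (b g x) = orb x" if "g \<in> carrier G" "x \<in> A" for g x
  proof (rule equalityI; rule subsetI)
    fix y assume "y \<in> orb (b g x)"
    then obtain h where h: "h \<in> carrier G" "y = b h (b g x)" by (auto simp: orb_def)
    then have "y = b (h \<otimes> g) x" using that A.act_mult by simp
    then show "y \<in> orb x" using orbI h that by simp
  next
    fix y assume "y \<in> orb x"
    then obtain h where h: "h \<in> carrier G" "y = b h x" by (auto simp: orb_def)
    then have "y = b (h \<otimes> inv g) (b g x)" using that A.act_mult[of h "inv g" "b g x"] A.act_inv A.act_closed by simp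
    then show "y \<in> orb (b g x)" using orbI h that by simp
  qed
  have orb_sym: "x \<in> orb y" if "x \<in> A" "y \<in> orb x" for x y
  proof -
    have "orb y = orb x" using that orb_eq by (auto simp: orb_def[of x])
    then show ?thesis using orb_self that by simp
  qed
  define rp where "rp x = (SOME y. y \<in> orb x \<union> orb (sw x))" for x
  define P where "P x \<longleftrightarrow> x \<in> orb (rp x)" for x
  have rp: "rp x \<in> orb x \<union> orb (sw x)" if "x \<in> A" for x
    unfolding rp_def by (rule someI[of _ x]) (use orb_self[OF that] in blast)
  have rpA: "rp x \<in> A" if "x \<in> A" for x using rp[OF that] orb_sub that sw_closed by blast
  have "P (sw x) \<longleftrightarrow> \<not> P x" if x: "x \<in> A" for x
  proof -
    have eq: "rp (sw x) = rp x" unfolding rp_def by (simp add: sw_sw[OF x] Un_commute)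
    have "\<not> (P (sw x) \<and> P x)" using sw_notin_orb[OF rpA[OF x]] eq by (auto simp: P_def)
    moreover have "P (sw x) \<or> P x" using rp[OF x] orb_sym x sw_closed eq by (auto simp: P_def)
    ultimately show ?thesis by blast
  qed
  moreover have "P (b g x) \<longleftrightarrow> P x" if g: "g \<in> carrier G" and x: "x \<in> A" for g x
  proof -
    have "rp (b g x) = rp x" unfolding rp_def using sw_act[OF g x] orb_eq[OF g] x sw_closed by simp
    then show ?thesis using orb_act_iff[OF rpA[OF x] x g] by (simp add: P_def)
  qed
  ultimately show ?thesis by blast
qed

lemma slides_between_trees:
  fixes G :: "('g, 'm) monoid_scheme" (structure) and V :: "'v set"
  assumes E: "gtree G V a E" and F: "gtree G V a F"
    and fin: "\<exists>Q. finite Q \<and> Q \<subseteq> E \<and> (\<forall>e\<in>E. \<exists>q\<in>Q. \<exists>g\<in>carrier G. e = a g ` q)"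
    and na: "\<And>E v w g h. gtree G V a E \<Longrightarrow> {v, w} \<in> E \<Longrightarrow> g \<in> carrier G \<Longrightarrow> a g v = w \<Longrightarrow>
      (\<And>h. h \<in> gset.St G a v \<inter> gset.St G a w \<Longrightarrow> g \<otimes> h \<otimes> inv g \<in> gset.St G a v) \<Longrightarrow>
      h \<in> gset.St G a v \<inter> gset.St G a w \<Longrightarrow> inv g \<otimes> h \<otimes> g \<in> gset.St G a w"
  shows "(gset.slide G a)\<^sup>*\<^sup>* E F"
proof -
  interpret E: gtree G V a E by fact
  interpret F: gtree G V a F by fact
  define A where "A = {(u, w). {u, w} \<in> E}"
  define b where "b g = map_prod (a g) (a g)" for g
  have AV: "fst x \<in> V \<and> snd x \<in> V" if "x \<in> A" for x using that E.edge_in_V by (auto simp: A_def)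
  interpret A: gset G A b
  proof
    show "b g x \<in> A" if "g \<in> carrier G" "x \<in> A" for g x using that E.act_edge by (auto simp: A_def b_def)
    show "b \<one> x = x" if "x \<in> A" for x using AV[OF that] E.act_one by (cases x) (simp add: b_def)
    show "b (g \<otimes> h) x = b g (b h x)" if "g \<in> carrier G" "h \<in> carrier G" "x \<in> A" for g h x
      using AV[OF that(3)] E.act_mult that by (cases x) (simp add: b_def)
  qed
  interpret arcs G V a A b prod.swap
  proof
    show "prod.swap x \<in> A" if "x \<in> A" for x using that by (auto simp: A_def insert_commute)
    show "b g x \<noteq> prod.swap x" if gx: "g \<in> carrier G" "x \<in> A" for g x
    proof -
      obtain u w where uw: "x = (u, w)" "{u, w} \<in> E" using gx(2) by (auto simp: A_def)
      then show ?thesis using E.no_inv[OF gx(1) uw(2)] by (auto simp: b_def)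
    qed
  qed (auto simp: b_def)
  obtain Q where Q: "finite Q" "Q \<subseteq> E" "\<forall>e\<in>E. \<exists>q\<in>Q. \<exists>g\<in>carrier G. e = a g ` q"
    using fin by (elim exE conjE) (rule that)
  define R where "R = {(u, w). {u, w} \<in> Q}"
  have RA: "R \<subseteq> A" using Q(2) by (auto simp: R_def A_def)
  have "finite q" if "q \<in> Q" for q using E.edge_ends[of q] Q(2) that by auto
  then have "finite (\<Union>Q \<times> \<Union>Q)" using Q(1) by blast
  then have finR: "finite R" by (rule rev_finite_subset) (auto simp: R_def)
  have AR: "\<exists>y\<in>R. \<exists>g\<in>carrier G. x = b g y" if x: "x \<in> A" for x
  proof -
    obtain u w where uw: "x = (u, w)" "{u, w} \<in> E" using x by (auto simp: A_def)
    obtain q g where q: "q \<in> Q" "g \<in> carrier G" "{u, w} = a g ` q" using bspec[OF Q(3) uw(2)] by (elim bexE) (rule that)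
    obtain p r where pr: "q = {p, r}" using q Q(2) E.edge_ends by blast
    then have "x = b g (p, r) \<or> x = b g (r, p)" using q(3) uw(1) by (auto simp: doubleton_eq_iff b_def)
    moreover have "(p, r) \<in> R" "(r, p) \<in> R" using q(1) pr by (auto simp: R_def insert_commute)
    ultimately show ?thesis using q(2) by blast
  qed
  interpret folding G V a A b prod.swap F
  proof
    have "A \<subseteq> \<Union>(orb ` R)" using AR orbI by blast
    then show "\<exists>R. finite R \<and> R \<subseteq> A \<and> A \<subseteq> \<Union>(orb ` R)" using finR RA by blast
    fix E v w g h
    assume h: "gtree G V a E" "{v, w} \<in> E" "g \<in> carrier G" "a g v = w"
      "\<And>h. h \<in> E.St v \<inter> E.St w \<Longrightarrow> g \<otimes> h \<otimes> inv g \<in> E.St v" "h \<in> E.St v \<inter> E.St w"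
    show "inv g \<otimes> h \<otimes> g \<in> E.St w" by (rule na[OF h(1-4) h(5) h(6)])
  qed
  have Eo: "Eo fst = E"
  proof (rule equalityI; rule subsetI)
    fix e assume "e \<in> E"
    then obtain u w where "e = {u, w}" using E.edge_ends by blast
    moreover from this have "(u, w) \<in> A" using \<open>e \<in> E\<close> by (simp add: A_def)
    ultimately show "e \<in> Eo fst" using EoI[of "(u, w)" fst] by simp
  next
    fix e assume "e \<in> Eo fst"
    then obtain x where "x \<in> A" "e = {fst x, snd x}" by (auto simp: Eo_def)
    then show "e \<in> E" by (auto simp: A_def)
  qed
  have sys: "sys fst"
    unfolding sys_def Eo using AV E by (auto simp: b_def prod_eq_iff)
  obtain P where P: "\<And>x. x \<in> A \<Longrightarrow> P (prod.swap x) \<longleftrightarrow> \<not> P x" "\<And>g x. g \<in> carrier G \<Longrightarrow> x \<in> A \<Longrightarrow> P (b g x) \<longleftrightarrow> P x"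
    using ex_orientation by blast
  \<comment> \<open>The neighbour of \<open>w\<close> on the geodesic of \<open>F\<close> towards
    \<open>u\<close>.\<close>
  define nb where "nb u w = (SOME y. {w, y} \<in> F \<and> F.d w u = Suc (F.d y u))" for u w
  have nb: "{w, nb u w} \<in> F \<and> F.d w u = Suc (F.d (nb u w) u)" if "u \<in> V" "w \<in> V" "u \<noteq> w" for u w
    unfolding nb_def by (rule someI_ex) (use F.closer_ex that in blast)
  have nb_act: "nb (a g u) (a g w) = a g (nb u w)" if g: "g \<in> carrier G" and uw: "u \<in> V" "w \<in> V" "u \<noteq> w" for g u w
  proof -
    have V: "a g u \<in> V" "a g w \<in> V" "a g u \<noteq> a g w" using g uw E.act_closed E.act_inj by auto
    have n: "nb u w \<in> V" using nb[OF uw] F.edge_in_V by blast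
    have "F.d (a g w) (a g u) = Suc (F.d (a g (nb u w)) (a g u))" using nb[OF uw] F.act_gdist g uw n by simp
    moreover have "{a g w, a g (nb u w)} \<in> F" using F.act_edge g nb[OF uw] by blast
    ultimately show ?thesis using F.closer_unique[of "a g w"] nb[OF V] V by blast
  qed
  \<comment> \<open>Only the last step of the geodesic replacing a positive edge from
    \<open>u\<close> to \<open>w\<close> is the arc itself: it leads from \<open>nb u w\<close>,
    attached to \<open>u\<close>, to the root at \<open>w\<close>.\<close>
  define l where "l x = (if P x then nb (fst x) (snd x) else fst x)" for x
  \<comment> \<open>Whole geodesics are attached at both ends of each edge, so that \<open>W\<close>
    is independent of the orientation; the surplus vertices are folded away.\<close>
  define W where "W = {(u, y). u \<in> V \<and> y \<in> V \<and> (y = u \<or> (\<exists>w. {u, w} \<in> E \<and> F.btw u y w))}"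
  have support: "support W"
    unfolding support_def
  proof (intro conjI allI ballI impI)
    show "W \<subseteq> V \<times> V" "\<And>v. v \<in> V \<Longrightarrow> (v, v) \<in> W" by (auto simp: W_def)
    show "(a g v, a g y) \<in> W" if g: "g \<in> carrier G" and "(v, y) \<in> W" for g v y
    proof -
      have V: "v \<in> V" "y \<in> V" and c: "y = v \<or> (\<exists>w. {v, w} \<in> E \<and> F.btw v y w)" using that(2) by (auto simp: W_def)
      from c have "a g y = a g v \<or> (\<exists>w. {a g v, w} \<in> E \<and> F.btw (a g v) (a g y) w)"
      proof
        assume "\<exists>w. {v, w} \<in> E \<and> F.btw v y w"
        then obtain w where w: "{v, w} \<in> E" "F.btw v y w" by blast
        then have "{a g v, a g w} \<in> E" "F.btw (a g v) (a g y) (a g w)"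
          using E.act_edge g F.act_between V E.edge_in_V[OF w(1)] by auto
        then show ?thesis by blast
      qed simp
      then show ?thesis using V g E.act_closed by (auto simp: W_def)
    qed
    show "(v, z) \<in> W" if vy: "(v, y) \<in> W" and z: "z \<in> V" "F.btw v z y" for v y z
    proof -
      have V: "v \<in> V" "y \<in> V" and c: "y = v \<or> (\<exists>w. {v, w} \<in> E \<and> F.btw v y w)" using vy by (auto simp: W_def)
      from c have "z = v \<or> (\<exists>w. {v, w} \<in> E \<and> F.btw v z w)"
      proof
        assume "y = v"
        then have "F.d v z = 0" using z(2) by (simp add: between_def)
        then show ?thesis using F.gdist_eq_0 V z by simp
      next
        assume "\<exists>w. {v, w} \<in> E \<and> F.btw v y w"
        then obtain w where w: "{v, w} \<in> E" "F.btw v y w" by blast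
        then have "F.btw v z w" using F.between_trans(1)[OF w(2) z(2)] V z(1) E.edge_in_V[OF w(1)] by blast
        then show ?thesis using w by blast
      qed
      then show ?thesis using V z by (auto simp: W_def)
    qed
  qed
  have lab: "labelling fst l W"
    unfolding labelling_def
  proof (intro ballI conjI)
    fix x assume x: "x \<in> A"
    obtain u w where uw: "x = (u, w)" "{u, w} \<in> E" using x by (auto simp: A_def)
    note V = E.edge_in_V[OF uw(2)]
    show "(fst x, l x) \<in> W"
    proof (cases "P x")
      case True
      have n: "nb u w \<in> V" using nb[OF V] F.edge_in_V by blast
      have "{nb u w, w} \<in> F" using nb[OF V] by (simp add: insert_commute)
      then have "F.btw u (nb u w) w" using F.between_adjI nb[OF V] between_sym by metis
      then show ?thesis using True uw V n by (auto simp: W_def l_def)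
    next
      case False
      then show ?thesis using uw V by (simp add: W_def l_def)
    qed
    have wu: "w \<noteq> u" using V by simp
    show "{l x, l (prod.swap x)} \<in> F"
      using P(1)[OF x] nb[OF V] nb[OF V(2,1) wu] uw(1) by (auto simp: l_def insert_commute)
    fix g assume g: "g \<in> carrier G"
    show "l (b g x) = a g (l x)" using P(2)[OF g x] nb_act[OF g V] uw(1) by (simp add: l_def b_def)
  qed
  have "orbs W \<subseteq> orb2 ` (\<Union>x\<in>R. {fst x} \<times> {y \<in> V. F.btw (fst x) y (snd x)})"
  proof
    fix O1 assume "O1 \<in> orbs W"
    then obtain u y where uy: "(u, y) \<in> W" "u \<noteq> y" "O1 = orb2 (u, y)" by (auto simp: orbs_def ext_def)
    then obtain w where w: "{u, w} \<in> E" "F.btw u y w" "u \<in> V" "y \<in> V" by (auto simp: W_def)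
    obtain u' w' g where u': "(u', w') \<in> R" "g \<in> carrier G" "u = a g u'" "w = a g w'"
      using AR[of "(u, w)"] w(1) by (auto simp: A_def b_def)
    have V: "u' \<in> V" "w' \<in> V" using AV[of "(u', w')"] u'(1) RA by auto
    define y' where "y' = a (inv g) y"
    have y': "y' \<in> V" "y = a g y'" using E.act_closed E.act_inv w u'(2) by (auto simp: y'_def)
    have "F.btw u' y' w'" using F.act_between[OF u'(2) V(1) y'(1) V(2)] w(2) u' y' by simp
    moreover have "orb2 (u', y') = orb2 (u, y)"
    proof (rule equalityI; rule subsetI)
      fix p assume "p \<in> orb2 (u', y')"
      then obtain h where h: "h \<in> carrier G" "p = (a h u', a h y')" by (auto simp: orb2_def)
      have "u' = a (inv g) u" "y' = a (inv g) y" using E.act_inv u' V by (auto simp: y'_def)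
      then have "p = (a (h \<otimes> inv g) u, a (h \<otimes> inv g) y)" using h E.act_mult u'(2) w by simp
      then show "p \<in> orb2 (u, y)" using h u'(2) by (auto simp: orb2_def)
    next
      fix p assume "p \<in> orb2 (u, y)"
      then obtain h where h: "h \<in> carrier G" "p = (a h u, a h y)" by (auto simp: orb2_def)
      then have "p = (a (h \<otimes> g) u', a (h \<otimes> g) y')" using E.act_mult u' V y' by simp
      then show "p \<in> orb2 (u', y')" using h u'(2) by (auto simp: orb2_def)
    qed
    ultimately show "O1 \<in> orb2 ` (\<Union>x\<in>R. {fst x} \<times> {y \<in> V. F.btw (fst x) y (snd x)})"
      using u'(1) uy(3) y'(1) by (intro image_eqI[of _ _ "(u', y')"]) force+
  qed
  moreover have "finite (\<Union>x\<in>R. {fst x} \<times> {y \<in> V. F.btw (fst x) y (snd x)})"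
    using finR F.finite_interval AV RA by (intro finite_UN_I finite_cartesian_product) auto
  ultimately have "finite (orbs W)" by (meson finite_imageI finite_subset)
  then have "E.slide\<^sup>*\<^sup>* (Eo fst) F" using slides_to_target[of fst l W] sys support lab by (simp add: state_def)
  then show ?thesis using Eo by simp
qed

subsection \<open>Comparing the vertices of two trees\<close>

lemma (in gset) St_subgroup: assumes "x \<in> V" shows "subgroup (St x) G"
proof (rule subgroupI)
  show "St x \<noteq> {}" using act_one[OF assms] by (auto simp: St_def)
  show "inv g \<in> St x" if "g \<in> St x" for g using St_inv that assms by blast
  show "g \<otimes> h \<in> St x" if "g \<in> St x" "h \<in> St x" for g h using that act_mult assms by (auto simp: St_def)
qed (auto simp: St_def)

text \<open>Passing from a stabilizer in one set to a larger one in the other and back, maximality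
  turns the inclusions into equalities, so the same subgroups occur in both sets. Vertices with
  equal stabilizers lie in one orbit, again by maximality; hence matching orbit representatives with
  equal stabilizers gives a bijection.\<close>

lemma ex_equivariant_bijection:
  fixes G :: "('g, 'm) monoid_scheme" (structure)
  assumes V: "gset G V a" "gset.maximal_stabilizers G V a" and V': "gset G V' a'" "gset.maximal_stabilizers G V' a'"
    and VV': "\<And>v. v \<in> V \<Longrightarrow> \<exists>u\<in>V'. gset.St G a v \<subseteq> gset.St G a' u"
    and V'V: "\<And>u. u \<in> V' \<Longrightarrow> \<exists>v\<in>V. gset.St G a' u \<subseteq> gset.St G a v"
  shows "\<exists>f. bij_betw f V V' \<and> (\<forall>g\<in>carrier G. \<forall>v\<in>V. f (a g v) = a' g (f v))"
proof -
  interpret gset G V a by (rule V(1))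
  interpret B: gset G V' a' by (rule V'(1))
  have ex: "\<exists>u\<in>V'. B.St u = St v" if v: "v \<in> V" for v
  proof -
    obtain u where u: "u \<in> V'" "St v \<subseteq> B.St u" using VV' v by blast
    obtain w where w: "w \<in> V" "B.St u \<subseteq> St w" using V'V u by blast
    have "St w \<subseteq> St v" using V(2) v w u unfolding maximal_stabilizers_def by blast
    then show ?thesis using u w by blast
  qed
  have ex': "\<exists>v\<in>V. St v = B.St u" if u: "u \<in> V'" for u
  proof -
    obtain v where v: "v \<in> V" "B.St u \<subseteq> St v" using V'V u by blast
    obtain w where w: "w \<in> V'" "St v \<subseteq> B.St w" using VV' v by blast
    have "B.St w \<subseteq> B.St u" using V'(2) v w u unfolding B.maximal_stabilizers_def by blast
    then show ?thesis using v w by blast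
  qed
  define orbit where "orbit v = {a g v | g. g \<in> carrier G}" for v
  define rp where "rp v = (SOME y. y \<in> orbit v)" for v
  define t where "t y = (SOME u. u \<in> V' \<and> B.St u = St y)" for y
  define f where "f v = a' (SOME g. g \<in> carrier G \<and> v = a g (rp v)) (t (rp v))" for v
  have orbit_act: "orbit (a g v) = orbit v" if g: "g \<in> carrier G" and v: "v \<in> V" for g v
  proof (rule equalityI; rule subsetI)
    fix x assume "x \<in> orbit (a g v)"
    then obtain h where h: "h \<in> carrier G" "x = a h (a g v)" by (auto simp: orbit_def)
    then have "x = a (h \<otimes> g) v" using g v act_mult by simp
    then show "x \<in> orbit v" using h g by (auto simp: orbit_def)
  next
    fix x assume "x \<in> orbit v"
    then obtain h where h: "h \<in> carrier G" "x = a h v" by (auto simp: orbit_def)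
    then have "x = a (h \<otimes> inv g) (a g v)" using g v act_mult[of h "inv g" "a g v"] act_inv act_closed by simp
    then show "x \<in> orbit (a g v)" using h g by (auto simp: orbit_def)
  qed
  have rp_act: "rp (a g v) = rp v" if "g \<in> carrier G" "v \<in> V" for g v using orbit_act[OF that] by (simp add: rp_def)
  have rp: "\<exists>k\<in>carrier G. rp v \<in> V \<and> v = a k (rp v)" if v: "v \<in> V" for v
  proof -
    have "rp v \<in> orbit v" unfolding rp_def
      by (rule someI[of _ v]) (use act_one[OF v] in \<open>force simp: orbit_def\<close>)
    then obtain h where h: "h \<in> carrier G" "rp v = a h v" by (auto simp: orbit_def)
    then show ?thesis using act_inv[OF h(1) v] act_closed[OF h(1) v] by (intro bexI[of _ "inv h"]) auto
  qed
  have t: "t y \<in> V'" "B.St (t y) = St y" if "y \<in> V" for y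
  proof -
    have "t y \<in> V' \<and> B.St (t y) = St y" unfolding t_def by (rule someI_ex) (use ex that in blast)
    then show "t y \<in> V'" "B.St (t y) = St y" by auto
  qed
  have f: "f v = a' k (t (rp v))" if v: "v \<in> V" and k: "k \<in> carrier G" "v = a k (rp v)" for v k
  proof -
    define g where "g = (SOME g. g \<in> carrier G \<and> v = a g (rp v))"
    have "g \<in> carrier G \<and> v = a g (rp v)" unfolding g_def by (rule someI[of _ k]) (use k in blast)
    then have g: "g \<in> carrier G" "a g (rp v) = a k (rp v)" using k by auto
    have y: "rp v \<in> V" using rp v by blast
    then have "inv k \<otimes> g \<in> B.St (t (rp v))" using act_eq_iff[OF g(1) k(1) y y] g k(1) t(2)[OF y] by (simp add: St_def)
    then have "a' g (t (rp v)) = a' k (t (rp v))" using B.act_eq_iff[OF g(1) k(1)] t[OF y] by (simp add: B.St_def)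
    then show ?thesis by (simp add: f_def g_def)
  qed
  have eq: "f (a g v) = a' g (f v)" if g: "g \<in> carrier G" and v: "v \<in> V" for g v
  proof -
    obtain k where k: "k \<in> carrier G" "rp v \<in> V" "v = a k (rp v)" using rp v by blast
    have "a g v = a (g \<otimes> k) (rp (a g v))" using act_mult[OF g k(1,2)] k(3) rp_act[OF g v] by simp
    then have "f (a g v) = a' (g \<otimes> k) (t (rp v))"
      using f[OF act_closed[OF g v], of "g \<otimes> k"] g k(1) rp_act[OF g v] by simp
    also have "\<dots> = a' g (f v)" using B.act_mult[OF g k(1)] t(1)[OF k(2)] f[OF v k(1,3)] by simp
    finally show ?thesis .
  qed
  have fV: "f v \<in> V'" and fSt: "B.St (f v) = St v" if v: "v \<in> V" for v
  proof -
    obtain k where k: "k \<in> carrier G" "rp v \<in> V" "v = a k (rp v)" using rp v by blast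
    show "f v \<in> V'" using f[OF v k(1,3)] t(1)[OF k(2)] B.act_closed k by simp
    have "B.St (f v) = St (a k (rp v))"
      unfolding f[OF v k(1,3)] B.St_image_conj[OF k(1) t(1)[OF k(2)], symmetric] St_image_conj[OF k(1,2), symmetric]
      using t(2)[OF k(2)] by simp
    then show "B.St (f v) = St v" using k(3) by simp
  qed
  have "inj_on f V"
  proof (rule inj_onI)
    fix v w assume vw: "v \<in> V" "w \<in> V" "f v = f w"
    then have "St v \<subseteq> St w" using fSt[OF vw(1)] fSt[OF vw(2)] by simp
    then obtain g where g: "g \<in> carrier G" "w = a g v" using V(2) vw unfolding maximal_stabilizers_def by blast
    then have "g \<in> B.St (f v)" using eq vw by (simp add: B.St_def)
    then show "v = w" using fSt[OF vw(1)] g by (simp add: St_def)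
  qed
  moreover have "f ` V = V'"
  proof (rule equalityI; rule subsetI)
    fix u assume u: "u \<in> V'"
    obtain v where v: "v \<in> V" "St v = B.St u" using ex' u by blast
    then have "B.St (f v) \<subseteq> B.St u" using fSt by simp
    then obtain g where g: "g \<in> carrier G" "u = a' g (f v)"
      using V'(2) u fV[OF v(1)] unfolding B.maximal_stabilizers_def by blast
    then show "u \<in> f ` V" using eq[OF g(1) v(1)] act_closed[OF g(1) v(1)] by (intro image_eqI[of _ _ "a g v"]) simp_all
  qed (use fV in blast)
  ultimately show ?thesis using eq by (auto simp: bij_betw_def)
qed

subsection \<open>Slide moves\<close>

text \<open>All stages are trees without inversions, so \<open>edge_stabilizer\<close> is the
  intersection of the stabilizers of the ends throughout.\<close>

lemma slide_moves:
  fixes G :: "('g, 'm) monoid_scheme" (structure) and T :: "('g, 'v) action_tree"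
  assumes "gtree G (verts T) (act T) E" "(gset.slide G (act T))\<^sup>*\<^sup>* E F"
  shows "(slide_move G)\<^sup>*\<^sup>* (T\<lparr>edges := E\<rparr>) (T\<lparr>edges := F\<rparr>)"
proof -
  have "gtree G (verts T) (act T) F \<and> (slide_move G)\<^sup>*\<^sup>* (T\<lparr>edges := E\<rparr>) (T\<lparr>edges := F\<rparr>)"
    using assms(2)
  proof induction
    case (step F F')
    interpret gtree G "verts T" "act T" F using step.IH by blast
    obtain v w x where s: "slidable F v w x" "F' = slide_edges F v w x" using step.hyps(2) by (auto simp: slide_def)
    have e: "{v, w} \<in> F" "{v, x} \<in> F" using s by (auto simp: slidable_def)
    have orbit: "orbit G (edge_act (T\<lparr>edges := F\<rparr>)) {y, z} = orbE y z" for y z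
      by (simp add: orbit_def orbE_def edge_act_def)
    have "edge_stabilizer G (T\<lparr>edges := F\<rparr>) {v, x} = St v \<inter> St x" "edge_stabilizer G (T\<lparr>edges := F\<rparr>) {v, w} = St v \<inter> St w"
      by (rule edge_stabilizer_eq[OF gtree_axioms]; simp add: e edge_act_def)+
    then have "slide_move G (T\<lparr>edges := F\<rparr>) (T\<lparr>edges := F'\<rparr>)"
      using s unfolding slide_move_def slidable_def slide_edges_def
      by (intro exI[of _ v] exI[of _ w] exI[of _ x]) (simp add: orbit)
    then show ?case using step.IH slide_tree[OF s(1)] s(2) by (auto intro: rtranclp.rtrancl_into_rtrancl)
  qed (use assms(1) in simp)
  then show ?thesis by blast
qed

lemma irreducible_tree_infinite:
  assumes "irreducible_tree G T" "cut_tree (verts T) (edges T)"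
  shows "infinite (verts T)"
proof -
  obtain p :: "int \<Rightarrow> _" where p: "inj p" "\<forall>n. {p n, p (n + 1)} \<in> edges T"
    using assms(1) unfolding irreducible_tree_def translation_axis_def by blast
  then have "range p \<subseteq> verts T" using cut_tree.edge_in_V(1)[OF assms(2)] by blast
  moreover have "infinite (range p)" using finite_imageD[OF _ p(1)] infinite_UNIV_int by blast
  ultimately show ?thesis using finite_subset by blast
qed

theorem theorem7p2:
  fixes G :: "('g, 'm) monoid_scheme"
    and D :: "('g, 'v) action_tree set"
    and T T' :: "('g, 'v) action_tree"
  assumes "group G"
    and "\<exists>S. finite S \<and> S \<subseteq> carrier G \<and> generate G S = carrier G"
    and "is_deformation_space G D"
    and "non_ascending G D"
    and "T \<in> D" and "T' \<in> D"
    and "reduced G T" and "reduced G T'"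
  shows "connected_by_slides G T T'"
proof -
  note G = assms(1)
  obtain S where S: "finite S" "S \<subseteq> carrier G" "generate G S = carrier G" using assms(2) by blast
  have D: "D = deformation_space G T" and T: "G_tree G T" and T': "G_tree G T'"
    and ell: "\<And>H. subgroup H G \<Longrightarrow> elliptic T H \<longleftrightarrow> elliptic T' H"
    using assms(3,5,6) by (auto simp: is_deformation_space_def deformation_space_def)
  have na: "\<not> (\<exists>y. strict_ascending_loop (quotient_graph_of_groups G T) y)" if "T \<in> D" for T
    using assms(4) that by (auto simp: non_ascending_def)
  interpret T: gtree G "verts T" "act T" "edges T" using G_tree_gtree[OF G T] .
  interpret T': gtree G "verts T'" "act T'" "edges T'" using G_tree_gtree[OF G T'] .
  have m: T.maximal_stabilizers using reduced_maximal_stabilizers[OF G T na[OF assms(5)] assms(7)] .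
  have m': T'.maximal_stabilizers using reduced_maximal_stabilizers[OF G T' na[OF assms(6)] assms(8)] .
  have "irreducible_tree G T" using assms(4,5) by (auto simp: non_ascending_def)
  then have inf: "infinite (verts T)" using irreducible_tree_infinite T.cut_tree_axioms by blast
  have "\<exists>f. bij_betw f (verts T) (verts T') \<and> (\<forall>g\<in>carrier G. \<forall>v\<in>verts T. f (act T g v) = act T' g (f v))"
  proof (rule ex_equivariant_bijection[OF T.gset_axioms m T'.gset_axioms m'])
    fix v assume v: "v \<in> verts T"
    have "elliptic T (T.St v)" using v by (auto simp: elliptic_def T.St_def)
    then have "elliptic T' (T.St v)" using ell T.St_subgroup[OF v] by simp
    then show "\<exists>u\<in>verts T'. T.St v \<subseteq> T'.St u" by (auto simp: elliptic_def T.St_def T'.St_def)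
  next
    fix u assume u: "u \<in> verts T'"
    have "elliptic T' (T'.St u)" using u by (auto simp: elliptic_def T'.St_def)
    then have "elliptic T (T'.St u)" using ell T'.St_subgroup[OF u] by simp
    then show "\<exists>v\<in>verts T. T'.St u \<subseteq> T.St v" by (auto simp: elliptic_def T.St_def T'.St_def)
  qed
  then obtain f where f: "bij_betw f (verts T) (verts T')"
    and eq: "\<And>g v. g \<in> carrier G \<Longrightarrow> v \<in> verts T \<Longrightarrow> f (act T g v) = act T' g (f v)" by blast
  define k where "k = inv_into (verts T) f"
  have k: "k u \<in> verts T" "f (k u) = u" if "u \<in> verts T'" for u
    using that f by (auto simp: k_def bij_betw_def inv_into_into f_inv_into_f)
  have kf: "k (f v) = v" if "v \<in> verts T" for v using that f by (simp add: k_def bij_betw_def)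
  have kT: "k ` verts T' = verts T" using f bij_betw_inv_into[OF f] by (simp add: k_def bij_betw_def)
  define F where "F = (`) k ` edges T'"
  have F: "gtree G (verts T) (act T) F"
    unfolding F_def kT[symmetric]
  proof (rule T'.transport_gtree)
    show "act T g (k u) = k (act T' g u)" if "g \<in> carrier G" "u \<in> verts T'" for g u
      using eq[of g "k u"] k[OF that(2)] kf[of "act T g (k u)"] T.act_closed that(1) by simp
    show "inj_on k (verts T')" by (rule inj_on_inverseI[of _ f]) (use k in blast)
  qed
  have "T.slide\<^sup>*\<^sup>* (edges T) F"
  proof (rule slides_between_trees[OF T.gtree_axioms F finitely_many_edge_orbits[OF G S T]])
    fix E v w g h
    assume h: "gtree G (verts T) (act T) E" "{v, w} \<in> E" "g \<in> carrier G" "act T g v = w"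
      "\<And>h. h \<in> T.St v \<inter> T.St w \<Longrightarrow> g \<otimes>\<^bsub>G\<^esub> h \<otimes>\<^bsub>G\<^esub> inv\<^bsub>G\<^esub> g \<in> T.St v" "h \<in> T.St v \<inter> T.St w"
    show "inv\<^bsub>G\<^esub> g \<otimes>\<^bsub>G\<^esub> h \<otimes>\<^bsub>G\<^esub> g \<in> T.St w"
      by (rule ascending_edge_in_deformation_space[OF G T m na[unfolded D] inf h(1-5) h(6)])
  qed
  then have "(slide_move G)\<^sup>*\<^sup>* T (T\<lparr>edges := F\<rparr>)" using slide_moves[OF T.gtree_axioms] by simp
  moreover have "equivariantly_isomorphic G (T\<lparr>edges := F\<rparr>) T'"
  proof -
    have "f ` k ` e = e" if e: "e \<in> edges T'" for e
    proof -
      obtain u w where "e = {u, w}" "u \<in> verts T'" "w \<in> verts T'" using T'.edge_ends[OF e] by blast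
      then show ?thesis using k by simp
    qed
    then have "(`) f ` F = edges T'" unfolding F_def image_image by simp
    then show ?thesis using f eq by (auto simp: equivariantly_isomorphic_def)
  qed
  ultimately show ?thesis by (auto simp: connected_by_slides_def)
qed

end
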